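(* Let $m\ge 1$ be an integer. For every $s\in\Delta$ the measure $\mu_s^{\mathbb{C}}$ belongs to $\mathcal{P}_{\mathrm{erg}}(\mathcal{M}^{\mathbb{C}})$, and the map $s\mapsto\mu_s^{\mathbb{C}}$ is a homeomorphism from $\Delta$ onto $\mathcal{P}_{\mathrm{erg}}(\mathcal{M}^{\mathbb{C}})$.
   Context: Let $\mathbb{N}=\{1,2,\dots\}$ and fix an integer $m\ge 1$. Let $\mathcal{M}^{\mathbb{C}}=\mathrm{Mat}(\mathbb{N}\times m,\mathbb{C})=\{[X_{ij}]_{i\in\mathbb{N},1\le j\le m}: X_{ij}\in\mathbb{C}\}$, with the product topology (a Polish space). $U(\infty)$ is the inductive limit of the compact unitary groups $U(1)\subset U(2)\subset\cdots$, that is, the group of infinite unitary matrices $u=[u_{ij}]_{i,j\in\mathbb{N}}$ such that $u_{ij}=\delta_{ij}$ when $i+j$ is large enough. The group $U(\infty)\times U(m)$ acts on $\mathcal{M}^{\mathbb{C}}$ by $((u,v),X)\mapsto uXv^{-1}$. A $U(\infty)\times U(m)$-invariant Borel probability measure $\mu$ on $\mathcal{M}^{\mathbb{C}}$ is called ergodic if for every $U(\infty)\times U(m)$-invariant Borel subset $\mathcal{A}\subset\mathcal{M}^{\mathbb{C}}$ either $\mu(\mathcal{A})=0$ or $\mu(\mathcal{M}^{\mathbb{C}}\setminus\mathcal{A})=0$. $\mathcal{P}_{\mathrm{erg}}(\mathcal{M}^{\mathbb{C}})$ is the set of ergodic $U(\infty)\times U(m)$-invariant Borel probability measures on $\mathcal{M}^{\mathbb{C}}$,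 with the topology induced by the topology of weak convergence of probability measures (convergence of integrals of bounded continuous functions). $\Delta=\{s=(s_1,\dots,s_m)\in\mathbb{R}^m: s_1\ge\cdots\ge s_m\ge 0\}$, with the topology induced from $\mathbb{R}^m$. Let $G_{\mathbb{C}}=[g^{\mathbb{C}}_{ij}]_{i\in\mathbb{N},1\le j\le m}$ be a random matrix with independent standard complex Gaussian entries (real and imaginary parts independent centered real Gaussians of variance $1/2$), and let $\mathcal{U}$ be a Haar-distributed random matrix in $U(m)$, independent of $G_{\mathbb{C}}$. For $s\in\Delta$, $\mu_s^{\mathbb{C}}$ is the probability distribution on $\mathcal{M}^{\mathbb{C}}$ of the random matrix $G_{\mathbb{C}}\cdot\mathrm{diag}(s_1,\dots,s_m)\cdot\mathcal{U}$. *)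

theory Defs
  imports "HOL-Probability.Probability"
begin

text \<open>
  The index set \<open>{1,\<dots>,m}\<close> is a type \<open>'m\<close> that is finite and, where the order of the coordinates
  matters, linearly ordered; \<open>m = CARD('m) \<ge> 1\<close>.  The index set of the rows is \<^typ>\<open>nat\<close>, starting at 0.
  The topology of a function type, hence of \<open>'m inf_mat\<close>, is the product topology.
\<close>

type_synonym 'm inf_mat = "nat \<Rightarrow> complex ^ 'm"

definition mat_mult_right :: "'m::finite inf_mat \<Rightarrow> complex ^ 'm ^ 'm \<Rightarrow> 'm inf_mat" where
  "mat_mult_right X A = (\<lambda>i. X i v* A)"

text \<open>
  A matrix \<open>u\<close> in \<open>U(\<infinity>)\<close> has finitely many nonzero entries in each row and in each column, so
  the sums over the supports below are finite.
\<close>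

definition mat_mult_left :: "(nat \<Rightarrow> nat \<Rightarrow> complex) \<Rightarrow> 'm::finite inf_mat \<Rightarrow> 'm inf_mat" where
  "mat_mult_left u X = (\<lambda>i. \<chi> j. \<Sum>k | u i k \<noteq> 0. u i k * X k $ j)"

definition unitary_inf :: "(nat \<Rightarrow> nat \<Rightarrow> complex) set" where
  "unitary_inf = {u.
     (\<exists>N. \<forall>i j. i + j \<ge> N \<longrightarrow> u i j = (if i = j then 1 else 0)) \<and>
     (\<forall>i j. (\<Sum>k | u i k \<noteq> 0. u i k * cnj (u j k)) = (if i = j then 1 else 0)) \<and>
     (\<forall>i j. (\<Sum>k | u k i \<noteq> 0. cnj (u k i) * u k j) = (if i = j then 1 else 0))}"

definition conj_transpose :: "complex ^ 'm ^ 'm \<Rightarrow> complex ^ 'm ^ 'm" where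
  "conj_transpose A = (\<chi> i j. cnj (A $ j $ i))"

definition unitary_group :: "(complex ^ 'm::finite ^ 'm) set" where
  "unitary_group = {v. v ** conj_transpose v = mat 1 \<and> conj_transpose v ** v = mat 1}"

definition unitary_act ::
    "(nat \<Rightarrow> nat \<Rightarrow> complex) \<times> (complex ^ 'm ^ 'm) \<Rightarrow> 'm::finite inf_mat \<Rightarrow> 'm inf_mat" where
  "unitary_act = (\<lambda>(u, v) X. mat_mult_right (mat_mult_left u X) (matrix_inv v))"

definition borel_prob_measures :: "'a::topological_space measure set" where
  "borel_prob_measures = {\<mu>. sets \<mu> = sets borel \<and> prob_space \<mu>}"

definition invariant_measure :: "'m::finite inf_mat measure \<Rightarrow> bool" where
  "invariant_measure \<mu> \<longleftrightarrow>
     (\<forall>g \<in> unitary_inf \<times> unitary_group. distr \<mu> borel (unitary_act g) = \<mu>)"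

definition invariant_set :: "'m::finite inf_mat set \<Rightarrow> bool" where
  "invariant_set A \<longleftrightarrow> (\<forall>g \<in> unitary_inf \<times> unitary_group. unitary_act g ` A = A)"

definition ergodic_measures :: "'m::finite inf_mat measure set" where
  "ergodic_measures = {\<mu> \<in> borel_prob_measures. invariant_measure \<mu> \<and>
     (\<forall>A \<in> sets borel. invariant_set A \<longrightarrow> emeasure \<mu> A = 0 \<or> emeasure \<mu> (UNIV - A) = 0)}"

text \<open>
  The coarsest topology on the Borel probability measures for which integration of every bounded
  continuous real function is continuous.
\<close>

definition weak_topology :: "'a::topological_space measure topology" where
  "weak_topology = pullback_topology borel_prob_measures
     (\<lambda>\<mu> (f :: 'a \<Rightarrow>\<^sub>C real). \<integral>x. apply_bcontfun f x \<partial>\<mu>) euclidean"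

definition ordered_cone :: "(real ^ 'm::{finite,linorder}) set" where
  "ordered_cone = {s. (\<forall>i j. i \<le> j \<longrightarrow> s $ j \<le> s $ i) \<and> (\<forall>i. 0 \<le> s $ i)}"

text \<open>The second argument of \<^const>\<open>normal_density\<close> is the standard deviation.\<close>

definition complex_gaussian :: "complex measure" where
  "complex_gaussian =
     (let N = density lborel (normal_density 0 (sqrt (1 / 2)))
      in distr (N \<Otimes>\<^sub>M N) borel (\<lambda>(x, y). Complex x y))"

definition gaussian_matrix :: "'m::finite inf_mat measure" where
  "gaussian_matrix =
     distr (Pi\<^sub>M (UNIV :: (nat \<times> 'm) set) (\<lambda>_. complex_gaussian)) borel
       (\<lambda>w i. \<chi> j. w (i, j))"

definition haar_unitary :: "(complex ^ 'm::finite ^ 'm) measure" where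
  "haar_unitary = (THE \<nu>. sets \<nu> = sets (restrict_space borel unitary_group) \<and> prob_space \<nu> \<and>
     (\<forall>v \<in> unitary_group. distr \<nu> \<nu> (\<lambda>w. v ** w) = \<nu>))"

definition diag_mat :: "real ^ 'm \<Rightarrow> complex ^ 'm ^ 'm" where
  "diag_mat s = (\<chi> i j. if i = j then complex_of_real (s $ i) else 0)"

definition mu :: "real ^ 'm::finite \<Rightarrow> 'm inf_mat measure" where
  "mu s = distr (gaussian_matrix \<Otimes>\<^sub>M haar_unitary) borel
     (\<lambda>(G, w). mat_mult_right (mat_mult_right G (diag_mat s)) w)"

end

theory Submission
  imports Defs
begin

text \<open>
  Let \<open>\<mu>\<close> be an invariant measure and let \<open>S\<^sub>n(X) = X\<^sub>n\<^sup>* X\<^sub>n / n\<close>, where \<open>X\<^sub>n\<close> consists of the first \<open>n\<close> rows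
  of \<open>X\<close>.  Invariance under \<open>U(\<infinity>)\<close> means that the characteristic function of \<open>\<mu>\<close> at \<open>T\<close> depends only on
  the Gram matrix \<open>T\<^sup>* T\<close>.  Evaluate it at \<open>G A / \<surd>n\<close>, with \<open>G\<close> an independent Gaussian \<open>n \<times> m\<close> matrix: the Gram
  matrix tends to \<open>A\<^sup>* A\<close> by the law of large numbers, while conditionally on \<open>X\<close> the average over \<open>G\<close> is
  \<open>exp (- tr (A S\<^sub>n A\<^sup>*) / 4)\<close>.  Two independent Gaussian matrices show in the same way that these random variables
  are Cauchy in \<open>L\<^sup>2\<close>, so \<open>S\<^sub>n\<close> converges almost surely along a subsequence to some \<open>S\<close>, and \<open>\<mu>\<close> is determined
  by the law of \<open>S\<close>.

  If \<open>\<mu>\<close> is ergodic, then the spectrum of \<open>S\<close> is an invariant function, hence constant, and \<open>U(m)\<close>-invariance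
  gives \<open>\<mu> = \<mu>\<^sub>s\<close> with \<open>s\<close> the square roots of the eigenvalues.  Conversely, a measure \<open>\<mu>\<^sub>s\<close> conditioned on an
  invariant event has the same limit spectrum, so it is again \<open>\<mu>\<^sub>s\<close>.  Finally
  \<open>\<integral> exp (- t |X\<^sub>0|\<^sup>2) d\<mu>\<^sub>s = \<Prod>\<^sub>j 1 / (1 + t s\<^sub>j\<^sup>2)\<close> for the first row \<open>X\<^sub>0\<close>; these weakly continuous functionals
  determine \<open>s\<close> and bound it, which makes the inverse map continuous.
\<close>

section \<open>Characteristic functions determine measures\<close>

text \<open>Ergodicity fixes only the spectrum of the limit \<open>S\<close>, not \<open>S\<close>
  itself. The remaining rotation is averaged out by right invariance, which requires Haar measure
  and its invariance under inversion; as it is given by a definite description, existence and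
  uniqueness have to be established, and the polar part of a Gaussian matrix conditioned to be
  nearly unitary provides it. Convergence in \<open>L^2\<close> concerns only the bounded functions
  exp(-form/4), so a limiting form could a priori be infinite; continuity of the characteristic
  function at 0 excludes this. The heights are powers of 2 because the variances in the law of large
  numbers are then summable along any choice of heights \<open>2 ^ a j\<close> with
  \<open>a j \<ge> j\<close>. That characteristic functions determine measures is reduced to one
  dimension by trading exponentials for indicators, one coordinate at a time. The spectrum is
  encoded by det(1 + t S) at natural \<open>t\<close>; for eigenvalues \<open>s_j^2\<close> this is
  the reciprocal of the functional of the first row, so that one injectivity lemma serves both the
  classification and the homeomorphism.\<close>

lemma measurable_cnj [measurable]: "cnj \<in> borel_measurable borel"
  by (intro borel_measurable_continuous_onI continuous_intros)

text \<open>Division by the total mass turns the weighted law of \<open>X\<close> into a probability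
  measure, to which Levy uniqueness applies. The bounds 1 and 3 are chosen for weights
  \<open>2 + u\<close> with \<open>|u| \<le> 1\<close>; they keep the weight integrable and its mass
  away from 0.\<close>

lemma weighted_distribution_eqI:
  fixes X :: "'a \<Rightarrow> real" and Y :: "'b \<Rightarrow> real" and f :: "'a \<Rightarrow> real" and g :: "'b \<Rightarrow> real"
  assumes "prob_space M" "prob_space N"
    and [measurable]: "X \<in> borel_measurable M" "Y \<in> borel_measurable N"
      "f \<in> borel_measurable M" "g \<in> borel_measurable N" "B \<in> sets borel"
    and f: "\<And>x. x \<in> space M \<Longrightarrow> 1 \<le> f x \<and> f x \<le> 3" and g: "\<And>x. x \<in> space N \<Longrightarrow> 1 \<le> g x \<and> g x \<le> 3"
    and eq: "\<And>t. (\<integral>x. f x *\<^sub>R iexp (t * X x) \<partial>M) = (\<integral>x. g x *\<^sub>R iexp (t * Y x) \<partial>N)"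
  shows "(\<integral>x. f x * indicator B (X x) \<partial>M) = (\<integral>x. g x * indicator B (Y x) \<partial>N)"
proof -
  have *: "\<exists>D c. real_distribution D \<and> c > 0 \<and>
      c = (\<integral>x. f x \<partial>M) \<and>
      (\<forall>t. char D t = (\<integral>x. f x *\<^sub>R iexp (t * X x) \<partial>M) / c) \<and>
      measure D B = (\<integral>x. f x * indicator B (X x) \<partial>M) / c"
    if "prob_space M" and [measurable]: "X \<in> borel_measurable M" "f \<in> borel_measurable M" "B \<in> sets borel"
      and f: "\<And>x. x \<in> space M \<Longrightarrow> 1 \<le> f x \<and> f x \<le> 3"
    for X :: "'c \<Rightarrow> real" and f :: "'c \<Rightarrow> real" and M B
  proof -
    interpret prob_space M by fact
    define c where "c = (\<integral>x. f x \<partial>M)"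
    have int: "integrable M f"
      by (rule integrable_const_bound[where B=3]) (use f in \<open>auto intro!: AE_I2 simp: abs_le_iff, fastforce\<close>)
    have "(\<integral>x. 1 \<partial>M) \<le> c" unfolding c_def
      by (intro integral_mono_AE int) (use f in auto)
    hence c: "c \<ge> 1" by (simp add: prob_space)
    define E where "E = density M (\<lambda>x. ennreal (f x / c))"
    have nn: "AE x in M. 0 \<le> f x / c" using f c by (auto intro!: AE_I2 divide_nonneg_nonneg) (meson order_trans zero_le_one)
    have [measurable]: "X \<in> borel_measurable E" by (simp add: E_def)
    have E: "prob_space E"
    proof
      have "emeasure E (space E) = (\<integral>\<^sup>+x. ennreal (f x / c) \<partial>M)"
        by (simp add: E_def emeasure_density cong: nn_integral_cong)
      also have "\<dots> = ennreal (\<integral>x. f x / c \<partial>M)"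
        using int nn by (intro nn_integral_eq_integral) auto
      also have "(\<integral>x. f x / c \<partial>M) = 1" using c by (simp add: c_def)
      finally show "emeasure E (space E) = 1" by simp
    qed
    interpret E: prob_space E by fact
    define D where "D = distr E borel X"
    have D: "real_distribution D"
      unfolding D_def by (intro E.real_distribution_distr) auto
    have 1: "char D t = (\<integral>x. f x *\<^sub>R iexp (t * X x) \<partial>M) / c" for t
    proof -
      have "char D t = (\<integral>x. iexp (t * X x) \<partial>E)"
        unfolding char_def D_def by (subst integral_distr) auto
      also have "\<dots> = (\<integral>x. (f x / c) *\<^sub>R iexp (t * X x) \<partial>M)"
        unfolding E_def by (subst integral_density) (use nn in auto)
      also have "\<dots> = (\<integral>x. (f x *\<^sub>R iexp (t * X x)) / c \<partial>M)"
        by (intro Bochner_Integration.integral_cong) (auto simp: scaleR_conv_of_real)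
      finally show ?thesis by simp
    qed
    have "measure D B = (\<integral>x. indicator B x \<partial>D)" by (simp add: D_def)
    also have "\<dots> = (\<integral>x. indicator B (X x) \<partial>E)" unfolding D_def by (subst integral_distr) auto
    also have "\<dots> = (\<integral>x. (f x / c) *\<^sub>R indicator B (X x) \<partial>M)"
      unfolding E_def by (subst integral_density) (use nn in auto)
    finally have 2: "measure D B = (\<integral>x. f x * indicator B (X x) \<partial>M) / c" by simp
    show ?thesis using c D 1 2 by (intro exI[of _ D] exI[of _ c]) (auto simp: c_def)
  qed
  obtain D1 c1 where 1: "real_distribution D1" "c1 > 0" "c1 = (\<integral>x. f x \<partial>M)"
      "\<And>t. char D1 t = (\<integral>x. f x *\<^sub>R iexp (t * X x) \<partial>M) / c1"
      "measure D1 B = (\<integral>x. f x * indicator B (X x) \<partial>M) / c1"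
    using *[OF assms(1) \<open>X \<in> _\<close> \<open>f \<in> _\<close> \<open>B \<in> _\<close> f] by blast
  obtain D2 c2 where 2: "real_distribution D2" "c2 > 0" "c2 = (\<integral>x. g x \<partial>N)"
      "\<And>t. char D2 t = (\<integral>x. g x *\<^sub>R iexp (t * Y x) \<partial>N) / c2"
      "measure D2 B = (\<integral>x. g x * indicator B (Y x) \<partial>N) / c2"
    using *[OF assms(2) \<open>Y \<in> _\<close> \<open>g \<in> _\<close> \<open>B \<in> _\<close> g] by blast
  \<comment> \<open>At \<open>t = 0\<close> the hypothesis compares the two total masses.\<close>
  have "complex_of_real c1 = complex_of_real c2"
    using eq[of 0] 1(3) 2(3) by (simp add: scaleR_conv_of_real)
  hence c: "c1 = c2" by simp
  hence "char D1 = char D2" using 1(4) 2(4) eq by auto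
  hence "D1 = D2" using 1(1) 2(1) Levy_uniqueness by blast
  thus ?thesis using 1(2,5) 2(2,5) c by simp
qed

text \<open>The weight is split into real and imaginary parts, which is why the conjugate equation
  is assumed as well. Each part \<open>u\<close> is shifted to the positive weight
  \<open>2 + u\<close>, and \<open>eq0\<close> removes the contribution of the constant 2
  again.\<close>

lemma complex_weighted_distribution_eqI:
  fixes X :: "'a \<Rightarrow> real" and Y :: "'b \<Rightarrow> real" and f :: "'a \<Rightarrow> complex" and g :: "'b \<Rightarrow> complex"
  assumes MN: "prob_space M" "prob_space N"
    and [measurable]: "X \<in> borel_measurable M" "Y \<in> borel_measurable N"
      "f \<in> borel_measurable M" "g \<in> borel_measurable N" "B \<in> sets borel"
    and f: "\<And>x. norm (f x) \<le> 1" and g: "\<And>x. norm (g x) \<le> 1"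
    and eq0: "\<And>t. (\<integral>x. iexp (t * X x) \<partial>M) = (\<integral>x. iexp (t * Y x) \<partial>N)"
    and eq1: "\<And>t. (\<integral>x. f x * iexp (t * X x) \<partial>M) = (\<integral>x. g x * iexp (t * Y x) \<partial>N)"
    and eq2: "\<And>t. (\<integral>x. cnj (f x) * iexp (t * X x) \<partial>M) = (\<integral>x. cnj (g x) * iexp (t * Y x) \<partial>N)"
  shows "(\<integral>x. f x * indicator B (X x) \<partial>M) = (\<integral>x. g x * indicator B (Y x) \<partial>N)"
proof -
  interpret M: prob_space M by fact
  interpret N: prob_space N by fact
  have iM: "integrable M h" if "h \<in> borel_measurable M" "\<And>x. norm (h x) \<le> 1" for h :: "_ \<Rightarrow> 'c::{banach,second_countable_topology}"
    using that by (intro M.integrable_const_bound[where B=1]) auto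
  have iN: "integrable N h" if "h \<in> borel_measurable N" "\<And>x. norm (h x) \<le> 1" for h :: "_ \<Rightarrow> 'c::{banach,second_countable_topology}"
    using that by (intro N.integrable_const_bound[where B=1]) auto
  have Reb: "\<bar>Re (f x)\<bar> \<le> 1" "\<bar>Im (f x)\<bar> \<le> 1" for x
    using abs_Re_le_cmod[of "f x"] abs_Im_le_cmod[of "f x"] f[of x] by linarith+
  have Reg: "\<bar>Re (g x)\<bar> \<le> 1" "\<bar>Im (g x)\<bar> \<le> 1" for x
    using abs_Re_le_cmod[of "g x"] abs_Im_le_cmod[of "g x"] g[of x] by linarith+
  note b = Reb Reg
  have i0: "integrable M (\<lambda>x. iexp (t * X x))" "integrable N (\<lambda>x. iexp (t * Y x))" for t
    by (auto intro!: iM iN)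
  have i1: "integrable M (\<lambda>x. f x * iexp (t * X x))" "integrable N (\<lambda>x. g x * iexp (t * Y x))" for t
    by (auto intro!: iM iN simp: norm_mult f g)
  have i2: "integrable M (\<lambda>x. cnj (f x) * iexp (t * X x))" "integrable N (\<lambda>x. cnj (g x) * iexp (t * Y x))" for t
    by (auto intro!: iM iN simp: norm_mult f g)
  have r: "(\<integral>x. Re (f x) *\<^sub>R iexp (t * X x) \<partial>M) = (\<integral>x. Re (g x) *\<^sub>R iexp (t * Y x) \<partial>N)" for t
  proof -
    have e: "Re z *\<^sub>R w = (z * w + cnj z * w) / 2" for z w :: complex
      by (simp add: complex_eq_iff algebra_simps)
    show ?thesis unfolding e
      using i1[of t] i2[of t] by (simp add: eq1 eq2 del: of_real_mult)
  qed
  have i: "(\<integral>x. Im (f x) *\<^sub>R iexp (t * X x) \<partial>M) = (\<integral>x. Im (g x) *\<^sub>R iexp (t * Y x) \<partial>N)" for t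
  proof -
    have e: "Im z *\<^sub>R w = (- \<i> / 2) * (z * w - cnj z * w)" for z w :: complex
      by (simp add: complex_eq_iff field_simps)
    show ?thesis unfolding e
      using i1[of t] i2[of t] by (simp add: eq1 eq2 del: of_real_mult)
  qed
  have key: "(\<integral>x. u x * indicator B (X x) \<partial>M) = (\<integral>x. v x * indicator B (Y x) \<partial>N)"
    if [measurable]: "u \<in> borel_measurable M" "v \<in> borel_measurable N"
    and bd: "\<And>x. \<bar>u x\<bar> \<le> 1" "\<And>x. \<bar>v x\<bar> \<le> 1"
    and e: "\<And>t. (\<integral>x. u x *\<^sub>R iexp (t * X x) \<partial>M) = (\<integral>x. v x *\<^sub>R iexp (t * Y x) \<partial>N)"
    for u :: "'a \<Rightarrow> real" and v :: "'b \<Rightarrow> real"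
  proof -
    have j: "integrable M (\<lambda>x. u x *\<^sub>R iexp (t * X x))" "integrable N (\<lambda>x. v x *\<^sub>R iexp (t * Y x))" for t
      by (auto intro!: iM iN simp: bd)
    have k: "(\<integral>x. (2 + u x) * indicator B (X x) \<partial>M) = (\<integral>x. (2 + v x) * indicator B (Y x) \<partial>N)"
    proof (rule weighted_distribution_eqI)
      fix t
      show "(\<integral>x. (2 + u x) *\<^sub>R iexp (t * X x) \<partial>M) = (\<integral>x. (2 + v x) *\<^sub>R iexp (t * Y x) \<partial>N)"
        unfolding scaleR_add_left Bochner_Integration.integral_add[OF integrable_scaleR_right[OF i0(1)] j(1)]
          Bochner_Integration.integral_add[OF integrable_scaleR_right[OF i0(2)] j(2)] e integral_scaleR_right eq0 ..
    next
      fix x show "1 \<le> 2 + u x \<and> 2 + u x \<le> 3" using bd(1)[of x] by linarith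
    next
      fix x show "1 \<le> 2 + v x \<and> 2 + v x \<le> 3" using bd(2)[of x] by linarith
    qed (use MN in simp_all)
    have k2: "(\<integral>x. (2::real) * indicator B (X x) \<partial>M) = (\<integral>x. 2 * indicator B (Y x) \<partial>N)"
      by (rule weighted_distribution_eqI) (simp_all add: MN eq0[simplified])
    have l: "integrable M (\<lambda>x. indicator B (X x) :: real)" "integrable N (\<lambda>x. indicator B (Y x) :: real)"
      by (auto intro!: iM iN split: split_indicator)
    have l2: "integrable M (\<lambda>x. u x * indicator B (X x))" "integrable N (\<lambda>x. v x * indicator B (Y x))"
      using bd by (auto intro!: iM iN split: split_indicator)
    show ?thesis using k k2 l l2 by (simp add: distrib_right)
  qed
  have "(\<integral>x. Re (f x) * indicator B (X x) \<partial>M) = (\<integral>x. Re (g x) * indicator B (Y x) \<partial>N)"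
    by (rule key) (use b r in auto)
  moreover have "(\<integral>x. Im (f x) * indicator B (X x) \<partial>M) = (\<integral>x. Im (g x) * indicator B (Y x) \<partial>N)"
    by (rule key) (use b i in auto)
  moreover have i3: "integrable M (\<lambda>x. f x * indicator B (X x))" "integrable N (\<lambda>x. g x * indicator B (Y x))"
    by (auto intro!: iM iN simp: norm_mult f g split: split_indicator)
  moreover have "Re (\<integral>x. f x * indicator B (X x) \<partial>M) = (\<integral>x. Re (f x) * indicator B (X x) \<partial>M)"
    "Im (\<integral>x. f x * indicator B (X x) \<partial>M) = (\<integral>x. Im (f x) * indicator B (X x) \<partial>M)"
    "Re (\<integral>x. g x * indicator B (Y x) \<partial>N) = (\<integral>x. Re (g x) * indicator B (Y x) \<partial>N)"
    "Im (\<integral>x. g x * indicator B (Y x) \<partial>N) = (\<integral>x. Im (g x) * indicator B (Y x) \<partial>N)"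
    unfolding integral_Re[OF i3(1), symmetric] integral_Im[OF i3(1), symmetric]
      integral_Re[OF i3(2), symmetric] integral_Im[OF i3(2), symmetric]
    by (auto intro!: Bochner_Integration.integral_cong split: split_indicator)
  ultimately show ?thesis by (simp add: complex_eq_iff)
qed

text \<open>One coordinate after another passes from the Fourier side to the indicator side: the
  indicators obtained so far, times the remaining exponentials, form a complex weight of modulus at
  most 1 for the coordinate \<open>p\<close>. With \<open>K = {}\<close> only indicators are
  left.\<close>

lemma integral_indicators_iexp_eq:
  fixes X :: "'i \<Rightarrow> 'a \<Rightarrow> real" and Y :: "'i \<Rightarrow> 'b \<Rightarrow> real"
  assumes MN: "prob_space M" "prob_space N"
    and m[measurable]: "\<And>i. X i \<in> borel_measurable M" "\<And>i. Y i \<in> borel_measurable N"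
    and B[measurable]: "\<And>i. B i \<in> sets borel"
    and eq: "\<And>K t. finite K \<Longrightarrow> (\<integral>x. iexp (\<Sum>k\<in>K. t k * X k x) \<partial>M) = (\<integral>x. iexp (\<Sum>k\<in>K. t k * Y k x) \<partial>N)"
    and fin: "finite J" "finite K" "J \<inter> K = {}"
  shows "(\<integral>x. (\<Prod>j\<in>J. indicator (B j) (X j x)) * iexp (\<Sum>k\<in>K. t k * X k x) \<partial>M) =
    (\<integral>x. (\<Prod>j\<in>J. indicator (B j) (Y j x)) * iexp (\<Sum>k\<in>K. t k * Y k x) \<partial>N)"
  using fin
proof (induction J arbitrary: K t rule: finite_induct)
  case empty
  then show ?case using eq by simp
next
  case (insert p J)
  have step: "(\<integral>x. (\<Prod>j\<in>J. indicator (B j) (X j x)) * iexp (\<Sum>k\<in>K. t k * X k x) * iexp (u * X p x) \<partial>M) =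
      (\<integral>x. (\<Prod>j\<in>J. indicator (B j) (Y j x)) * iexp (\<Sum>k\<in>K. t k * Y k x) * iexp (u * Y p x) \<partial>N)" for u t
  proof -
    have e: "iexp (\<Sum>k\<in>K. t k * Z k x) * iexp (u * Z p x) = iexp (\<Sum>k\<in>insert p K. (t(p:=u)) k * Z k x)" for Z :: "'i \<Rightarrow> 'c \<Rightarrow> real" and x
    proof -
      have "(\<Sum>k\<in>insert p K. (t(p:=u)) k * Z k x) = u * Z p x + (\<Sum>k\<in>K. (t(p:=u)) k * Z k x)"
        using insert.prems by (subst sum.insert) auto
      also have "(\<Sum>k\<in>K. (t(p:=u)) k * Z k x) = (\<Sum>k\<in>K. t k * Z k x)"
        using insert.prems by (intro sum.cong) auto
      finally show ?thesis by (simp add: exp_add[symmetric] distrib_left add.commute)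
    qed
    show ?thesis unfolding mult.assoc e
      using insert.prems insert.hyps by (intro insert.IH) auto
  qed
  have prod_le: "norm (\<Prod>j\<in>J. indicator (B j) (Z j x) :: complex) \<le> 1" for Z :: "'i \<Rightarrow> 'c \<Rightarrow> real" and x
    by (subst prod_norm[symmetric], rule prod_le_1) (auto split: split_indicator)
  have cn: "cnj (\<Prod>j\<in>J. indicator (B j) (Z j x)) = (\<Prod>j\<in>J. indicator (B j) (Z j x))" for Z :: "'i \<Rightarrow> 'c \<Rightarrow> real" and x
    by (subst cnj_prod) (intro prod.cong, auto split: split_indicator)
  have cn2: "cnj (iexp s) = iexp (- s)" for s
    by (simp add: exp_cnj)
  have main: "(\<integral>x. (\<Prod>j\<in>J. indicator (B j) (X j x)) * iexp (\<Sum>k\<in>K. t k * X k x) * indicator (B p) (X p x) \<partial>M) =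
    (\<integral>x. (\<Prod>j\<in>J. indicator (B j) (Y j x)) * iexp (\<Sum>k\<in>K. t k * Y k x) * indicator (B p) (Y p x) \<partial>N)"
  proof (rule complex_weighted_distribution_eqI[OF MN])
    show "(\<integral>x. iexp (u * X p x) \<partial>M) = (\<integral>x. iexp (u * Y p x) \<partial>N)" for u
      using eq[of "{p}" "\<lambda>_. u"] by simp
    show "(\<integral>x. (\<Prod>j\<in>J. indicator (B j) (X j x)) * iexp (\<Sum>k\<in>K. t k * X k x) * iexp (u * X p x) \<partial>M) =
      (\<integral>x. (\<Prod>j\<in>J. indicator (B j) (Y j x)) * iexp (\<Sum>k\<in>K. t k * Y k x) * iexp (u * Y p x) \<partial>N)" for u
      by (rule step)
    \<comment> \<open>Indicators are real, so conjugation only reverses the sign of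
      \<open>t\<close>.\<close>
    show "(\<integral>x. cnj ((\<Prod>j\<in>J. indicator (B j) (X j x)) * iexp (\<Sum>k\<in>K. t k * X k x)) * iexp (u * X p x) \<partial>M) =
      (\<integral>x. cnj ((\<Prod>j\<in>J. indicator (B j) (Y j x)) * iexp (\<Sum>k\<in>K. t k * Y k x)) * iexp (u * Y p x) \<partial>N)" for u
      using step[of "\<lambda>k. - t k" u] unfolding complex_cnj_mult cn cn2 by (simp add: sum_negf)
  next
    show "norm ((\<Prod>j\<in>J. indicator (B j) (X j x)) * iexp (\<Sum>k\<in>K. t k * X k x)) \<le> 1" for x
      using prod_le[of X x] by (simp only: norm_mult norm_exp_i_times mult_1_right)
    show "norm ((\<Prod>j\<in>J. indicator (B j) (Y j x)) * iexp (\<Sum>k\<in>K. t k * Y k x)) \<le> 1" for x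
      using prod_le[of Y x] by (simp only: norm_mult norm_exp_i_times mult_1_right)
  qed measurable
  have *: "(\<Prod>j\<in>insert p J. indicator (B j) (Z j x)) * w =
      (\<Prod>j\<in>J. indicator (B j) (Z j x)) * w * indicator (B p) (Z p x)" for Z :: "'i \<Rightarrow> 'c \<Rightarrow> real" and x and w :: complex
    using insert.hyps by (simp add: mult_ac)
  show ?case unfolding *[of X] *[of Y] by (rule main)
qed

lemma borel_measurable_vec_nth [measurable (raw)]:
  fixes f :: "'a \<Rightarrow> ('b::euclidean_space) ^ 'm::finite"
  assumes "f \<in> borel_measurable M"
  shows "(\<lambda>x. f x $ i) \<in> borel_measurable M"
proof -
  have "(\<lambda>v :: 'b ^ 'm. v $ i) \<in> borel_measurable borel"
    by (intro borel_measurable_continuous_onI continuous_intros)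
  from measurable_compose[OF assms this] show ?thesis .
qed

lemma borel_measurable_vec_lambda [measurable (raw)]:
  fixes f :: "'m::finite \<Rightarrow> 'a \<Rightarrow> 'b::euclidean_space"
  assumes [measurable]: "\<And>i. f i \<in> borel_measurable M"
  shows "(\<lambda>x. \<chi> i. f i x) \<in> borel_measurable M"
proof (subst borel_measurable_euclidean_space, safe)
  fix b :: "'b ^ 'm" assume "b \<in> Basis"
  then obtain i u where b: "b = axis i u" by (auto simp: Basis_vec_def)
  show "(\<lambda>x. (\<chi> i. f i x) \<bullet> b) \<in> borel_measurable M"
    unfolding b by (simp add: inner_axis)
qed

lemma borel_measurable_Complex [measurable (raw)]:
  assumes [measurable]: "f \<in> borel_measurable M" "g \<in> borel_measurable M"
  shows "(\<lambda>x. Complex (f x) (g x)) \<in> borel_measurable M"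
  unfolding Complex_eq by measurable

lemma inner_complex_vec:
  "(x :: complex ^ 'm::finite) \<bullet> y = (\<Sum>j\<in>UNIV. Re (x $ j) * Re (y $ j) + Im (x $ j) * Im (y $ j))"
  by (simp add: inner_vec_def inner_complex_def)

text \<open>The inner product of rows is the real one, so the exponent is the real part of the trace
  of \<open>T^H X\<close>, where \<open>^H\<close> denotes the conjugate transpose and only the
  first \<open>n\<close> rows count.\<close>

definition cf :: "nat \<Rightarrow> 'm::finite inf_mat \<Rightarrow> 'm inf_mat measure \<Rightarrow> complex" where
  "cf n T M = (\<integral>X. iexp (\<Sum>i<n. T i \<bullet> X i) \<partial>M)"

definition entry :: "nat \<times> 'm \<times> bool \<Rightarrow> 'm::finite inf_mat \<Rightarrow> real" where
  "entry = (\<lambda>(i, j, b) X. if b then Re (X i $ j) else Im (X i $ j))"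

definition of_entries :: "(nat \<times> 'm \<times> bool \<Rightarrow> real) \<Rightarrow> 'm::finite inf_mat" where
  "of_entries w = (\<lambda>i. \<chi> j. Complex (w (i, j, True)) (w (i, j, False)))"

lemma of_entries_entry: "of_entries (\<lambda>p. entry p X) = X"
  by (auto simp: of_entries_def entry_def vec_eq_iff)

lemma entry_measurable [measurable]: "entry p \<in> borel_measurable borel"
  unfolding entry_def split_def by measurable

lemma of_entries_measurable [measurable]: "of_entries \<in> borel_measurable (Pi\<^sub>M UNIV (\<lambda>_. borel))"
  unfolding of_entries_def [abs_def]
  by (rule measurable_coordinatewise_then_product) measurable

lemma sum_entries_eq:
  assumes "finite K" "K \<subseteq> {..<n} \<times> UNIV \<times> UNIV"
  shows "(\<Sum>k\<in>K. t k * entry k X) = (\<Sum>i<n. of_entries (\<lambda>p. if p \<in> K then t p else 0) i \<bullet> X i)"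
proof -
  have "(\<Sum>k\<in>K. t k * entry k X) = (\<Sum>k\<in>{..<n} \<times> UNIV \<times> UNIV. (if k \<in> K then t k else 0) * entry k X)"
    using assms by (intro sum.mono_neutral_cong_left) auto
  also have "\<dots> = (\<Sum>i<n. \<Sum>j\<in>UNIV. \<Sum>b\<in>UNIV. (if (i, j, b) \<in> K then t (i, j, b) else 0) * entry (i, j, b) X)"
    by (simp add: sum.cartesian_product split_def cong: if_cong)
  also have "\<dots> = (\<Sum>i<n. of_entries (\<lambda>p. if p \<in> K then t p else 0) i \<bullet> X i)"
    by (simp add: inner_complex_vec of_entries_def entry_def UNIV_bool add.commute)
  finally show ?thesis .
qed

text \<open>Real coordinates identify matrices with a countable product of real lines, where
  finite-dimensional cylinders determine a measure. Cylinder probabilities are integrals of products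
  of indicators, as in \<open>integral_indicators_iexp_eq\<close>.\<close>

proposition inf_mat_measure_eqI:
  fixes M N :: "'m::finite inf_mat measure"
  assumes MN: "prob_space M" "prob_space N" and s[measurable_cong]: "sets M = sets borel" "sets N = sets borel"
    and eq: "\<And>n T. cf n T M = cf n T N"
  shows "M = N"
proof -
  interpret M: prob_space M by fact
  interpret N: prob_space N by fact
  let ?P = "Pi\<^sub>M UNIV (\<lambda>_. borel) :: (nat \<times> 'm \<times> bool \<Rightarrow> real) measure"
  let ?e = "\<lambda>X p. entry p X"
  have e[measurable]: "?e \<in> borel \<rightarrow>\<^sub>M ?P" by (rule measurable_PiM_single') (auto simp: space_PiM)
  have [measurable]: "entry p \<in> borel_measurable M" "entry p \<in> borel_measurable N" for p by measurable
  have iexp_eq: "(\<integral>X. iexp (\<Sum>k\<in>K. t k * entry k X) \<partial>M) = (\<integral>X. iexp (\<Sum>k\<in>K. t k * entry k X) \<partial>N)"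
    if "finite K" for K t
  proof -
    have sub: "K \<subseteq> {..<Suc (Max (insert 0 (fst ` K)))} \<times> UNIV \<times> UNIV"
      using that by (force simp: less_Suc_eq_le intro: Max_ge)
    show ?thesis unfolding sum_entries_eq[OF that sub] by (rule eq[unfolded cf_def])
  qed
  have "distr M ?P ?e = distr N ?P ?e"
  proof (rule measure_eqI_PiM_infinite)
    show "finite_measure (distr M ?P ?e)" by (intro M.finite_measure_distr) measurable
    fix A J assume J: "finite J" "J \<subseteq> (UNIV :: (nat \<times> 'm \<times> bool) set)"
      and A: "\<And>i. i \<in> J \<Longrightarrow> A i \<in> sets (borel :: real measure)"
    define B where "B i = (if i \<in> J then A i else {})" for i
    have B[measurable]: "B i \<in> sets borel" for i using A by (simp add: B_def)
    have emb: "prod_emb UNIV (\<lambda>_. borel) J (Pi\<^sub>E J A) = {w. \<forall>i\<in>J. w i \<in> B i}"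
      by (auto simp: prod_emb_def B_def PiE_iff)
    have m[measurable]: "{X. \<forall>i\<in>J. entry i X \<in> B i} \<in> sets borel"
      using J(1) by measurable
    have *: "complex_of_real (measure K {X. \<forall>i\<in>J. entry i X \<in> B i}) = (\<integral>X. (\<Prod>j\<in>J. indicator (B j) (entry j X)) \<partial>K)"
      if [measurable_cong]: "sets K = sets borel" "prob_space K" for K :: "'m inf_mat measure"
    proof -
      interpret prob_space K by fact
      have "(\<integral>X. (\<Prod>j\<in>J. indicator (B j) (entry j X)) \<partial>K) = (\<integral>X. complex_of_real (indicator {X. \<forall>i\<in>J. entry i X \<in> B i} X) \<partial>K)"
        using J(1) by (intro Bochner_Integration.integral_cong refl)
          (auto simp: indicator_def prod_zero_iff split: if_splits)
      also have "\<dots> = complex_of_real (\<integral>X. indicator {X. \<forall>i\<in>J. entry i X \<in> B i} X \<partial>K)"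
        by (rule integral_complex_of_real)
      finally show ?thesis using that(1) sets_eq_imp_space_eq[OF that(1)] by simp
    qed
    have "(\<integral>X. (\<Prod>j\<in>J. indicator (B j) (entry j X)) \<partial>M) = (\<integral>X. (\<Prod>j\<in>J. indicator (B j) (entry j X) :: complex) \<partial>N)"
      using integral_indicators_iexp_eq[OF MN, of entry entry B J "{}"] iexp_eq J(1) by simp
    hence "complex_of_real (measure M {X. \<forall>i\<in>J. entry i X \<in> B i}) = complex_of_real (measure N {X. \<forall>i\<in>J. entry i X \<in> B i})"
      unfolding *[OF s(1) MN(1)] *[OF s(2) MN(2)] .
    hence "measure M {X. \<forall>i\<in>J. entry i X \<in> B i} = measure N {X. \<forall>i\<in>J. entry i X \<in> B i}"
      by (simp only: of_real_eq_iff)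
    moreover have "?e -` {w. \<forall>i\<in>J. w i \<in> B i} = {X. \<forall>i\<in>J. entry i X \<in> B i}" by auto
    moreover have "{w. \<forall>i\<in>J. w i \<in> B i} \<in> sets ?P"
      unfolding emb[symmetric] using J A by (intro sets_PiM_I) auto
    moreover have "space M = UNIV" "space N = UNIV" using s[THEN sets_eq_imp_space_eq] by auto
    ultimately show "emeasure (distr M ?P ?e) (prod_emb UNIV (\<lambda>_. borel) J (Pi\<^sub>E J A)) =
        emeasure (distr N ?P ?e) (prod_emb UNIV (\<lambda>_. borel) J (Pi\<^sub>E J A))"
      unfolding emb by (simp add: emeasure_distr M.emeasure_eq_measure N.emeasure_eq_measure)
  qed simp_all
  hence "distr (distr M ?P ?e) borel of_entries = distr (distr N ?P ?e) borel of_entries" by simp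
  moreover have "distr (distr K ?P ?e) borel of_entries = K" if [measurable_cong]: "sets K = sets borel" for K
    by (subst distr_distr) (auto simp: comp_def of_entries_entry distr_id2 that)
  ultimately show ?thesis using s by metis
qed

section \<open>Unitary matrices and Gram matrices\<close>

lemma conj_transpose_nth [simp]: "conj_transpose A $ i $ j = cnj (A $ j $ i)"
  by (simp add: conj_transpose_def)

lemma conj_transpose_mult: "conj_transpose (A ** B) = conj_transpose B ** conj_transpose (A :: complex ^ 'm::finite ^ 'm)"
  by (simp add: vec_eq_iff matrix_matrix_mult_def mult.commute)

lemma conj_transpose_conj_transpose [simp]: "conj_transpose (conj_transpose A) = A"
  by (simp add: vec_eq_iff)

lemma conj_transpose_mat_1 [simp]: "conj_transpose (mat 1) = (mat 1 :: complex ^ 'm::finite ^ 'm)"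
  by (simp add: vec_eq_iff mat_def)

lemma unitary_groupD:
  assumes "v \<in> unitary_group"
  shows "v ** conj_transpose v = mat 1" "conj_transpose v ** v = mat 1"
  using assms by (auto simp: unitary_group_def)

lemma unitary_groupI: "v ** conj_transpose v = mat 1 \<Longrightarrow> v \<in> unitary_group"
  by (simp add: unitary_group_def matrix_left_right_inverse)

lemma mat_1_unitary [simp]: "mat 1 \<in> unitary_group"
  by (simp add: unitary_group_def)

lemma conj_transpose_unitary: "v \<in> unitary_group \<Longrightarrow> conj_transpose v \<in> unitary_group"
  by (simp add: unitary_group_def)

lemma mult_unitary:
  assumes "v \<in> unitary_group" "w \<in> unitary_group"
  shows "v ** w \<in> unitary_group"
proof (rule unitary_groupI)
  have "v ** w ** conj_transpose (v ** w) = v ** (w ** conj_transpose w) ** conj_transpose v"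
    by (simp add: conj_transpose_mult matrix_mul_assoc)
  then show "v ** w ** conj_transpose (v ** w) = mat 1"
    using assms by (simp add: unitary_groupD)
qed

lemma matrix_inv_unitary:
  assumes "v \<in> unitary_group"
  shows "matrix_inv v = conj_transpose v"
proof -
  have "v ** matrix_inv v = mat 1"
    unfolding matrix_inv_def using unitary_groupD[OF assms]
    by (metis (mono_tags, lifting) someI_ex)
  then show ?thesis using unitary_groupD[OF assms]
    by (metis matrix_mul_assoc matrix_mul_lid matrix_mul_rid)
qed

lemma mat_mult_right_mult: "mat_mult_right (mat_mult_right X A) B = mat_mult_right X (A ** B)"
  by (simp add: mat_mult_right_def vector_matrix_mul_assoc)

lemma mat_mult_right_mat_1 [simp]: "mat_mult_right X (mat 1) = X"
  by (simp add: mat_mult_right_def)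

lemma vector_matrix_mult_nth: "(x v* A) $ j = (\<Sum>i\<in>UNIV. x $ i * A $ i $ j)"
  by (simp add: vector_matrix_mult_def)

lemma mat_mult_right_measurable [measurable]: "(\<lambda>X. mat_mult_right X A) \<in> borel_measurable borel"
  unfolding mat_mult_right_def vector_matrix_mult_def
  by (rule measurable_coordinatewise_then_product) measurable

lemma mat_mult_left_measurable [measurable]: "mat_mult_left u \<in> borel_measurable borel"
  unfolding mat_mult_left_def [abs_def]
  by (rule measurable_coordinatewise_then_product) measurable

lemma unitary_act_measurable [measurable]: "unitary_act g \<in> borel_measurable borel"
  unfolding unitary_act_def split_def by measurable

text \<open>Kronecker delta; as a matrix it is also the neutral element of
  \<open>unitary_inf\<close>.\<close>

definition kron :: "nat \<Rightarrow> nat \<Rightarrow> complex" where "kron i j = (if i = j then 1 else 0)"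

lemma kron_simps [simp]: "kron i i = 1" "i \<noteq> j \<Longrightarrow> kron i j = 0" "cnj (kron i j) = kron i j"
  by (auto simp: kron_def)

lemma sum_kron:
  assumes "i < n"
  shows "(\<Sum>k<n. kron i k * f k) = f i" "(\<Sum>k<n. f k * kron i k) = f i"
    "(\<Sum>k<n. kron k i * f k) = f i" "(\<Sum>k<n. f k * kron k i) = f i"
proof -
  have "kron i k * f k = (if k = i then f k else 0)" "f k * kron i k = (if k = i then f k else 0)"
     "kron k i * f k = (if k = i then f k else 0)" "f k * kron k i = (if k = i then f k else 0)" for k
    by (auto simp: kron_def)
  then show "(\<Sum>k<n. kron i k * f k) = f i" "(\<Sum>k<n. f k * kron i k) = f i"
    "(\<Sum>k<n. kron k i * f k) = f i" "(\<Sum>k<n. f k * kron k i) = f i"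
    using assms by simp_all
qed

text \<open>The copy of U(n) inside U(\<infinity>), with plain sums over \<open>k < n\<close> in
  place of sums over supports.\<close>

definition unitary_upto :: "nat \<Rightarrow> (nat \<Rightarrow> nat \<Rightarrow> complex) set" where
  "unitary_upto n = {u. (\<forall>i j. n \<le> i \<or> n \<le> j \<longrightarrow> u i j = kron i j) \<and>
     (\<forall>i<n. \<forall>j<n. (\<Sum>k<n. u i k * cnj (u j k)) = kron i j) \<and>
     (\<forall>i<n. \<forall>j<n. (\<Sum>k<n. cnj (u k i) * u k j) = kron i j)}"

text \<open>A row or column of index below \<open>n\<close> has its support below \<open>n\<close>;
  any other one has a single nonzero entry, on the diagonal.\<close>

lemma support_row:
  assumes "\<And>i j. n \<le> i \<or> n \<le> j \<Longrightarrow> u i j = kron i j"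
  shows "(\<Sum>k | u i k \<noteq> 0. u i k * f k) = (if i < n then \<Sum>k<n. u i k * f k else f i)"
    and "(\<Sum>k | u k i \<noteq> 0. f k * u k i) = (if i < n then \<Sum>k<n. f k * u k i else f i)"
proof -
  have "(\<Sum>k | u i k \<noteq> 0. u i k * f k) = (\<Sum>k<n. u i k * f k)" if "i < n"
    using that assms[of i] by (intro sum.mono_neutral_left) (auto simp: kron_def, meson linorder_not_less)
  moreover have "{k. u i k \<noteq> 0} = {i}" if "\<not> i < n" using that assms[of i] by (auto simp: kron_def)
  ultimately show "(\<Sum>k | u i k \<noteq> 0. u i k * f k) = (if i < n then \<Sum>k<n. u i k * f k else f i)"
    using assms[of i i] by auto
  have "(\<Sum>k | u k i \<noteq> 0. f k * u k i) = (\<Sum>k<n. f k * u k i)" if "i < n"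
    using that assms[of _ i] by (intro sum.mono_neutral_left) (auto simp: kron_def, meson linorder_not_less)
  moreover have "{k. u k i \<noteq> 0} = {i}" if "\<not> i < n" using that assms[of _ i] by (auto simp: kron_def)
  ultimately show "(\<Sum>k | u k i \<noteq> 0. f k * u k i) = (if i < n then \<Sum>k<n. f k * u k i else f i)"
    using assms[of i i] by auto
qed

lemma unitary_upto_subset: "unitary_upto n \<subseteq> unitary_inf"
proof
  fix u assume u: "u \<in> unitary_upto n"
  have 1: "u i j = kron i j" if "n \<le> i \<or> n \<le> j" for i j using u that by (auto simp: unitary_upto_def)
  have 2: "(\<Sum>k | u i k \<noteq> 0. u i k * cnj (u j k)) = kron i j" for i j
    using u 1 support_row(1)[OF 1, where i=i and f="\<lambda>k. cnj (u j k)"] 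
    by (cases "j < n") (auto simp: unitary_upto_def sum_kron kron_def)
  have 3: "(\<Sum>k | u k i \<noteq> 0. cnj (u k i) * u k j) = kron i j" for i j
  proof -
    have "(\<Sum>k | u k i \<noteq> 0. cnj (u k i) * u k j) = cnj (\<Sum>k | u k i \<noteq> 0. cnj (u k j) * u k i)"
      by (simp add: mult.commute)
    also have "\<dots> = kron i j"
      using u 1 support_row(2)[OF 1, where i=i and f="\<lambda>k. cnj (u k j)"]
      by (cases "j < n") (auto simp: unitary_upto_def sum_kron kron_def)
    finally show ?thesis .
  qed
  \<comment> \<open>A sum of at least \<open>2 * n\<close> forces one of the two indices to be at
    least \<open>n\<close>.\<close>
  have "\<forall>i j. i + j \<ge> 2 * n \<longrightarrow> u i j = (if i = j then 1 else 0)"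
    using 1 by (auto simp: kron_def) (metis add_less_mono linorder_not_less mult_2)+
  then show "u \<in> unitary_inf"
    using 2 3 unfolding unitary_inf_def kron_def by blast
qed

lemma unitary_inf_imp_upto:
  assumes "u \<in> unitary_inf"
  obtains n where "u \<in> unitary_upto n"
proof -
  obtain n where n: "\<And>i j. i + j \<ge> n \<Longrightarrow> u i j = kron i j"
    using assms by (auto simp: unitary_inf_def kron_def)
  have 1: "u i j = kron i j" if "n \<le> i \<or> n \<le> j" for i j using that by (intro n) auto
  have "(\<Sum>k<n. u i k * cnj (u j k)) = kron i j" if "i < n" "j < n" for i j
    using assms that support_row(1)[OF 1, where i=i and f="\<lambda>k. cnj (u j k)"] by (auto simp: unitary_inf_def kron_def)
  moreover have "(\<Sum>k<n. cnj (u k i) * u k j) = kron i j" if "i < n" "j < n" for i j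
  proof -
    have "(\<Sum>k<n. cnj (u k i) * u k j) = cnj (\<Sum>k | u k i \<noteq> 0. cnj (u k j) * u k i)"
      using that support_row(2)[OF 1, where i=i and f="\<lambda>k. cnj (u k j)"] by (simp add: mult.commute)
    also have "\<dots> = (\<Sum>k | u k i \<noteq> 0. cnj (u k i) * u k j)" by (simp add: mult.commute)
    also have "\<dots> = kron i j" using assms by (auto simp: unitary_inf_def kron_def)
    finally show ?thesis .
  qed
  ultimately have "u \<in> unitary_upto n" using 1 by (auto simp: unitary_upto_def)
  then show ?thesis by (rule that)
qed

lemma mat_mult_left_upto:
  assumes "u \<in> unitary_upto n"
  shows "i < n \<Longrightarrow> mat_mult_left u X i $ j = (\<Sum>k<n. u i k * X k $ j)"
    and "n \<le> i \<Longrightarrow> mat_mult_left u X i = X i"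
  using support_row(1)[of n u i "\<lambda>k. X k $ _"] assms
  by (auto simp: mat_mult_left_def unitary_upto_def vec_eq_iff)

lemma kron_unitary: "kron \<in> unitary_upto 0" "kron \<in> unitary_inf"
proof -
  show "kron \<in> unitary_upto 0" by (auto simp: unitary_upto_def)
  then show "kron \<in> unitary_inf" using unitary_upto_subset by blast
qed

lemma mat_mult_left_kron [simp]: "mat_mult_left kron X = X"
  using mat_mult_left_upto(2)[OF kron_unitary(1)] by auto

text \<open>This is \<open>X^H Y\<close> for the first \<open>n\<close> rows. Its trace carries the
  exponent of \<open>cf\<close>, unitary left multiplication preserves it, and right multiplication
  acts on its two sides.\<close>

definition cgram :: "nat \<Rightarrow> 'm::finite inf_mat \<Rightarrow> 'm inf_mat \<Rightarrow> complex ^ 'm ^ 'm" where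
  "cgram n X Y = (\<chi> j l. \<Sum>i<n. cnj (X i $ j) * Y i $ l)"

lemma sum_inner_eq_trace_cgram: "(\<Sum>i<n. X i \<bullet> Y i) = Re (trace (cgram n X Y))"
  unfolding trace_def cgram_def
  by (simp add: inner_complex_vec sum.swap[of _ _ UNIV])

lemma cgram_mat_mult_right:
  "cgram n (mat_mult_right X A) (mat_mult_right Y B) = conj_transpose A ** cgram n X Y ** B"
proof (intro vec_eq_iff[THEN iffD2] allI)
  fix j l
  have "cgram n (mat_mult_right X A) (mat_mult_right Y B) $ j $ l =
    (\<Sum>i<n. \<Sum>a\<in>UNIV. \<Sum>b\<in>UNIV. cnj (X i $ a) * cnj (A $ a $ j) * (Y i $ b * B $ b $ l))"
    by (simp add: cgram_def mat_mult_right_def vector_matrix_mult_nth sum_product)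
  also have "\<dots> = (\<Sum>a\<in>UNIV. \<Sum>i<n. \<Sum>b\<in>UNIV. cnj (X i $ a) * cnj (A $ a $ j) * (Y i $ b * B $ b $ l))"
    by (rule sum.swap)
  also have "\<dots> = (\<Sum>a\<in>UNIV. \<Sum>b\<in>UNIV. \<Sum>i<n. cnj (X i $ a) * cnj (A $ a $ j) * (Y i $ b * B $ b $ l))"
    by (intro sum.cong refl sum.swap)
  also have "\<dots> = (\<Sum>b\<in>UNIV. \<Sum>a\<in>UNIV. \<Sum>i<n. cnj (X i $ a) * cnj (A $ a $ j) * (Y i $ b * B $ b $ l))"
    by (rule sum.swap)
  also have "\<dots> = (conj_transpose A ** cgram n X Y ** B) $ j $ l"
    by (simp add: cgram_def matrix_matrix_mult_def sum_distrib_left sum_distrib_right mult_ac)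
  finally show "cgram n (mat_mult_right X A) (mat_mult_right Y B) $ j $ l = (conj_transpose A ** cgram n X Y ** B) $ j $ l" .
qed

lemma cgram_mat_mult_left:
  assumes u: "u \<in> unitary_upto m" and "m \<le> n"
  shows "cgram n (mat_mult_left u X) (mat_mult_left u Y) = cgram n X Y"
proof (intro vec_eq_iff[THEN iffD2] allI)
  fix j l
  have split: "(\<Sum>i<n. f i) = (\<Sum>i<m. f i) + (\<Sum>i\<in>{m..<n}. f i)" for f :: "nat \<Rightarrow> complex"
    using \<open>m \<le> n\<close> by (metis atLeast0LessThan sum.atLeastLessThan_concat zero_le)
  have "(\<Sum>i<m. cnj (mat_mult_left u X i $ j) * mat_mult_left u Y i $ l) =
    (\<Sum>i<m. \<Sum>k<m. \<Sum>k'<m. (cnj (X k $ j) * Y k' $ l) * (cnj (u i k) * u i k'))"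
    by (simp add: mat_mult_left_upto(1)[OF u] sum_product) (simp add: mult_ac)
  also have "\<dots> = (\<Sum>k<m. \<Sum>k'<m. \<Sum>i<m. (cnj (X k $ j) * Y k' $ l) * (cnj (u i k) * u i k'))"
    by (subst sum.swap) (intro sum.cong refl sum.swap)
  also have "\<dots> = (\<Sum>k<m. \<Sum>k'<m. (cnj (X k $ j) * Y k' $ l) * kron k k')"
    using u by (simp add: sum_distrib_left[symmetric] unitary_upto_def)
  also have "\<dots> = (\<Sum>k<m. cnj (X k $ j) * Y k $ l)"
    by (simp add: sum_kron)
  finally have "(\<Sum>i<n. cnj (mat_mult_left u X i $ j) * mat_mult_left u Y i $ l) = (\<Sum>i<n. cnj (X i $ j) * Y i $ l)"
    unfolding split by (simp add: mat_mult_left_upto(2)[OF u])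
  then show "cgram n (mat_mult_left u X) (mat_mult_left u Y) $ j $ l = cgram n X Y $ j $ l"
    by (simp add: cgram_def)
qed

text \<open>The reflection along \<open>w = y - y'\<close>, with the complex scalar \<open>\<alpha> = \<langle>w, y\<rangle>\<close> in place of half
  the squared norm of \<open>w\<close>; it is unitary because \<open>\<langle>w, w\<rangle> = \<alpha> + cnj \<alpha>\<close>.\<close>

lemma householder:
  fixes y y' :: "nat \<Rightarrow> complex"
  assumes eq: "(\<Sum>k<n. cnj (y k) * y k) = (\<Sum>k<n. cnj (y' k) * y' k)"
  obtains u where "u \<in> unitary_upto n" "\<And>i. i < n \<Longrightarrow> (\<Sum>k<n. u i k * y k) = y' i"
    "\<And>z i. (\<Sum>k<n. cnj (y k) * z k) = (\<Sum>k<n. cnj (y' k) * z k) \<Longrightarrow> i < n \<Longrightarrow> (\<Sum>k<n. u i k * z k) = z i"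
proof -
  define w where "w k = y k - y' k" for k
  define \<alpha> where "\<alpha> = (\<Sum>k<n. cnj (w k) * y k)"
  define \<beta> where "\<beta> = (\<Sum>k<n. cnj (w k) * w k)"
  have \<beta>: "\<beta> = \<alpha> + cnj \<alpha>"
    using eq by (simp add: \<alpha>_def \<beta>_def w_def algebra_simps sum.distrib sum_subtractf)
  show ?thesis
  \<comment> \<open>If \<open>\<alpha> = 0\<close>, then \<open>\<beta>\<close>, the squared norm of
    \<open>w\<close>, vanishes as well, so \<open>y\<close> and \<open>y'\<close> agree and the
    identity serves.\<close>
  proof (cases "\<alpha> = 0")
    case True
    have "complex_of_real (\<Sum>k<n. (norm (w k))\<^sup>2) = \<beta>"
      by (simp only: \<beta>_def of_real_sum complex_norm_square mult.commute)
    hence "(\<Sum>k<n. (norm (w k))\<^sup>2) = 0"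
      by (simp only: \<beta> True complex_cnj_zero add_0_right of_real_eq_0_iff)
    hence "\<forall>k\<in>{..<n}. (norm (w k))\<^sup>2 = 0" by (subst (asm) sum_nonneg_eq_0_iff) auto
    hence "y k = y' k" if "k < n" for k using that by (auto simp: w_def)
    moreover have "kron \<in> unitary_upto n"
      by (auto simp: unitary_upto_def sum_kron) (auto simp: kron_def)
    ultimately show ?thesis by (intro that[of kron]) (auto simp: sum_kron)
  next
    case False
    define u where "u i k = (if i < n \<and> k < n then kron i k - w i * cnj (w k) / \<alpha> else kron i k)" for i k
    have row: "(\<Sum>k<n. u i k * z k) = z i - w i * (\<Sum>k<n. cnj (w k) * z k) / \<alpha>" if "i < n" for i z
      using that by (simp add: u_def left_diff_distrib sum_subtractf sum_kron sum_distrib_left sum_divide_distrib mult.assoc)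
    have wy: "(\<Sum>k<n. cnj (w k) * cnj (u j k)) = cnj (w j) * (1 - \<beta> / cnj \<alpha>)" if "j < n" for j
      using that by (simp add: u_def right_diff_distrib sum_subtractf sum_kron \<beta>_def sum_distrib_left sum_divide_distrib mult_ac)
    have "(\<Sum>k<n. u i k * cnj (u j k)) = kron i j" if "i < n" "j < n" for i j
      using that False unfolding row[OF that(1)] wy[OF that(2)]
      by (simp add: u_def \<beta> field_simps) (auto simp: kron_def)
    moreover have "(\<Sum>k<n. cnj (u k i) * u k j) = kron i j" if "i < n" "j < n" for i j
    proof -
      have "(\<Sum>k<n. cnj (u k i) * u k j) = (\<Sum>k<n. (kron k i - cnj (w k) * w i / cnj \<alpha>) * (kron k j - w k * cnj (w j) / \<alpha>))"
        using that by (simp add: u_def)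
      also have "\<dots> = (\<Sum>k<n. kron k i * kron k j - kron k i * (w k * cnj (w j) / \<alpha>) - kron k j * (cnj (w k) * w i / cnj \<alpha>)
          + (w i * cnj (w j) / (\<alpha> * cnj \<alpha>)) * (cnj (w k) * w k))"
        by (intro sum.cong refl) (simp add: algebra_simps)
      also have "\<dots> = kron i j - w i * cnj (w j) / \<alpha> - cnj (w j) * w i / cnj \<alpha> + (w i * cnj (w j) / (\<alpha> * cnj \<alpha>)) * \<beta>"
        using that by (simp add: sum.distrib sum_subtractf sum_kron \<beta>_def sum_distrib_left flip: sum_divide_distrib)
      also have "\<dots> = kron i j" using False by (simp add: \<beta> field_simps)
      finally show ?thesis .
    qed
    moreover have "u i k = kron i k" if "n \<le> i \<or> n \<le> k" for i k using that by (auto simp: u_def)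
    ultimately have u: "u \<in> unitary_upto n" by (auto simp: unitary_upto_def)
    show ?thesis
    proof (rule that[OF u])
      show "(\<Sum>k<n. u i k * y k) = y' i" if "i < n" for i
        using False by (simp add: row that flip: \<alpha>_def) (simp add: w_def)
      show "(\<Sum>k<n. u i k * z k) = z i" if "(\<Sum>k<n. cnj (y k) * z k) = (\<Sum>k<n. cnj (y' k) * z k)" "i < n" for z i
        using that by (simp add: row) (simp add: w_def left_diff_distrib sum_subtractf)
    qed
  qed
qed

lemma invariant_measure_left:
  assumes "invariant_measure \<mu>" "u \<in> unitary_inf"
  shows "distr \<mu> borel (mat_mult_left u) = \<mu>"
proof -
  have "unitary_act (u, mat 1) = (mat_mult_left u :: 'a inf_mat \<Rightarrow> _)"
    by (auto simp: unitary_act_def matrix_inv_unitary)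
  then show ?thesis using assms unfolding invariant_measure_def by (metis SigmaI mat_1_unitary)
qed

text \<open>The action multiplies by an inverse on the right, so \<open>v\<close> comes from the
  group element with second component \<open>v^H\<close>.\<close>

lemma invariant_measure_right:
  assumes "invariant_measure \<mu>" "v \<in> unitary_group"
  shows "distr \<mu> borel (\<lambda>X. mat_mult_right X v) = \<mu>"
proof -
  have "unitary_act (kron, conj_transpose v) = (\<lambda>X. mat_mult_right X v)"
    using assms(2) by (auto simp: unitary_act_def matrix_inv_unitary conj_transpose_unitary)
  then show ?thesis using assms kron_unitary unfolding invariant_measure_def
    by (metis SigmaI conj_transpose_unitary)
qed

text \<open>By invariance the integration variable may be multiplied by \<open>u\<close> too; the
  pairing of \<open>u T\<close> with \<open>u X\<close> equals that of \<open>T\<close> with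
  \<open>X\<close>.\<close>

lemma cf_mat_mult_left:
  assumes inv: "invariant_measure \<mu>" and s: "sets \<mu> = sets borel" and u: "u \<in> unitary_upto m" "m \<le> n"
  shows "cf n (mat_mult_left u T) \<mu> = cf n T \<mu>"
proof -
  have u': "u \<in> unitary_inf" using u unitary_upto_subset by blast
  have "cf n (mat_mult_left u T) \<mu> = cf n (mat_mult_left u T) (distr \<mu> borel (mat_mult_left u))"
    using invariant_measure_left[OF inv u'] by simp
  also have "\<dots> = (\<integral>X. iexp (\<Sum>i<n. mat_mult_left u T i \<bullet> mat_mult_left u X i) \<partial>\<mu>)"
    unfolding cf_def by (subst integral_distr) (use s in \<open>auto simp: measurable_cong_sets[OF s refl]\<close>)
  also have "\<dots> = cf n T \<mu>"
    unfolding cf_def sum_inner_eq_trace_cgram by (simp add: cgram_mat_mult_left[OF u])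
  finally show ?thesis .
qed

lemma trace_cyclic: "trace (A ** B) = trace (B ** (A :: complex ^ 'm::finite ^ 'm))"
  unfolding trace_def matrix_matrix_mult_def
  by simp (subst sum.swap, simp add: mult.commute)

lemma cf_mat_mult_right:
  assumes inv: "invariant_measure \<mu>" and s: "sets \<mu> = sets borel" and v: "v \<in> unitary_group"
  shows "cf n (mat_mult_right T v) \<mu> = cf n T \<mu>"
proof -
  have "cf n (mat_mult_right T v) \<mu> = cf n (mat_mult_right T v) (distr \<mu> borel (\<lambda>X. mat_mult_right X v))"
    using invariant_measure_right[OF inv v] by simp
  also have "\<dots> = (\<integral>X. iexp (\<Sum>i<n. mat_mult_right T v i \<bullet> mat_mult_right X v i) \<partial>\<mu>)"
    unfolding cf_def by (subst integral_distr) (use s in \<open>auto simp: measurable_cong_sets[OF s refl]\<close>)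
  also have "\<dots> = cf n T \<mu>"
    unfolding cf_def sum_inner_eq_trace_cgram cgram_mat_mult_right
    by (simp add: trace_cyclic[of "conj_transpose v ** _"] matrix_mul_assoc unitary_groupD[OF v])
  finally show ?thesis .
qed

lemma cf_cong: "(\<And>i. i < n \<Longrightarrow> T i = T' i) \<Longrightarrow> cf n T \<mu> = cf n T' \<mu>"
  unfolding cf_def by simp

text \<open>Induction on the set \<open>J\<close> of columns in which \<open>T\<close> and
  \<open>T'\<close> may still differ. The unitary of \<open>householder\<close> for column
  \<open>p\<close> moves it to the column of \<open>T'\<close>; a column already adjusted stays
  fixed, since equal Gram matrices give it the same inner product with the old and the new column
  \<open>p\<close>.\<close>

lemma cf_cong_cgram_aux:
  fixes \<mu> :: "'m::finite inf_mat measure"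
  assumes inv: "invariant_measure \<mu>" and s: "sets \<mu> = sets borel" and "finite J"
    and "\<And>i j. j \<notin> J \<Longrightarrow> i < n \<Longrightarrow> T i $ j = T' i $ j" "cgram n T T = cgram n T' T'"
  shows "cf n T \<mu> = cf n T' \<mu>"
  using \<open>finite J\<close> assms(4,5)
proof (induction J arbitrary: T rule: finite_induct)
  case empty
  then show ?case by (intro cf_cong) (auto simp: vec_eq_iff)
next
  case (insert p J)
  have g: "(\<Sum>i<n. cnj (T i $ j) * T i $ l) = (\<Sum>i<n. cnj (T' i $ j) * T' i $ l)" for j l
    using insert.prems(2) by (simp add: cgram_def vec_eq_iff)
  obtain u where u: "u \<in> unitary_upto n" and up: "\<And>i. i < n \<Longrightarrow> (\<Sum>k<n. u i k * T k $ p) = T' i $ p"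
    and uz: "\<And>z i. (\<Sum>k<n. cnj (T k $ p) * z k) = (\<Sum>k<n. cnj (T' k $ p) * z k) \<Longrightarrow> i < n \<Longrightarrow> (\<Sum>k<n. u i k * z k) = z i"
    using householder[OF g[of p p]] by blast
  have "cf n (mat_mult_left u T) \<mu> = cf n T' \<mu>"
  proof (rule insert.IH)
    show "cgram n (mat_mult_left u T) (mat_mult_left u T) = cgram n T' T'"
      using insert.prems(2) by (simp add: cgram_mat_mult_left[OF u order_refl])
    fix i j assume j: "j \<notin> J" and i: "i < n"
    show "mat_mult_left u T i $ j = T' i $ j"
    proof (cases "j = p")
      case True
      then show ?thesis using i up by (simp add: mat_mult_left_upto[OF u])
    next
      case False
      hence T: "T k $ j = T' k $ j" if "k < n" for k using insert.prems(1) j that by auto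
      have "(\<Sum>k<n. cnj (T' k $ p) * T' k $ j) = (\<Sum>k<n. cnj (T' k $ p) * T k $ j)"
        by (intro sum.cong) (auto simp: T)
      with g[of p j] have "(\<Sum>k<n. u i k * T k $ j) = T i $ j" by (intro uz i) simp
      then show ?thesis using i T by (simp add: mat_mult_left_upto[OF u])
    qed
  qed
  then show ?case using cf_mat_mult_left[OF inv s u] by simp
qed

text \<open>Different heights are reconciled by padding with zero rows, which changes neither the
  characteristic function nor the Gram matrix.\<close>

lemma cf_cong_cgram:
  fixes \<mu> :: "'m::finite inf_mat measure"
  assumes inv: "invariant_measure \<mu>" and s: "sets \<mu> = sets borel" and eq: "cgram n T T = cgram n' T' T'"
  shows "cf n T \<mu> = cf n' T' \<mu>"
proof -
  define pad where "pad k X = (\<lambda>i. if i < k then X i else 0)" for k and X :: "'m inf_mat"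
  have split: "(\<Sum>i<max n n'. f i) = (\<Sum>i<k. f i) + (\<Sum>i\<in>{k..<max n n'}. f i)" if "k \<in> {n, n'}" for f :: "nat \<Rightarrow> 'b::comm_monoid_add" and k
    using that by (metis atLeast0LessThan insert_iff max.cobounded1 max.cobounded2 singletonD sum.atLeastLessThan_concat zero_le)
  have c: "cf (max n n') (pad k X) \<mu> = cf k X \<mu>" if "k \<in> {n, n'}" for k X
    unfolding cf_def split[OF that] by (simp add: pad_def)
  have g: "cgram (max n n') (pad k X) (pad k X) = cgram k X X" if "k \<in> {n, n'}" for k X
    unfolding cgram_def split[OF that] by (simp add: pad_def)
  have "cf (max n n') (pad n T) \<mu> = cf (max n n') (pad n' T') \<mu>"
    by (rule cf_cong_cgram_aux[OF inv s finite_class.finite_UNIV]) (auto simp: g eq)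
  then show ?thesis by (simp add: c)
qed

section \<open>Diagonalization of positive semidefinite matrices\<close>

lemma tendsto_matrix_mult [tendsto_intros]:
  fixes f :: "'a \<Rightarrow> complex ^ 'n::finite ^ 'm::finite" and g :: "'a \<Rightarrow> complex ^ 'k::finite ^ 'n"
  assumes "(f \<longlongrightarrow> A) F" "(g \<longlongrightarrow> B) F"
  shows "((\<lambda>x. f x ** g x) \<longlongrightarrow> A ** B) F"
  unfolding matrix_matrix_mult_def by (intro tendsto_intros assms)

lemma tendsto_conj_transpose [tendsto_intros]:
  assumes "(f \<longlongrightarrow> A) F"
  shows "((\<lambda>x. conj_transpose (f x)) \<longlongrightarrow> conj_transpose (A :: complex ^ 'm::finite ^ 'm)) F"
  unfolding conj_transpose_def by (intro tendsto_intros assms)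

lemma tendsto_trace [tendsto_intros]:
  assumes "(f \<longlongrightarrow> A) F"
  shows "((\<lambda>x. trace (f x)) \<longlongrightarrow> trace (A :: complex ^ 'm::finite ^ 'm)) F"
  unfolding trace_def by (intro tendsto_intros assms)

lemma continuous_on_matrix_mult [continuous_intros]:
  fixes f :: "'a::topological_space \<Rightarrow> complex ^ 'n::finite ^ 'm::finite" and g :: "'a \<Rightarrow> complex ^ 'k::finite ^ 'n"
  assumes "continuous_on S f" "continuous_on S g"
  shows "continuous_on S (\<lambda>x. f x ** g x)"
  using assms unfolding continuous_on_def by (auto intro: tendsto_intros)

lemma continuous_on_conj_transpose [continuous_intros]:
  fixes f :: "'a::topological_space \<Rightarrow> complex ^ 'm::finite ^ 'm"
  assumes "continuous_on S f"
  shows "continuous_on S (\<lambda>x. conj_transpose (f x))"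
  using assms unfolding continuous_on_def by (auto intro: tendsto_intros)

lemma continuous_on_trace [continuous_intros]:
  fixes f :: "'a::topological_space \<Rightarrow> complex ^ 'm::finite ^ 'm"
  assumes "continuous_on S f"
  shows "continuous_on S (\<lambda>x. trace (f x))"
  using assms unfolding continuous_on_def by (auto intro: tendsto_intros)

lemma norm_power2_eq_trace: "(norm A)\<^sup>2 = Re (trace (conj_transpose A ** (A :: complex ^ 'm::finite ^ 'm)))"
proof -
  have "(norm A)\<^sup>2 = (\<Sum>i\<in>UNIV. \<Sum>j\<in>UNIV. Re (cnj (A $ i $ j) * A $ i $ j))"
    by (simp add: power2_norm_eq_inner inner_vec_def inner_complex_def)
  also have "\<dots> = (\<Sum>j\<in>UNIV. \<Sum>i\<in>UNIV. Re (cnj (A $ i $ j) * A $ i $ j))"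
    by (rule sum.swap)
  finally show ?thesis by (simp add: trace_def matrix_matrix_mult_def)
qed

lemma compact_unitary_group: "compact (unitary_group :: (complex ^ 'm::finite ^ 'm) set)"
proof -
  have "closed {v :: complex ^ 'm ^ 'm. v ** conj_transpose v = mat 1}"
    by (intro closed_Collect_eq continuous_intros)
  moreover have "unitary_group = {v :: complex ^ 'm ^ 'm. v ** conj_transpose v = mat 1}"
    by (auto dest: unitary_groupD intro: unitary_groupI)
  moreover have "norm v \<le> sqrt (Re (trace (mat 1 :: complex ^ 'm ^ 'm)))" if "v \<in> unitary_group" for v :: "complex ^ 'm ^ 'm"
    by (rule real_le_rsqrt) (simp add: norm_power2_eq_trace unitary_groupD[OF that])
  then have "bounded (unitary_group :: (complex ^ 'm ^ 'm) set)" by (auto simp: bounded_iff)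
  ultimately show ?thesis by (simp add: compact_eq_bounded_closed)
qed

text \<open>A matrix \<open>C\<close> takes the place of a vector because this is the expression
  that the Gaussian averages produce.\<close>

definition herm_form :: "complex ^ 'm ^ 'm \<Rightarrow> complex ^ 'm ^ 'm \<Rightarrow> real" where
  "herm_form C S = Re (trace (conj_transpose C ** S ** (C :: complex ^ 'm::finite ^ 'm)))"

definition psd :: "complex ^ 'm::finite ^ 'm \<Rightarrow> bool" where
  "psd S \<longleftrightarrow> conj_transpose S = S \<and> (\<forall>C. 0 \<le> herm_form C S)"

lemma tendsto_herm_form [tendsto_intros]:
  assumes "(f \<longlongrightarrow> S) F"
  shows "((\<lambda>x. herm_form C (f x)) \<longlongrightarrow> herm_form C S) F"
  unfolding herm_form_def by (intro tendsto_intros assms)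

lemma herm_form_scaleR [simp]: "herm_form C (c *\<^sub>R S) = c * herm_form C S"
proof -
  have "conj_transpose C ** (c *\<^sub>R S) ** C = c *\<^sub>R (conj_transpose C ** S ** C)"
    by (simp add: vec_eq_iff matrix_matrix_mult_def flip: scaleR_sum_right)
  then show ?thesis by (simp add: herm_form_def trace_def scaleR_sum_right[symmetric])
qed

lemma herm_form_cgram: "herm_form C (cgram n X X) = (\<Sum>i<n. (norm (X i v* C))\<^sup>2)"
  using sum_inner_eq_trace_cgram[of "mat_mult_right X C" "mat_mult_right X C" n]
  by (simp add: herm_form_def cgram_mat_mult_right) (simp add: mat_mult_right_def power2_norm_eq_inner)

lemma conj_transpose_cgram: "conj_transpose (cgram n X X) = cgram n X X"
  by (simp add: vec_eq_iff cgram_def mult.commute)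

lemma psd_cgram: "0 \<le> c \<Longrightarrow> psd (c *\<^sub>R cgram n X X)"
  using conj_transpose_cgram[of n X]
  by (auto simp: psd_def herm_form_cgram vec_eq_iff intro!: mult_nonneg_nonneg sum_nonneg)

lemma psd_tendsto:
  assumes "(f \<longlongrightarrow> S) F" "F \<noteq> bot" "\<And>x. psd (f x)"
  shows "psd S"
  unfolding psd_def
proof safe
  have "((\<lambda>x. conj_transpose (f x)) \<longlongrightarrow> conj_transpose S) F" by (intro tendsto_intros assms)
  with assms show "conj_transpose S = S" by (auto simp: psd_def intro: tendsto_unique)
  fix C show "0 \<le> herm_form C S"
    using assms by (intro tendsto_lowerbound[OF tendsto_herm_form[OF assms(1)]]) (auto simp: psd_def)
qed

text \<open>Unitary and acting only in the plane of the coordinates \<open>p\<close> and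
  \<open>q\<close>, provided that \<open>p \<noteq> q\<close> and
  \<open>a^2 + |b|^2 = 1\<close>.\<close>

definition rotation :: "'m \<Rightarrow> 'm \<Rightarrow> real \<Rightarrow> complex \<Rightarrow> complex ^ 'm::finite ^ 'm" where
  "rotation p q a b = (\<chi> i j. if i = p then (if j = p then of_real a else if j = q then b else 0)
     else if i = q then (if j = p then - cnj b else if j = q then of_real a else 0)
     else if i = j then 1 else 0)"

lemma sum_rotation:
  assumes "p \<noteq> q"
  shows "(\<Sum>k\<in>UNIV. rotation p q a b $ i $ k * f k) =
    (if i = p then of_real a * f p + b * f q else if i = q then - cnj b * f p + of_real a * f q else f i)"
proof -
  have *: "(\<Sum>k\<in>UNIV. (if k = p then x else if k = q then y else 0) * f k) = x * f p + y * f q" for x y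
  proof -
    have "(\<Sum>k\<in>UNIV. (if k = p then x else if k = q then y else 0) * f k) =
      (\<Sum>k\<in>UNIV. (if k = p then x * f k else 0) + (if k = q then y * f k else 0))"
      using assms by (intro sum.cong) auto
    then show ?thesis by (simp add: sum.distrib)
  qed
  have "(\<Sum>k\<in>UNIV. (if i = k then 1 else 0) * f k) = f i"
    by (simp add: if_distrib[of "\<lambda>x. x * _"] cong: if_cong)
  then show ?thesis using assms by (simp add: rotation_def * cong: if_cong)
qed

lemma sum_rotation_cnj:
  assumes "p \<noteq> q"
  shows "(\<Sum>k\<in>UNIV. f k * cnj (rotation p q a b $ i $ k)) =
    (if i = p then of_real a * f p + cnj b * f q else if i = q then - b * f p + of_real a * f q else f i)"
proof -
  have "(\<Sum>k\<in>UNIV. f k * cnj (rotation p q a b $ i $ k)) = cnj (\<Sum>k\<in>UNIV. rotation p q a b $ i $ k * cnj (f k))"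
    by (simp add: mult.commute)
  then show ?thesis using sum_rotation[OF assms, of a b i "\<lambda>k. cnj (f k)"] by simp
qed

lemma rotation_unitary:
  assumes "p \<noteq> q" "a\<^sup>2 + (norm b)\<^sup>2 = 1"
  shows "rotation p q a b \<in> unitary_group"
proof (rule unitary_groupI)
  have "complex_of_real a * of_real a + b * cnj b = 1"
    using assms(2) by (metis complex_norm_square of_real_1 of_real_add of_real_mult power2_eq_square)
  then show "rotation p q a b ** conj_transpose (rotation p q a b) = mat 1"
    using assms(1) by (simp add: vec_eq_iff matrix_matrix_mult_def sum_rotation)
      (auto simp: rotation_def mat_def mult.commute add.commute)
qed

lemma rotation_diagonal:
  assumes "p \<noteq> q"
  shows "(rotation p q a b ** B ** conj_transpose (rotation p q a b)) $ i $ i =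
    (if i = p then of_real a * (of_real a * B $ p $ p + b * B $ q $ p) + cnj b * (of_real a * B $ p $ q + b * B $ q $ q)
     else if i = q then - b * (- cnj b * B $ p $ p + of_real a * B $ q $ p) + of_real a * (- cnj b * B $ p $ q + of_real a * B $ q $ q)
     else B $ i $ i)"
  using assms by (simp add: matrix_matrix_mult_def sum_rotation_cnj sum_rotation)

lemma conj_transpose_diag_mat [simp]: "conj_transpose (diag_mat s) = diag_mat s"
  by (simp add: vec_eq_iff diag_mat_def)

text \<open>At a maximiser of \<open>v \<mapsto> \<Sum>\<^sub>j c\<^sub>j (v S v\<^sup>*)\<^sub>j\<^sub>j\<close> over the unitary group, with \<open>c\<close> strictly decreasing,
  the matrix \<open>v S v\<^sup>*\<close> is diagonal with decreasing entries: plane rotations give the variations.\<close>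

proposition psd_diagonalization:
  fixes S :: "complex ^ 'm::{finite,linorder} ^ 'm::{finite,linorder}"
  assumes "psd S"
  obtains v s where "v \<in> unitary_group" "s \<in> ordered_cone"
    "S = conj_transpose (diag_mat s ** v) ** (diag_mat s ** v)"
proof -
  have S: "conj_transpose S = S" and S0: "\<And>C. 0 \<le> herm_form C S" using assms by (auto simp: psd_def)
  \<comment> \<open>Any strictly decreasing weights would do; they force the diagonal at a maximiser
    to be sorted.\<close>
  define c where "c j = - real (card {i::'m. i < j})" for j
  have c: "c q < c p" if "p < q" for p q
    unfolding c_def using that by (simp, intro psubset_card_mono) (auto dest: less_trans)
  define f where "f v = (\<Sum>j\<in>UNIV. c j * Re ((v ** S ** conj_transpose v) $ j $ j))" for v
  have "continuous_on unitary_group f" unfolding f_def by (intro continuous_intros)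
  then obtain v where v: "v \<in> unitary_group" and max: "\<And>w. w \<in> unitary_group \<Longrightarrow> f w \<le> f v"
    using continuous_attains_sup[OF compact_unitary_group, of f] mat_1_unitary by blast
  define B where "B = v ** S ** conj_transpose v"
  have B: "B $ j $ i = cnj (B $ i $ j)" for i j
  proof -
    have "conj_transpose B = B" by (simp add: B_def conj_transpose_mult S matrix_mul_assoc)
    then show ?thesis by (metis conj_transpose_nth)
  qed
  have var: "(norm b)\<^sup>2 * (Re (B $ q $ q) - Re (B $ p $ p)) + 2 * a * Re (cnj b * B $ p $ q) \<le> 0"
    if pq: "p < q" and ab: "a\<^sup>2 + (norm b)\<^sup>2 = 1" for p q a b
  proof -
    define R where "R = rotation p q a b"
    define d where "d j = Re ((R ** B ** conj_transpose R) $ j $ j) - Re (B $ j $ j)" for j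
    have ne: "p \<noteq> q" using pq by auto
    have "R ** v \<in> unitary_group" unfolding R_def by (intro mult_unitary rotation_unitary v ne ab)
    moreover have "(R ** v) ** S ** conj_transpose (R ** v) = R ** B ** conj_transpose R"
      by (simp add: B_def conj_transpose_mult matrix_mul_assoc)
    ultimately have "(\<Sum>j\<in>UNIV. c j * d j) \<le> 0"
      using max[of "R ** v"] by (simp add: f_def d_def right_diff_distrib sum_subtractf B_def)
    \<comment> \<open>The rotation alters only the diagonal entries at \<open>p\<close> and
      \<open>q\<close>.\<close>
    also have "(\<Sum>j\<in>UNIV. c j * d j) = (\<Sum>j\<in>{p, q}. c j * d j)"
      by (intro sum.mono_neutral_right) (auto simp: d_def R_def rotation_diagonal[OF ne])
    finally have le: "c p * d p + c q * d q \<le> 0" using ne by simp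
    have nb: "(norm b)\<^sup>2 = Re b * Re b + Im b * Im b" using cmod_power2[of b] by (simp add: power2_eq_square)
    have a2: "a * a = 1 - (norm b)\<^sup>2" using ab by (simp add: power2_eq_square)
    have dp: "d p = (norm b)\<^sup>2 * (Re (B $ q $ q) - Re (B $ p $ p)) + 2 * a * Re (cnj b * B $ p $ q)"
    proof -
      have "d p = a * a * Re (B $ p $ p) - Re (B $ p $ p) + (norm b)\<^sup>2 * Re (B $ q $ q) + 2 * a * Re (cnj b * B $ p $ q)"
        unfolding d_def R_def rotation_diagonal[OF ne] nb using B[of p q] by (simp add: algebra_simps)
      then show ?thesis unfolding a2 by (simp add: algebra_simps)
    qed
    \<comment> \<open>The trace is preserved, so what one entry gains the other loses.\<close>
    have dq: "d q = - d p"
    proof -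
      have "d q = a * a * Re (B $ q $ q) - Re (B $ q $ q) + (norm b)\<^sup>2 * Re (B $ p $ p) - 2 * a * Re (cnj b * B $ p $ q)"
        unfolding d_def R_def rotation_diagonal[OF ne] nb using B[of p q] ne by (simp add: algebra_simps)
      then show ?thesis unfolding dp a2 by (simp add: algebra_simps)
    qed
    have "(c p - c q) * d p \<le> 0" using le dq by (simp add: algebra_simps)
    then have "d p \<le> 0" using c[OF pq] by (simp add: mult_le_0_iff)
    then show ?thesis using dp by simp
  qed
  \<comment> \<open>With \<open>a = 0\<close> and \<open>b = 1\<close> the rotation exchanges the
    two diagonal entries.\<close>
  have sorted: "Re (B $ q $ q) \<le> Re (B $ p $ p)" if "p < q" for p q
    using var[OF that, of 0 1] by simp
  have off: "B $ p $ q = 0" if pq: "p < q" for p q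
  proof (rule ccontr)
    assume ne: "B $ p $ q \<noteq> 0"
    define h where "h = norm (B $ p $ q)"
    define D where "D = Re (B $ q $ q) - Re (B $ p $ p)"
    have h: "h > 0" using ne by (simp add: h_def)
    \<comment> \<open>The phase of \<open>b\<close> makes the term linear in \<open>t\<close> equal
      to \<open>2 a^2 t h > 0\<close>. For this \<open>t\<close> one has
      \<open>|t D| \<le> h\<close>, so the quadratic term is at most half as large, and the rotation
      would increase the maximum.\<close>
    define t where "t = h / (\<bar>D\<bar> + 1)"
    define a where "a = 1 / sqrt (1 + t\<^sup>2)"
    define b where "b = of_real (a * t) * (B $ p $ q / of_real h)"
    have a: "a > 0" "a\<^sup>2 * (1 + t\<^sup>2) = 1"
      unfolding a_def by (auto simp: power_divide add_pos_nonneg) (metis add_pos_nonneg less_irrefl zero_le_power2 zero_less_one)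
    have t: "t > 0" using h by (simp add: t_def)
    have nb: "norm b = a * t" using a t h by (simp add: b_def norm_mult norm_divide h_def)
    have "a\<^sup>2 + (norm b)\<^sup>2 = 1" using a(2) by (simp add: nb algebra_simps power_mult_distrib)
    from var[OF pq this] have "(a * t)\<^sup>2 * D + 2 * a * Re (cnj b * B $ p $ q) \<le> 0"
      by (simp add: nb D_def)
    also have "cnj b * B $ p $ q = of_real (a * t * h)"
    proof -
      have "cnj b * B $ p $ q = of_real (a * t / h) * (B $ p $ q * cnj (B $ p $ q))"
        by (simp add: b_def mult_ac)
      also have "B $ p $ q * cnj (B $ p $ q) = of_real (h\<^sup>2)"
        by (simp only: complex_norm_square h_def)
      finally show ?thesis using h by (simp add: power2_eq_square)
    qed
    finally have "a\<^sup>2 * t * (t * D + 2 * h) \<le> 0" by (simp add: power2_eq_square algebra_simps)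
    then have 1: "t * D + 2 * h \<le> 0" using a t by (simp add: mult_le_0_iff)
    have "\<bar>t * D\<bar> \<le> t * (\<bar>D\<bar> + 1)" using t by (simp add: abs_mult)
    also have "\<dots> = h" by (simp add: t_def)
    finally show False using 1 h by linarith
  qed
  have diag: "B $ p $ q = 0" if "p \<noteq> q" for p q
    using that off[of p q] off[of q p] B[of p q] by (cases p q rule: linorder_cases) auto
  have nonneg: "0 \<le> Re (B $ j $ j)" for j
  proof -
    \<comment> \<open>A matrix unit tests positivity on the \<open>j\<close>-th coordinate
      vector.\<close>
    define E where "E = (\<chi> i k. if i = j \<and> k = j then 1 else (0::complex))"
    have "(conj_transpose E ** B ** E) $ i $ i = (if i = j then B $ j $ j else 0)" for i
      by (simp add: matrix_matrix_mult_def E_def if_distrib[of "\<lambda>x. x * _"] if_distrib[of "\<lambda>x. _ * x"] if_distrib[of cnj]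
        cong: if_cong)
    then have "herm_form (conj_transpose v ** E) S = Re (B $ j $ j)"
      by (simp add: herm_form_def trace_def conj_transpose_mult B_def matrix_mul_assoc)
    then show ?thesis using S0 by metis
  qed
  define s where "s = (\<chi> j. sqrt (Re (B $ j $ j)))"
  have "s \<in> ordered_cone"
    using sorted nonneg by (auto simp: ordered_cone_def s_def le_less)
  moreover have "diag_mat s ** diag_mat s = B"
  proof (intro vec_eq_iff[THEN iffD2] allI)
    fix i j
    have "Im (B $ i $ i) = 0" using B[of i i] by (simp add: complex_eq_iff)
    then have "of_real (sqrt (Re (B $ i $ i))) * of_real (sqrt (Re (B $ i $ i))) = B $ i $ i"
      using nonneg[of i] by (simp add: complex_eq_iff)
    then show "(diag_mat s ** diag_mat s) $ i $ j = B $ i $ j"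
      using diag[of i j] by (cases "i = j") (simp_all add: matrix_matrix_mult_def diag_mat_def s_def
          if_distrib[of "\<lambda>x. x * _"] if_distrib[of "\<lambda>x. _ * x"] cong: if_cong)
  qed
  then have "conj_transpose (diag_mat s ** v) ** (diag_mat s ** v) = conj_transpose v ** B ** v"
    by (simp add: conj_transpose_mult matrix_mul_assoc) (metis matrix_mul_assoc)
  moreover have "conj_transpose v ** B ** v = S"
    by (simp add: B_def matrix_mul_assoc unitary_groupD[OF v]) (simp add: matrix_mul_assoc[symmetric] unitary_groupD[OF v])
  ultimately show ?thesis using v that by metis
qed

section \<open>Invariant measures and Gram matrices\<close>

lemma LIMSEQ_subsubseqI:
  fixes x :: "nat \<Rightarrow> 'a::metric_space"
  assumes "\<And>r :: nat \<Rightarrow> nat. strict_mono r \<Longrightarrow> \<exists>s. strict_mono s \<and> (\<lambda>k. x (r (s k))) \<longlonglongrightarrow> L"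
  shows "x \<longlonglongrightarrow> L"
proof (rule ccontr)
  assume "\<not> x \<longlonglongrightarrow> L"
  then obtain e where e: "e > 0" "\<not> eventually (\<lambda>k. dist (x k) L < e) sequentially"
    by (auto simp: tendsto_iff)
  then have "infinite {k. \<not> dist (x k) L < e}"
    by (simp add: not_eventually frequently_sequentially infinite_nat_iff_unbounded_le) 
  then obtain r :: "nat \<Rightarrow> nat" where r: "strict_mono r" "\<And>k. \<not> dist (x (r k)) L < e"
    using infinite_enumerate by blast
  then obtain s where "(\<lambda>k. x (r (s k))) \<longlonglongrightarrow> L" using assms by blast
  with e(1) have "eventually (\<lambda>k. dist (x (r (s k))) L < e) sequentially" by (auto simp: tendsto_iff)
  with r(2) show False by simp
qed

text \<open>An enumeration of the column indices, used to place a square matrix in the first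
  \<open>CARD('m)\<close> rows of an infinite one.\<close>

definition row_index :: "nat \<Rightarrow> 'm::finite" where
  "row_index = (SOME h. bij_betw h {0..<CARD('m)} UNIV)"

lemma bij_betw_row_index: "bij_betw (row_index :: nat \<Rightarrow> 'm::finite) {..<CARD('m)} UNIV"
  unfolding row_index_def atLeast0LessThan[symmetric]
  by (rule someI_ex[of "\<lambda>h. bij_betw h {0..<CARD('m)} UNIV"]) (rule ex_bij_betw_nat_finite, simp)

lemma sum_row_index: "(\<Sum>i<CARD('m). f (row_index i :: 'm::finite)) = (\<Sum>j\<in>UNIV. f j)"
  by (rule sum.reindex_bij_betw[OF bij_betw_row_index])

definition emb :: "complex ^ 'm ^ 'm \<Rightarrow> 'm::finite inf_mat" where
  "emb A = (\<lambda>i. A $ row_index i)"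

lemma cgram_emb: "cgram CARD('m) (emb A) (emb B) = conj_transpose A ** (B :: complex ^ 'm::finite ^ 'm)"
  by (simp add: vec_eq_iff cgram_def emb_def matrix_matrix_mult_def
      sum_row_index[where f="\<lambda>i. cnj (A $ i $ _) * B $ i $ _"])

text \<open>The characteristic function at a square matrix with Gram matrix \<open>A^H A\<close>.
  For an invariant measure these values suffice, since every Gram matrix has this form by
  \<open>psd_diagonalization\<close>.\<close>

definition cfm :: "complex ^ 'm ^ 'm \<Rightarrow> 'm::finite inf_mat measure \<Rightarrow> complex" where
  "cfm A M = cf CARD('m) (emb A) M"

lemma cfm_tendsto:
  fixes M :: "'m::finite inf_mat measure"
  assumes "prob_space M" and s[measurable_cong]: "sets M = sets borel" and "B \<longlonglongrightarrow> A"
  shows "(\<lambda>k. cfm (B k) M) \<longlonglongrightarrow> cfm A M"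
proof -
  interpret prob_space M by fact
  show ?thesis unfolding cfm_def cf_def
  proof (rule integral_dominated_convergence[where w="\<lambda>_. 1"])
    show "AE X in M. (\<lambda>k. iexp (\<Sum>i<CARD('m). emb (B k) i \<bullet> X i)) \<longlonglongrightarrow> iexp (\<Sum>i<CARD('m). emb A i \<bullet> X i)"
      unfolding emb_def by (intro AE_I2 tendsto_intros assms)
  qed auto
qed

lemma cf_cfm:
  fixes M :: "'m::{finite,linorder} inf_mat measure"
  assumes "invariant_measure M" "sets M = sets borel"
  obtains A where "conj_transpose A ** A = cgram n T T" "cf n T M = cfm A M"
proof -
  obtain v s where e: "cgram n T T = conj_transpose (diag_mat s ** v) ** (diag_mat s ** v)"
    using psd_diagonalization[OF psd_cgram[of 1 n T]] by (metis scaleR_one zero_le_one)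
  have "cf n T M = cfm (diag_mat s ** v) M"
    unfolding cfm_def by (rule cf_cong_cgram[OF assms]) (simp add: e cgram_emb)
  with e show ?thesis by (intro that[of "diag_mat s ** v"]) simp_all
qed

lemma cfm_cong:
  assumes "invariant_measure M" "sets M = sets borel" "conj_transpose A ** A = conj_transpose B ** B"
  shows "cfm A M = cfm B M"
  unfolding cfm_def by (rule cf_cong_cgram[OF assms(1,2)]) (simp add: cgram_emb assms(3))

lemma invariant_measure_eqI:
  fixes M N :: "'m::{finite,linorder} inf_mat measure"
  assumes M: "prob_space M" "invariant_measure M" "sets M = sets borel"
    and N: "prob_space N" "invariant_measure N" "sets N = sets borel"
    and eq: "\<And>A. cfm A M = cfm A N"
  shows "M = N"
proof (rule inf_mat_measure_eqI[OF M(1) N(1) M(3) N(3)])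
  fix n T
  obtain A where A: "conj_transpose A ** A = cgram n T T" "cf n T M = cfm A M" by (rule cf_cfm[OF M(2,3)])
  moreover have "cf n T N = cfm A N"
    unfolding cfm_def by (rule cf_cong_cgram[OF N(2,3)]) (simp add: A cgram_emb)
  ultimately show "cf n T M = cf n T N" using eq by simp
qed

text \<open>Continuity in the Gram matrix, although the heights \<open>n k\<close> may grow. The
  \<open>T k\<close> are replaced by square matrices \<open>B k\<close> with the same Gram matrices,
  bounded because the traces converge. The \<open>B k\<close> need not tend to \<open>A\<close>, but
  each limit point \<open>L\<close> satisfies \<open>L^H L = A^H A\<close> and so has the same value
  of \<open>cfm\<close>.\<close>

lemma cf_tendsto_cfm:
  fixes M :: "'m::{finite,linorder} inf_mat measure"
  assumes M: "prob_space M" "invariant_measure M" "sets M = sets borel"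
    and lim: "(\<lambda>k. cgram (n k) (T k) (T k)) \<longlonglongrightarrow> conj_transpose A ** A"
  shows "(\<lambda>k. cf (n k) (T k) M) \<longlonglongrightarrow> cfm A M"
proof -
  have "\<exists>B. conj_transpose B ** B = cgram (n k) (T k) (T k) \<and> cf (n k) (T k) M = cfm B M" for k
    using cf_cfm[OF M(2,3)] by metis
  then obtain B where B: "\<And>k. conj_transpose (B k) ** B k = cgram (n k) (T k) (T k)" "\<And>k. cf (n k) (T k) M = cfm (B k) M"
    by metis
  have "(\<lambda>k. Re (trace (conj_transpose (B k) ** B k))) \<longlonglongrightarrow> Re (trace (conj_transpose A ** A))"
    unfolding B by (intro tendsto_intros lim)
  then have "Bseq (\<lambda>k. Re (trace (conj_transpose (B k) ** B k)))" by (intro convergent_imp_Bseq convergentI)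
  then obtain K where K: "\<And>k. Re (trace (conj_transpose (B k) ** B k)) \<le> K"
    by (auto elim!: BseqE) (meson abs_le_D1)
  have bd: "norm (B k) \<le> sqrt K" for k
    by (rule real_le_rsqrt) (simp add: norm_power2_eq_trace K)
  show ?thesis unfolding B
  proof (rule LIMSEQ_subsubseqI)
    fix r :: "nat \<Rightarrow> nat" assume r: "strict_mono r"
    have "bounded (range (\<lambda>k. B (r k)))" using bd by (auto simp: bounded_iff)
    then obtain L s where s: "strict_mono s" and L: "((\<lambda>k. B (r k)) \<circ> s) \<longlonglongrightarrow> L"
      using bounded_imp_convergent_subsequence by blast
    then have L: "(\<lambda>k. B (r (s k))) \<longlonglongrightarrow> L" by (simp add: comp_def)
    have "(\<lambda>k. conj_transpose (B (r (s k))) ** B (r (s k))) \<longlonglongrightarrow> conj_transpose L ** L"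
      by (intro tendsto_intros L)
    moreover have "(\<lambda>k. conj_transpose (B (r (s k))) ** B (r (s k))) \<longlonglongrightarrow> conj_transpose A ** A"
      using LIMSEQ_subseq_LIMSEQ[OF LIMSEQ_subseq_LIMSEQ[OF lim r] s] by (simp add: B comp_def)
    ultimately have "conj_transpose L ** L = conj_transpose A ** A" by (rule LIMSEQ_unique)
    then have "cfm L M = cfm A M" by (rule cfm_cong[OF M(2,3)])
    with cfm_tendsto[OF M(1,3) L] s show "\<exists>s. strict_mono s \<and> (\<lambda>k. cfm (B (r (s k))) M) \<longlonglongrightarrow> cfm A M" by auto
  qed
qed

section \<open>Complex Gaussian variables\<close>

text \<open>The centred normal law of variance 1/2, to which the name refers: the law of the real
  and of the imaginary part of a standard complex Gaussian.\<close>

definition half_normal :: "real measure" where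
  "half_normal = density lborel (normal_density 0 (sqrt (1 / 2)))"

lemma sets_half_normal [simp, measurable_cong]: "sets half_normal = sets borel"
  and space_half_normal [simp]: "space half_normal = UNIV"
  by (simp_all add: half_normal_def)

lemma prob_space_half_normal: "prob_space half_normal"
  unfolding half_normal_def by (rule prob_space_normal_density) simp

interpretation half_normal: prob_space half_normal by (rule prob_space_half_normal)
interpretation half_normal_pair: pair_prob_space half_normal half_normal ..

lemma char_half_normal: "(\<integral>x. iexp (t * x) \<partial>half_normal) = exp (- t\<^sup>2 / 4)"
proof -
  let ?D = "std_normal_distribution"
  interpret D: prob_space ?D by (rule prob_space_normal_density) simp
  have "distributed ?D lborel (\<lambda>x. x) std_normal_density"
    by (simp add: distributed_def distr_id2)
  from D.normal_density_affine[OF this, of "sqrt (1 / 2)" 0]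
  have d: "distr ?D lborel (\<lambda>x. sqrt (1 / 2) * x) = half_normal"
    by (simp add: distributed_def half_normal_def)
  have "(\<integral>x. iexp (t * x) \<partial>half_normal) = (\<integral>x. iexp (t * (sqrt (1 / 2) * x)) \<partial>?D)"
    unfolding d[symmetric] by (subst integral_distr) auto
  also have "\<dots> = char ?D (t * sqrt (1 / 2))" by (simp add: char_def mult_ac)
  also have "\<dots> = exp (- t\<^sup>2 / 4)"
  proof -
    have "- ((t * sqrt (1 / 2))\<^sup>2) / 2 = - t\<^sup>2 / 4" by (simp add: power_mult_distrib)
    then show ?thesis unfolding char_std_normal_distribution by (simp only: exp_of_real)
  qed
  finally show ?thesis .
qed

lemma half_normal_exp_square:
  assumes "0 \<le> a"
  shows "(\<integral>x. exp (- (a * x\<^sup>2)) \<partial>half_normal) = 1 / sqrt (1 + a)"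
proof -
  \<comment> \<open>The factor \<open>exp (- a x^2)\<close> turns the density of variance 1/2 into a
    multiple of the density with this standard deviation.\<close>
  define \<sigma> where "\<sigma> = sqrt (1 / (2 * (1 + a)))"
  have s: "\<sigma>\<^sup>2 = 1 / (2 * (1 + a))" using assms by (simp add: \<sigma>_def)
  have "normal_density 0 (sqrt (1 / 2)) x * exp (- (a * x\<^sup>2)) = (1 / sqrt (1 + a)) * normal_density 0 \<sigma> x" for x
  proof -
    have 1: "2 * pi * (1 / (2 * (1 + a))) = pi / (1 + a)" using assms by (simp add: field_simps)
    have 2: "- (x - 0)\<^sup>2 / (2 * (1 / (2 * (1 + a)))) = - ((1 + a) * x\<^sup>2)" using assms by (simp add: field_simps)
    have "normal_density 0 \<sigma> x = sqrt (1 + a) * (1 / sqrt pi) * exp (- ((1 + a) * x\<^sup>2))"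
      unfolding normal_density_def s 1 2 by (simp add: real_sqrt_divide)
    moreover have "exp (- x\<^sup>2) * exp (- (a * x\<^sup>2)) = exp (- ((1 + a) * x\<^sup>2))"
      by (simp add: exp_add[symmetric] algebra_simps)
    moreover have "normal_density 0 (sqrt (1 / 2)) x = (1 / sqrt pi) * exp (- x\<^sup>2)"
      by (simp add: normal_density_def)
    ultimately show ?thesis using assms by (simp add: mult.assoc)
  qed
  then have "(\<integral>x. exp (- (a * x\<^sup>2)) \<partial>half_normal) = (\<integral>x. (1 / sqrt (1 + a)) * normal_density 0 \<sigma> x \<partial>lborel)"
    unfolding half_normal_def by (subst integral_density) auto
  also have "\<dots> = 1 / sqrt (1 + a)"
    using assms by (simp add: \<sigma>_def)
  finally show ?thesis .
qed

lemma half_normal_moments: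
  "integrable half_normal (\<lambda>x. x ^ k)" "(\<integral>x. x \<partial>half_normal) = 0" "(\<integral>x. x\<^sup>2 \<partial>half_normal) = 1 / 2"
proof -
  show "integrable half_normal (\<lambda>x. x ^ k)"
    unfolding half_normal_def using integrable_normal_moment[of "sqrt (1/2)" 0 k]
    by (subst integrable_density) (auto simp: mult.commute)
  show "(\<integral>x. x \<partial>half_normal) = 0"
    unfolding half_normal_def using integral_normal_moment_nz_1[of "sqrt (1/2)" 0]
    by (subst integral_density) auto
  show "(\<integral>x. x\<^sup>2 \<partial>half_normal) = 1 / 2"
    unfolding half_normal_def using integral_normal_moment_even[of "sqrt (1/2)" 0 1]
    by (subst integral_density) (auto simp: power_divide)
qed

text \<open>Full support of the normal law; it will allow conditioning a Gaussian matrix on an open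
  set.\<close>

lemma half_normal_interval_pos:
  assumes "a < b"
  shows "emeasure half_normal {a<..<b} > 0"
proof (rule ccontr)
  assume "\<not> ?thesis"
  then have "(\<integral>\<^sup>+x. ennreal (normal_density 0 (sqrt (1 / 2)) x) * indicator {a<..<b} x \<partial>lborel) = 0"
    by (simp add: half_normal_def emeasure_density)
  then have "AE x in lborel. ennreal (normal_density 0 (sqrt (1 / 2)) x) * indicator {a<..<b} x = 0"
    by (subst (asm) nn_integral_0_iff_AE) auto
  moreover have "normal_density 0 (sqrt (1 / 2)) x \<noteq> 0" for x
    by (rule less_imp_neq[symmetric]) (rule normal_density_pos, simp)
  ultimately have "AE x in lborel. x \<notin> {a<..<b}"
    by (auto elim!: eventually_mono split: split_indicator_asm)
  then have "emeasure lborel {a<..<b} = 0"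
    by (subst (asm) AE_iff_measurable[where N="{a<..<b}"]) auto
  with assms show False by simp
qed

lemma complex_gaussian_eq: "complex_gaussian = distr (half_normal \<Otimes>\<^sub>M half_normal) borel (\<lambda>(x, y). Complex x y)"
  by (simp add: complex_gaussian_def half_normal_def Let_def)

lemma sets_complex_gaussian [simp, measurable_cong]: "sets complex_gaussian = sets borel"
  and space_complex_gaussian [simp]: "space complex_gaussian = UNIV"
  by (simp_all add: complex_gaussian_eq)

lemma prob_space_complex_gaussian: "prob_space complex_gaussian"
  unfolding complex_gaussian_eq
  by (rule half_normal_pair.prob_space_distr) (simp add: split_def)

interpretation complex_gaussian: prob_space complex_gaussian by (rule prob_space_complex_gaussian)

lemma complex_gaussian_product:
  fixes f g :: "real \<Rightarrow> 'b::{real_normed_field, banach, second_countable_topology}"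
  assumes [measurable]: "f \<in> borel_measurable borel" "g \<in> borel_measurable borel"
    and b: "\<And>x. norm (f x) \<le> 1" "\<And>x. norm (g x) \<le> 1"
  shows "(\<integral>z. f (Re z) * g (Im z) \<partial>complex_gaussian) = (\<integral>x. f x \<partial>half_normal) * (\<integral>x. g x \<partial>half_normal)"
proof -
  have "integrable (half_normal \<Otimes>\<^sub>M half_normal) (\<lambda>z. f (fst z) * g (snd z))"
    by (intro half_normal_pair.integrable_const_bound[where B=1]) (auto simp: norm_mult intro!: mult_le_one b)
  from half_normal_pair.integral_fst'[OF this] show ?thesis
    unfolding complex_gaussian_eq by (subst integral_distr) (auto simp: split_def)
qed

lemma complex_gaussian_char: "(\<integral>z. iexp (z \<bullet> c) \<partial>complex_gaussian) = exp (- (norm c)\<^sup>2 / 4)"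
proof -
  have "iexp (z \<bullet> c) = iexp (Re c * Re z) * iexp (Im c * Im z)" for z
    by (simp add: inner_complex_def exp_add[symmetric] distrib_left mult_ac add_ac)
  then have "(\<integral>z. iexp (z \<bullet> c) \<partial>complex_gaussian) =
      (\<integral>x. iexp (Re c * x) \<partial>half_normal) * (\<integral>x. iexp (Im c * x) \<partial>half_normal)"
    using complex_gaussian_product[of "\<lambda>x. iexp (Re c * x)" "\<lambda>x. iexp (Im c * x)"] by simp
  then show ?thesis
    by (simp only: char_half_normal) (simp add: cmod_power2 exp_add[symmetric] exp_of_real[symmetric] diff_divide_distrib)
qed

lemma complex_gaussian_exp_norm_square:
  assumes "0 \<le> a"
  shows "(\<integral>z. exp (- (a * (norm z)\<^sup>2)) \<partial>complex_gaussian) = 1 / (1 + a)"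
proof -
  have "exp (- (a * (norm z)\<^sup>2)) = exp (- (a * (Re z)\<^sup>2)) * exp (- (a * (Im z)\<^sup>2))" for z
    by (simp add: cmod_power2 exp_add[symmetric] algebra_simps)
  then have "(\<integral>z. exp (- (a * (norm z)\<^sup>2)) \<partial>complex_gaussian) =
      (\<integral>x. exp (- (a * x\<^sup>2)) \<partial>half_normal) * (\<integral>x. exp (- (a * x\<^sup>2)) \<partial>half_normal)"
    using complex_gaussian_product[of "\<lambda>x. exp (- (a * x\<^sup>2))" "\<lambda>x. exp (- (a * x\<^sup>2))"] assms by simp
  then show ?thesis using assms by (simp add: half_normal_exp_square)
qed

lemma distr_Re_Im_complex_gaussian:
  "distr complex_gaussian borel Re = half_normal" "distr complex_gaussian borel Im = half_normal"
proof -
  have e: "emeasure (half_normal \<Otimes>\<^sub>M half_normal) (A \<times> B) = emeasure half_normal A * emeasure half_normal B"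
    if "A \<in> sets borel" "B \<in> sets borel" for A B
    using that by (intro half_normal.emeasure_pair_measure_Times) auto
  have u: "emeasure half_normal UNIV = 1" using half_normal.emeasure_space_1 by simp
  show "distr complex_gaussian borel Re = half_normal"
  proof (rule measure_eqI)
    fix A :: "real set" assume "A \<in> sets (distr complex_gaussian borel Re)"
    then have [measurable]: "A \<in> sets borel" by simp
    have 1: "{x. fst x \<in> A} = A \<times> (UNIV :: real set)" by auto
    then show "emeasure (distr complex_gaussian borel Re) A = emeasure half_normal A"
      unfolding complex_gaussian_eq
      by (subst distr_distr) (auto simp: emeasure_distr split_def comp_def space_pair_measure vimage_def 1 e u)
  qed simp
  show "distr complex_gaussian borel Im = half_normal"
  proof (rule measure_eqI)
    fix A :: "real set" assume "A \<in> sets (distr complex_gaussian borel Im)"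
    then have [measurable]: "A \<in> sets borel" by simp
    have 1: "{x. snd x \<in> A} = (UNIV :: real set) \<times> A" by auto
    then show "emeasure (distr complex_gaussian borel Im) A = emeasure half_normal A"
      unfolding complex_gaussian_eq
      by (subst distr_distr) (auto simp: emeasure_distr split_def comp_def space_pair_measure vimage_def 1 e u)
  qed simp
qed

lemma complex_gaussian_Re_Im:
  fixes f :: "real \<Rightarrow> 'b::{banach, second_countable_topology}"
  assumes "f \<in> borel_measurable borel"
  shows "(\<integral>z. f (Re z) \<partial>complex_gaussian) = (\<integral>x. f x \<partial>half_normal)"
    "(\<integral>z. f (Im z) \<partial>complex_gaussian) = (\<integral>x. f x \<partial>half_normal)"
    "integrable half_normal f \<Longrightarrow> integrable complex_gaussian (\<lambda>z. f (Re z))"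
    "integrable half_normal f \<Longrightarrow> integrable complex_gaussian (\<lambda>z. f (Im z))"
  using assms distr_Re_Im_complex_gaussian
    integral_distr[of Re complex_gaussian borel f] integral_distr[of Im complex_gaussian borel f]
    integrable_distr_eq[of Re complex_gaussian borel f] integrable_distr_eq[of Im complex_gaussian borel f]
  by simp_all

lemma complex_gaussian_moments:
  "integrable complex_gaussian (\<lambda>z. z)" "(\<integral>z. z \<partial>complex_gaussian) = 0"
  "integrable complex_gaussian (\<lambda>z. (norm z)\<^sup>2)" "(\<integral>z. (norm z)\<^sup>2 \<partial>complex_gaussian) = 1"
  "integrable complex_gaussian (\<lambda>z. (norm z) ^ 4)"
proof -
  have i: "integrable complex_gaussian (\<lambda>z. Re z ^ k)" "integrable complex_gaussian (\<lambda>z. Im z ^ k)" for k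
    by (intro complex_gaussian_Re_Im half_normal_moments; simp)+
  note i1 = i[of 1, simplified]
  have "integrable complex_gaussian (\<lambda>z. complex_of_real (Re z) + \<i> * complex_of_real (Im z))"
    using i1 by (intro Bochner_Integration.integrable_add integrable_mult_right integrable_of_real)
  then show i': "integrable complex_gaussian (\<lambda>z. z)" by (simp flip: complex_eq)
  show "(\<integral>z. z \<partial>complex_gaussian) = 0"
  proof (rule complex_eqI)
    show "Re (\<integral>z. z \<partial>complex_gaussian) = Re 0" "Im (\<integral>z. z \<partial>complex_gaussian) = Im 0"
      unfolding integral_Re[OF i', symmetric] integral_Im[OF i', symmetric]
      using complex_gaussian_Re_Im(1,2)[of "\<lambda>x. x :: real"] half_normal_moments(2) by simp_all
  qed
  show "integrable complex_gaussian (\<lambda>z. (norm z)\<^sup>2)" "(\<integral>z. (norm z)\<^sup>2 \<partial>complex_gaussian) = 1"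
    using i[of 2] complex_gaussian_Re_Im(1,2)[of "\<lambda>x. x\<^sup>2"] half_normal_moments(3) by (auto simp: cmod_power2)
  show "integrable complex_gaussian (\<lambda>z. (norm z) ^ 4)"
  proof (rule Bochner_Integration.integrable_bound)
    show "integrable complex_gaussian (\<lambda>z. 2 * Re z ^ 4 + 2 * Im z ^ 4)" using i[of 4] by simp
    have "norm z ^ 4 \<le> 2 * Re z ^ 4 + 2 * Im z ^ 4" for z :: complex
    proof -
      have "norm z ^ 4 = ((Re z)\<^sup>2 + (Im z)\<^sup>2)\<^sup>2" using cmod_power2[of z] by (metis numeral_Bit0 power_even_eq power_add mult_2 power2_eq_square)
      also have "\<dots> \<le> 2 * ((Re z)\<^sup>2)\<^sup>2 + 2 * ((Im z)\<^sup>2)\<^sup>2"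
        using zero_le_power2[of "(Re z)\<^sup>2 - (Im z)\<^sup>2"] by (simp add: power2_sum power2_diff)
      finally show ?thesis by simp
    qed
    then show "AE z in complex_gaussian. norm (norm z ^ 4) \<le> norm (2 * Re z ^ 4 + 2 * Im z ^ 4)"
      by (auto intro!: AE_I2)
  qed simp
qed

lemma complex_gaussian_ball_pos:
  assumes "0 < e"
  shows "emeasure complex_gaussian (ball c e) > 0"
proof -
  let ?I = "{Re c - e/2<..<Re c + e/2}" and ?J = "{Im c - e/2<..<Im c + e/2}"
  have "0 < emeasure half_normal ?I * emeasure half_normal ?J"
    using assms by (simp add: ennreal_zero_less_mult_iff half_normal_interval_pos)
  also have "\<dots> = emeasure (half_normal \<Otimes>\<^sub>M half_normal) (?I \<times> ?J)"
    by (intro half_normal.emeasure_pair_measure_Times[symmetric]) auto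
  also have "\<dots> \<le> emeasure (half_normal \<Otimes>\<^sub>M half_normal) ((\<lambda>(x, y). Complex x y) -` ball c e \<inter> space (half_normal \<Otimes>\<^sub>M half_normal))"
  proof (rule emeasure_mono)
    show "?I \<times> ?J \<subseteq> (\<lambda>(x, y). Complex x y) -` ball c e \<inter> space (half_normal \<Otimes>\<^sub>M half_normal)"
    proof (clarsimp simp: space_pair_measure)
      fix x y assume a: "Re c - e / 2 < x" "x < Re c + e / 2" "Im c - e / 2 < y" "y < Im c + e / 2"
      have "dist c (Complex x y) \<le> \<bar>Re (c - Complex x y)\<bar> + \<bar>Im (c - Complex x y)\<bar>"
        unfolding dist_norm by (rule cmod_le)
      also have "\<dots> < e" using a by (simp add: abs_if) 
      finally show "dist c (Complex x y) < e" .
    qed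
    show "(\<lambda>(x, y). Complex x y) -` ball c e \<inter> space (half_normal \<Otimes>\<^sub>M half_normal) \<in> sets (half_normal \<Otimes>\<^sub>M half_normal)"
      by (rule measurable_sets[of _ _ borel]) (auto simp: split_def)
  qed
  also have "\<dots> = emeasure complex_gaussian (ball c e)"
    unfolding complex_gaussian_eq by (subst emeasure_distr) (auto simp: split_def)
  finally show ?thesis .
qed

text \<open>The series of the \<open>f k\<close> has finite integral, hence is finite almost
  everywhere, and its terms tend to 0.\<close>

lemma AE_tendsto_0_of_summable_integrals:
  fixes f :: "nat \<Rightarrow> 'a \<Rightarrow> real"
  assumes int: "\<And>k. integrable M (f k)" and nn: "\<And>k x. 0 \<le> f k x" and le: "\<And>k. (\<integral>x. f k x \<partial>M) \<le> c k" and c: "summable c"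
  shows "AE x in M. (\<lambda>k. f k x) \<longlonglongrightarrow> 0"
proof -
  have [measurable]: "f k \<in> borel_measurable M" for k using int[of k] by auto
  have c0: "0 \<le> c k" for k using le[of k] nn by (meson Bochner_Integration.integral_nonneg order_trans)
  have "(\<integral>\<^sup>+x. (\<Sum>k. ennreal (f k x)) \<partial>M) = (\<Sum>k. \<integral>\<^sup>+x. ennreal (f k x) \<partial>M)"
    by (rule nn_integral_suminf) measurable
  also have "\<dots> \<le> (\<Sum>k. ennreal (c k))"
    by (intro suminf_le) (auto simp: nn_integral_eq_integral int nn le intro!: ennreal_leI)
  also have "\<dots> = ennreal (suminf c)" by (rule suminf_ennreal2[OF c0 c])
  finally have "(\<integral>\<^sup>+x. (\<Sum>k. ennreal (f k x)) \<partial>M) \<noteq> \<infinity>" by (auto simp: top_unique)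
  then have "AE x in M. (\<Sum>k. ennreal (f k x)) \<noteq> \<infinity>" by (intro nn_integral_PInf_AE) measurable
  then show ?thesis
    by eventually_elim (auto intro!: summable_LIMSEQ_zero summable_suminf_not_top nn)
qed

section \<open>Independent families of complex Gaussian variables\<close>

definition gauss_entries :: "('i \<Rightarrow> complex) measure" where
  "gauss_entries = Pi\<^sub>M UNIV (\<lambda>_. complex_gaussian)"

lemma sets_gauss_entries [measurable_cong]: "sets gauss_entries = sets (Pi\<^sub>M UNIV (\<lambda>_. borel))"
  unfolding gauss_entries_def by (rule sets_PiM_cong) auto

lemma space_gauss_entries [simp]: "space gauss_entries = UNIV"
  by (simp add: gauss_entries_def space_PiM)

lemma prob_space_gauss_entries: "prob_space gauss_entries"
  unfolding gauss_entries_def by (rule prob_space_PiM) (rule prob_space_complex_gaussian)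

interpretation gauss_entries: prob_space gauss_entries by (rule prob_space_gauss_entries)

lemma gauss_entries_coord_measurable [measurable]: "(\<lambda>w. w p) \<in> borel_measurable gauss_entries"
  by (subst measurable_cong_sets[OF sets_gauss_entries refl]) measurable

lemma gauss_entries_component: "distr gauss_entries borel (\<lambda>w. w p) = complex_gaussian"
proof -
  interpret product_prob_space "\<lambda>_. complex_gaussian" UNIV ..
  have "distr gauss_entries complex_gaussian (\<lambda>w. w p) = complex_gaussian"
    unfolding gauss_entries_def by (rule PiM_component) simp
  then show ?thesis by (simp cong: distr_cong)
qed

lemma gauss_entries_integral_component:
  fixes f :: "complex \<Rightarrow> 'b::{banach, second_countable_topology}"
  assumes "f \<in> borel_measurable borel"
  shows "(\<integral>w. f (w p) \<partial>gauss_entries) = (\<integral>z. f z \<partial>complex_gaussian)"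
    and "integrable complex_gaussian f \<Longrightarrow> integrable gauss_entries (\<lambda>w. f (w p))"
  using assms gauss_entries_component[of p] integral_distr[of "\<lambda>w. w p" gauss_entries borel f]
    integrable_distr_eq[of "\<lambda>w. w p" gauss_entries borel f] by simp_all

lemma gauss_entries_indep: "gauss_entries.indep_vars (\<lambda>_. borel) (\<lambda>p w. w p) (UNIV :: 'i set)"
proof (subst gauss_entries.indep_vars_iff_distr_eq_PiM)
  have "distr gauss_entries (Pi\<^sub>M UNIV (\<lambda>_. borel)) (\<lambda>w. \<lambda>p\<in>UNIV. w p) = (gauss_entries :: ('i \<Rightarrow> complex) measure)"
    by (simp add: restrict_def distr_id2 sets_gauss_entries)
  moreover have "Pi\<^sub>M UNIV (\<lambda>p. distr gauss_entries borel (\<lambda>w. w p)) = (gauss_entries :: ('i \<Rightarrow> complex) measure)"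
    by (simp add: gauss_entries_component) (simp add: gauss_entries_def)
  ultimately show "distr gauss_entries (Pi\<^sub>M UNIV (\<lambda>_. borel)) (\<lambda>w. \<lambda>p\<in>UNIV. w p) =
    (Pi\<^sub>M UNIV (\<lambda>p. distr gauss_entries borel (\<lambda>w. w p)) :: ('i \<Rightarrow> complex) measure)" by simp
qed auto

lemma gauss_entries_integral_prod:
  fixes f :: "'i \<Rightarrow> complex \<Rightarrow> 'b::{real_normed_field, banach, second_countable_topology}"
  assumes "finite K" and m: "\<And>p. f p \<in> borel_measurable borel" and i: "\<And>p. p \<in> K \<Longrightarrow> integrable complex_gaussian (f p)"
  shows "(\<integral>w. (\<Prod>p\<in>K. f p (w p)) \<partial>gauss_entries) = (\<Prod>p\<in>K. \<integral>z. f p z \<partial>complex_gaussian)"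
proof -
  have "gauss_entries.indep_vars (\<lambda>_. borel) (\<lambda>p w. f p (w p)) K"
    by (rule gauss_entries.indep_vars_compose2[OF gauss_entries.indep_vars_subset[OF gauss_entries_indep subset_UNIV]]) (use m in auto)
  then have "(\<integral>w. (\<Prod>p\<in>K. f p (w p)) \<partial>gauss_entries) = (\<Prod>p\<in>K. \<integral>w. f p (w p) \<partial>gauss_entries)"
    by (intro gauss_entries.indep_vars_lebesgue_integral assms gauss_entries_integral_component(2)[OF m])
  then show ?thesis by (simp add: gauss_entries_integral_component(1)[OF m])
qed

lemma gauss_entries_char:
  assumes "finite K"
  shows "(\<integral>w. iexp (\<Sum>p\<in>K. w p \<bullet> c p) \<partial>gauss_entries) = complex_of_real (exp (- (\<Sum>p\<in>K. (norm (c p))\<^sup>2) / 4))"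
proof -
  have "(\<integral>w. iexp (\<Sum>p\<in>K. w p \<bullet> c p) \<partial>gauss_entries) = (\<integral>w. (\<Prod>p\<in>K. iexp (w p \<bullet> c p)) \<partial>gauss_entries)"
    using assms by (simp add: exp_sum sum_distrib_left)
  also have "\<dots> = (\<Prod>p\<in>K. \<integral>z. iexp (z \<bullet> c p) \<partial>complex_gaussian)"
  proof (rule gauss_entries_integral_prod[OF assms])
    show m: "(\<lambda>z. iexp (z \<bullet> c p)) \<in> borel_measurable borel" for p
      by (intro borel_measurable_continuous_onI continuous_intros)
    show "integrable complex_gaussian (\<lambda>z. iexp (z \<bullet> c p))" for p
      using m by (intro complex_gaussian.integrable_const_bound[where B=1])
        (auto simp: measurable_cong_sets[OF sets_complex_gaussian refl])
  qed
  also have "\<dots> = complex_of_real (\<Prod>p\<in>K. exp (- (norm (c p))\<^sup>2 / 4))"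
    by (simp only: complex_gaussian_char of_real_prod)
  also have "(\<Prod>p\<in>K. exp (- (norm (c p))\<^sup>2 / 4)) = exp (- (\<Sum>p\<in>K. (norm (c p))\<^sup>2) / 4)"
    using assms by (simp add: exp_sum[symmetric] sum_negf sum_divide_distrib)
  finally show ?thesis .
qed

section \<open>Law of large numbers for products of Gaussian entries\<close>

definition corr :: "'i \<Rightarrow> 'i \<Rightarrow> ('i \<Rightarrow> complex) \<Rightarrow> complex" where
  "corr p q w = cnj (w p) * w q - (if p = q then 1 else 0)"

lemma corr_measurable [measurable]: "corr p q \<in> borel_measurable gauss_entries"
  unfolding corr_def by measurable

lemma corr_integrable:
  fixes p q :: 'i
  shows "integrable gauss_entries (corr p q)" "(\<integral>w. corr p q w \<partial>gauss_entries) = 0"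
proof -
  have "integrable gauss_entries (corr p q) \<and> (\<integral>w. corr p q w \<partial>gauss_entries) = 0"
  proof (cases "p = q")
    case True
    have c: "corr p q w = complex_of_real ((norm (w p))\<^sup>2 - 1)" for w
      using complex_norm_square[of "w p"] True by (simp add: corr_def mult.commute)
    have i: "integrable gauss_entries (\<lambda>w. (norm (w p))\<^sup>2)"
      by (rule gauss_entries_integral_component(2)[OF _ complex_gaussian_moments(3)]) simp
    have "(\<integral>w. (norm (w p))\<^sup>2 \<partial>gauss_entries) = 1"
      using gauss_entries_integral_component(1)[of "\<lambda>z. (norm z)\<^sup>2" p] complex_gaussian_moments(4) by simp
    then have "(\<integral>w. (norm (w p))\<^sup>2 - 1 \<partial>gauss_entries) = 0"
      using i gauss_entries.prob_space by simp
    moreover have "integrable gauss_entries (\<lambda>w. (norm (w p))\<^sup>2 - 1)" using i by simp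
    ultimately show ?thesis unfolding c integral_complex_of_real by (auto simp del: of_real_diff of_real_power)
  next
    case False
    have "{p} \<inter> {q} = {}" using False by simp
    from gauss_entries.indep_var_restrict[OF gauss_entries_indep this subset_UNIV subset_UNIV]
    have "gauss_entries.indep_var (Pi\<^sub>M {p} (\<lambda>_. borel)) (\<lambda>w. restrict w {p})
      (Pi\<^sub>M {q} (\<lambda>_. borel)) (\<lambda>w. restrict w {q})" by (simp add: restrict_def)
    from gauss_entries.indep_var_compose[OF this, of "\<lambda>f. cnj (f p)" borel "\<lambda>f. f q" borel]
    have ind: "gauss_entries.indep_var borel (\<lambda>w. cnj (w p)) borel (\<lambda>w. w q)" by (simp add: comp_def)
    have "integrable gauss_entries (\<lambda>w. w r)" for r :: 'i
      by (rule gauss_entries_integral_component(2)[OF _ complex_gaussian_moments(1)]) simp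
    then have i: "integrable gauss_entries (\<lambda>w. cnj (w p))" "integrable gauss_entries (\<lambda>w. w q)"
      by (auto intro: integrable_cnj)
    have "(\<integral>w. w q \<partial>gauss_entries) = 0"
      using gauss_entries_integral_component(1)[of "\<lambda>z. z" q] complex_gaussian_moments(2) by simp
    then show ?thesis using gauss_entries.indep_var_lebesgue_integral[OF ind i] gauss_entries.indep_var_integrable[OF ind i] False
      by (simp add: corr_def[abs_def])
  qed
  then show "integrable gauss_entries (corr p q)" "(\<integral>w. corr p q w \<partial>gauss_entries) = 0" by auto
qed

text \<open>A second moment bound common to all \<open>corr p q\<close>, from the pointwise estimate
  by \<open>|w p|^4 + |w q|^4 + 2\<close>. Only its finiteness and sign matter.\<close>

definition corr_bound :: real where
  "corr_bound = 2 * (\<integral>z. (norm z) ^ 4 \<partial>complex_gaussian) + 2"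

lemma corr_square_integrable:
  fixes p q :: 'i
  shows
  "integrable gauss_entries (\<lambda>w. (norm (corr p q w))\<^sup>2)"
  "(\<integral>w. (norm (corr p q w))\<^sup>2 \<partial>gauss_entries) \<le> corr_bound"
proof -
  have i4: "integrable gauss_entries (\<lambda>w. (norm (w r)) ^ 4)" for r :: 'i
    by (rule gauss_entries_integral_component(2)[OF _ complex_gaussian_moments(5)]) simp
  have e4: "(\<integral>w. (norm (w r)) ^ 4 \<partial>gauss_entries) = (\<integral>z. (norm z) ^ 4 \<partial>complex_gaussian)" for r :: 'i
    using gauss_entries_integral_component(1)[of "\<lambda>z. (norm z) ^ 4" r] by simp
  have le: "(norm (corr p q w))\<^sup>2 \<le> norm (w p) ^ 4 + norm (w q) ^ 4 + 2" for w
  proof -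
    have "norm (corr p q w) \<le> norm (w p) * norm (w q) + 1"
      unfolding corr_def by (rule order_trans[OF norm_triangle_ineq4]) (simp add: norm_mult)
    then have "(norm (corr p q w))\<^sup>2 \<le> (norm (w p) * norm (w q) + 1)\<^sup>2" by (intro power_mono) auto
    also have "\<dots> \<le> 2 * (norm (w p) * norm (w q))\<^sup>2 + 2"
      using zero_le_power2[of "norm (w p) * norm (w q) - 1"] by (simp add: power2_sum power2_diff)
    also have "2 * (norm (w p) * norm (w q))\<^sup>2 \<le> ((norm (w p))\<^sup>2)\<^sup>2 + ((norm (w q))\<^sup>2)\<^sup>2"
      using zero_le_power2[of "(norm (w p))\<^sup>2 - (norm (w q))\<^sup>2"] by (simp add: power2_diff power_mult_distrib)
    finally show ?thesis by simp
  qed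
  have i: "integrable gauss_entries (\<lambda>w. norm (w p) ^ 4 + norm (w q) ^ 4 + 2)" using i4 by simp
  show 1: "integrable gauss_entries (\<lambda>w. (norm (corr p q w))\<^sup>2)"
    by (rule Bochner_Integration.integrable_bound[OF i]) (auto intro!: AE_I2 order_trans[OF le])
  have "(\<integral>w. (norm (corr p q w))\<^sup>2 \<partial>gauss_entries) \<le> (\<integral>w. norm (w p) ^ 4 + norm (w q) ^ 4 + 2 \<partial>gauss_entries)"
    by (rule integral_mono[OF 1 i le])
  also have "\<dots> = corr_bound" using i4 gauss_entries.prob_space by (simp add: e4 corr_bound_def)
  finally show "(\<integral>w. (norm (corr p q w))\<^sup>2 \<partial>gauss_entries) \<le> corr_bound" .
qed

text \<open>Disjoint index pairs make the factors independent, and \<open>corr p q\<close> has mean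
  0.\<close>

lemma corr_orthogonal:
  assumes "{p, q} \<inter> {p', q'} = {}"
  shows "integrable gauss_entries (\<lambda>w. corr p q w * cnj (corr p' q' w))"
    "(\<integral>w. corr p q w * cnj (corr p' q' w) \<partial>gauss_entries) = 0"
proof -
  from gauss_entries.indep_var_restrict[OF gauss_entries_indep assms subset_UNIV subset_UNIV]
  have "gauss_entries.indep_var (Pi\<^sub>M {p, q} (\<lambda>_. borel)) (\<lambda>w. restrict w {p, q})
      (Pi\<^sub>M {p', q'} (\<lambda>_. borel)) (\<lambda>w. restrict w {p', q'})" by (simp add: restrict_def)
  from gauss_entries.indep_var_compose[OF this,
      of "\<lambda>f. cnj (f p) * f q - (if p = q then 1 else 0)" borel "\<lambda>f. cnj (cnj (f p') * f q' - (if p' = q' then 1 else 0))" borel]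
  have ind: "gauss_entries.indep_var borel (corr p q) borel (\<lambda>w. cnj (corr p' q' w))"
    by (simp add: comp_def corr_def[abs_def])
  note i = corr_integrable(1)[of p q] integrable_cnj[OF corr_integrable(1)[of p' q']]
  show "integrable gauss_entries (\<lambda>w. corr p q w * cnj (corr p' q' w))"
    "(\<integral>w. corr p q w * cnj (corr p' q' w) \<partial>gauss_entries) = 0"
    using gauss_entries.indep_var_lebesgue_integral[OF ind i] gauss_entries.indep_var_integrable[OF ind i]
      corr_integrable(2)[of p q] by simp_all
qed

text \<open>In the expanded square the off-diagonal terms vanish by orthogonality, so the second
  moment grows only linearly in \<open>n\<close>.\<close>

lemma corr_sum_square:
  assumes disj: "\<And>i k :: nat. i \<noteq> k \<Longrightarrow> {p i, q i} \<inter> {p k, q k} = {}"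
  shows "integrable gauss_entries (\<lambda>w. (norm (\<Sum>i<n. corr (p i) (q i) w))\<^sup>2)"
    "(\<integral>w. (norm (\<Sum>i<n. corr (p i) (q i) w))\<^sup>2 \<partial>gauss_entries) \<le> n * corr_bound"
proof -
  let ?c = "\<lambda>i. corr (p i) (q i)"
  have sq: "complex_of_real ((norm (\<Sum>i<n. ?c i w))\<^sup>2) = (\<Sum>i<n. \<Sum>k<n. ?c i w * cnj (?c k w))" for w
    by (simp only: complex_norm_square cnj_sum sum_product)
  have diag: "?c i w * cnj (?c i w) = complex_of_real ((norm (?c i w))\<^sup>2)" for i w
    by (simp only: complex_norm_square)
  have int: "integrable gauss_entries (\<lambda>w. ?c i w * cnj (?c k w))" for i k
  proof (cases "i = k")
    case True
    then show ?thesis unfolding True diag by (intro integrable_of_real corr_square_integrable)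
  next
    case False
    then show ?thesis using corr_orthogonal(1)[OF disj] by blast
  qed
  have "integrable gauss_entries (\<lambda>w. complex_of_real ((norm (\<Sum>i<n. ?c i w))\<^sup>2))"
    unfolding sq by (intro Bochner_Integration.integrable_sum int)
  then show "integrable gauss_entries (\<lambda>w. (norm (\<Sum>i<n. ?c i w))\<^sup>2)"
    by (drule_tac integrable_Re) (simp only: Re_complex_of_real)
  have "complex_of_real (\<integral>w. (norm (\<Sum>i<n. ?c i w))\<^sup>2 \<partial>gauss_entries) = (\<Sum>i<n. \<Sum>k<n. \<integral>w. ?c i w * cnj (?c k w) \<partial>gauss_entries)"
    unfolding integral_complex_of_real[symmetric] sq by (simp add: int)
  also have "\<dots> = (\<Sum>i<n. \<Sum>k<n. if k = i then \<integral>w. ?c i w * cnj (?c i w) \<partial>gauss_entries else 0)"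
    using corr_orthogonal(2)[OF disj] by (intro sum.cong refl) auto
  also have "\<dots> = (\<Sum>i<n. \<integral>w. ?c i w * cnj (?c i w) \<partial>gauss_entries)" by simp
  also have "\<dots> = complex_of_real (\<Sum>i<n. \<integral>w. (norm (?c i w))\<^sup>2 \<partial>gauss_entries)"
    unfolding diag integral_complex_of_real by simp
  finally have "(\<integral>w. (norm (\<Sum>i<n. ?c i w))\<^sup>2 \<partial>gauss_entries) = (\<Sum>i<n. \<integral>w. (norm (?c i w))\<^sup>2 \<partial>gauss_entries)"
    by (simp only: of_real_eq_iff)
  also have "\<dots> \<le> (\<Sum>i<n. corr_bound)" by (intro sum_mono corr_square_integrable)
  finally show "(\<integral>w. (norm (\<Sum>i<n. ?c i w))\<^sup>2 \<partial>gauss_entries) \<le> n * corr_bound" by simp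
qed

text \<open>The second moment of the \<open>j\<close>-th average is at most a constant times
  \<open>(1/2)^j\<close>, hence summable. Heights of at least \<open>2^j\<close> make this condition
  on \<open>\<rho>\<close> available.\<close>

proposition corr_average_tendsto_0:
  assumes disj: "\<And>i k :: nat. i \<noteq> k \<Longrightarrow> {p i, q i} \<inter> {p k, q k} = {}"
    and \<rho>: "\<And>j. (\<rho> j)\<^sup>2 * real (n j) \<le> (1 / 2) ^ j"
  shows "AE w in gauss_entries. (\<lambda>j. \<rho> j *\<^sub>R (\<Sum>i<n j. corr (p i) (q i) w)) \<longlonglongrightarrow> 0"
proof -
  have cb: "0 \<le> corr_bound" by (simp add: corr_bound_def)
  have "AE w in gauss_entries. (\<lambda>j. (norm (\<rho> j *\<^sub>R (\<Sum>i<n j. corr (p i) (q i) w)))\<^sup>2) \<longlonglongrightarrow> 0"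
  proof (rule AE_tendsto_0_of_summable_integrals)
    show "summable (\<lambda>j. corr_bound * (1 / 2 :: real) ^ j)" by (intro summable_mult summable_geometric) simp
    fix j
    have e: "(norm (\<rho> j *\<^sub>R x))\<^sup>2 = (\<rho> j)\<^sup>2 * (norm x)\<^sup>2" for x :: complex by (simp add: power_mult_distrib)
    show "integrable gauss_entries (\<lambda>w. (norm (\<rho> j *\<^sub>R (\<Sum>i<n j. corr (p i) (q i) w)))\<^sup>2)"
      unfolding e by (intro integrable_mult_right corr_sum_square(1) disj)
    have "(\<integral>w. (norm (\<rho> j *\<^sub>R (\<Sum>i<n j. corr (p i) (q i) w)))\<^sup>2 \<partial>gauss_entries) \<le> (\<rho> j)\<^sup>2 * (n j * corr_bound)"
      unfolding e integral_mult_right_zero by (intro mult_left_mono corr_sum_square(2) disj) auto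
    also have "\<dots> = corr_bound * ((\<rho> j)\<^sup>2 * n j)" by simp
    also have "\<dots> \<le> corr_bound * (1 / 2) ^ j" by (intro mult_left_mono \<rho> cb)
    finally show "(\<integral>w. (norm (\<rho> j *\<^sub>R (\<Sum>i<n j. corr (p i) (q i) w)))\<^sup>2 \<partial>gauss_entries) \<le> corr_bound * (1 / 2) ^ j" .
  qed auto
  then show ?thesis
  proof eventually_elim
    case (elim w)
    then have "(\<lambda>j. sqrt ((norm (\<rho> j *\<^sub>R (\<Sum>i<n j. corr (p i) (q i) w)))\<^sup>2)) \<longlonglongrightarrow> sqrt 0"
      by (rule tendsto_real_sqrt)
    then have "(\<lambda>j. norm (\<rho> j *\<^sub>R (\<Sum>i<n j. corr (p i) (q i) w))) \<longlonglongrightarrow> 0"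
      by (simp only: real_sqrt_abs abs_norm_cancel real_sqrt_zero)
    then show ?case by (rule tendsto_norm_zero_cancel)
  qed
qed

section \<open>Averaged Gram matrices along an invariant measure\<close>

lemma inner_eq_Re_sum: "x \<bullet> y = Re (\<Sum>j\<in>UNIV. cnj (x $ j) * (y :: complex ^ 'm::finite) $ j)"
  by (simp add: inner_complex_vec)

lemma inner_vector_matrix_mult:
  "(x v* A) \<bullet> y = x \<bullet> ((y :: complex ^ 'm::finite) v* conj_transpose A)"
proof -
  have "(\<Sum>j\<in>UNIV. cnj ((x v* A) $ j) * y $ j) = (\<Sum>j\<in>UNIV. \<Sum>i\<in>UNIV. cnj (x $ i) * (y $ j * cnj (A $ i $ j)))"
    by (simp add: vector_matrix_mult_nth sum_distrib_right) (simp add: mult_ac)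
  also have "\<dots> = (\<Sum>i\<in>UNIV. \<Sum>j\<in>UNIV. cnj (x $ i) * (y $ j * cnj (A $ i $ j)))" by (rule sum.swap)
  also have "\<dots> = (\<Sum>i\<in>UNIV. cnj (x $ i) * (y v* conj_transpose A) $ i)"
    by (simp add: vector_matrix_mult_nth sum_distrib_left)
  finally show ?thesis by (simp add: inner_eq_Re_sum)
qed

definition avg_gram :: "nat \<Rightarrow> 'm::finite inf_mat \<Rightarrow> complex ^ 'm ^ 'm" where
  "avg_gram n X = (1 / real n) *\<^sub>R cgram n X X"

lemma psd_avg_gram: "psd (avg_gram n X)"
  unfolding avg_gram_def by (rule psd_cgram) simp

lemma herm_form_avg_gram: "herm_form C (avg_gram n X) = (\<Sum>i<n. (norm (X i v* C))\<^sup>2) / n"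
  by (simp add: avg_gram_def herm_form_cgram)

lemma borel_measurable_matrix_mult [measurable (raw)]:
  fixes f :: "'a \<Rightarrow> complex ^ 'n::finite ^ 'm::finite" and g :: "'a \<Rightarrow> complex ^ 'k::finite ^ 'n"
  assumes [measurable]: "f \<in> borel_measurable M" "g \<in> borel_measurable M"
  shows "(\<lambda>x. f x ** g x) \<in> borel_measurable M"
  unfolding matrix_matrix_mult_def by measurable

lemma borel_measurable_trace [measurable (raw)]:
  fixes f :: "'a \<Rightarrow> complex ^ 'm::finite ^ 'm"
  assumes [measurable]: "f \<in> borel_measurable M"
  shows "(\<lambda>x. trace (f x)) \<in> borel_measurable M"
  unfolding trace_def by measurable

lemma borel_measurable_det [measurable (raw)]:
  fixes f :: "'a \<Rightarrow> complex ^ 'm::finite ^ 'm"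
  assumes [measurable]: "f \<in> borel_measurable M"
  shows "(\<lambda>x. det (f x)) \<in> borel_measurable M"
  unfolding det_def by measurable

lemma borel_measurable_conj_transpose [measurable (raw)]:
  fixes f :: "'a \<Rightarrow> complex ^ 'm::finite ^ 'm"
  assumes [measurable]: "f \<in> borel_measurable M"
  shows "(\<lambda>x. conj_transpose (f x)) \<in> borel_measurable M"
  unfolding conj_transpose_def by measurable

lemma borel_measurable_herm_form [measurable (raw)]:
  assumes [measurable]: "f \<in> borel_measurable M"
  shows "(\<lambda>x. herm_form C (f x)) \<in> borel_measurable M"
  unfolding herm_form_def by measurable

lemma avg_gram_measurable [measurable]: "avg_gram n \<in> borel_measurable borel"
  unfolding avg_gram_def [abs_def] cgram_def by measurable

text \<open>A combination \<open>a G + b G'\<close> of two independent Gaussian matrices with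
  row-dependent coefficients; the Boolean index tells \<open>G\<close> from
  \<open>G'\<close>.\<close>

definition two_rows :: "(nat \<Rightarrow> real) \<Rightarrow> (nat \<Rightarrow> real) \<Rightarrow> (bool \<times> nat \<times> 'm \<Rightarrow> complex) \<Rightarrow> 'm::finite inf_mat" where
  "two_rows a b w = (\<lambda>i. a i *\<^sub>R (\<chi> j. w (False, i, j)) + b i *\<^sub>R (\<chi> j. w (True, i, j)))"

text \<open>For positive \<open>n\<close>, coefficients with square sum \<open>c^2\<close>, spread
  evenly over the first \<open>n\<close> rows.\<close>

definition flat :: "real \<Rightarrow> nat \<Rightarrow> nat \<Rightarrow> real" where
  "flat c n i = (if i < n then c / sqrt n else 0)"

lemma sum_flat_square:
  assumes "n \<le> N"
  shows "(\<Sum>i<N. (flat c n i)\<^sup>2 * f i) = c\<^sup>2 * (\<Sum>i<n. f i) / n"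
proof -
  have "(\<Sum>i<N. (flat c n i)\<^sup>2 * f i) = (\<Sum>i<n. (flat c n i)\<^sup>2 * f i)"
    using assms by (intro sum.mono_neutral_right) (auto simp: flat_def)
  also have "\<dots> = (\<Sum>i<n. c\<^sup>2 / n * f i)" by (intro sum.cong) (auto simp: flat_def power_divide)
  finally show ?thesis by (simp add: sum_distrib_left sum_divide_distrib)
qed

lemma gauss_entries_rows_char:
  fixes U :: "nat \<Rightarrow> complex ^ 'm::finite"
  shows "(\<integral>w. iexp (\<Sum>i<N. two_rows a b w i \<bullet> U i) \<partial>gauss_entries) =
    complex_of_real (exp (- (\<Sum>i<N. ((a i)\<^sup>2 + (b i)\<^sup>2) * (norm (U i))\<^sup>2) / 4))"
proof -
  define c where "c = (\<lambda>(e, i, j). (if e then b i else a i) *\<^sub>R U i $ j)"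
  have s: "(\<Sum>p\<in>UNIV \<times> {..<N} \<times> UNIV. f p) = (\<Sum>i<N. (\<Sum>j\<in>UNIV. f (False, i, j)) + (\<Sum>j\<in>UNIV. f (True, i, j)))"
    for f :: "bool \<times> nat \<times> 'm \<Rightarrow> real"
  proof -
    have "(\<Sum>p\<in>UNIV \<times> {..<N} \<times> UNIV. f p) = (\<Sum>e\<in>UNIV. \<Sum>i<N. \<Sum>j\<in>UNIV. f (e, i, j))"
      by (simp add: sum.cartesian_product split_def)
    then show ?thesis by (simp add: UNIV_bool sum.distrib add.commute)
  qed
  have "(\<Sum>i<N. two_rows a b w i \<bullet> U i) = (\<Sum>p\<in>UNIV \<times> {..<N} \<times> UNIV. w p \<bullet> c p)" for w
    unfolding s by (simp add: two_rows_def c_def inner_add_left inner_vec_def sum_distrib_left sum.distrib)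
  then have "(\<integral>w. iexp (\<Sum>i<N. two_rows a b w i \<bullet> U i) \<partial>gauss_entries) =
      complex_of_real (exp (- (\<Sum>p\<in>UNIV \<times> {..<N} \<times> UNIV. (norm (c p))\<^sup>2) / 4))"
    using gauss_entries_char[of "UNIV \<times> {..<N} \<times> UNIV" c] by simp
  also have "(\<Sum>p\<in>UNIV \<times> {..<N} \<times> UNIV. (norm (c p))\<^sup>2) = (\<Sum>i<N. ((a i)\<^sup>2 + (b i)\<^sup>2) * (norm (U i))\<^sup>2)"
  proof -
    have "(norm (U i))\<^sup>2 = (\<Sum>j\<in>UNIV. (norm (U i $ j))\<^sup>2)" for i
      by (simp add: power2_norm_eq_inner inner_vec_def)
    then show ?thesis unfolding s by (simp add: c_def power_mult_distrib sum_distrib_left distrib_right sum.distrib)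
  qed
  finally show ?thesis .
qed

text \<open>Fubini: for fixed \<open>X\<close> the Gaussian integral of the oscillating exponential
  is the exponential of minus a quarter of the forms of the averaged Gram matrices, while
  integrating over \<open>X\<close> first gives \<open>cf\<close>.\<close>

lemma gauss_average_cf:
  fixes M :: "'m::finite inf_mat measure"
  assumes M: "prob_space M" and s[measurable_cong]: "sets M = sets borel"
  defines "T \<equiv> \<lambda>A c n d k w. mat_mult_right (two_rows (flat c n) (flat d k) w) A"
  shows "(\<lambda>w. cf (max n k) (T A c n d k w) M) \<in> borel_measurable gauss_entries"
    and "(\<integral>w. cf (max n k) (T A c n d k w) M \<partial>gauss_entries) =
      (\<integral>X. complex_of_real (exp (- (c\<^sup>2 * herm_form (conj_transpose A) (avg_gram n X) +
         d\<^sup>2 * herm_form (conj_transpose A) (avg_gram k X)) / 4)) \<partial>M)"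
proof -
  interpret M: prob_space M by fact
  interpret P: pair_prob_space gauss_entries M ..
  let ?N = "max n k"
  let ?f = "\<lambda>w X. iexp (\<Sum>i<?N. T A c n d k w i \<bullet> X i)"
  have [measurable]: "(\<lambda>p. snd p i) \<in> borel_measurable (gauss_entries \<Otimes>\<^sub>M M)" for i
    by (rule measurable_compose[OF measurable_snd]) (simp add: measurable_cong_sets[OF s refl])
  have [measurable]: "(\<lambda>p. fst p q) \<in> borel_measurable (gauss_entries \<Otimes>\<^sub>M M)" for q
    by (rule measurable_compose[OF measurable_fst gauss_entries_coord_measurable])
  have [measurable]: "(\<lambda>p. T A c n d k (fst p) i) \<in> borel_measurable (gauss_entries \<Otimes>\<^sub>M M)" for i
    unfolding T_def mat_mult_right_def vector_matrix_mult_def two_rows_def by measurable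
  have [measurable]: "(\<lambda>p. T A c n d k (fst p) i \<bullet> snd p i) \<in> borel_measurable (gauss_entries \<Otimes>\<^sub>M M)" for i
    by (rule borel_measurable_inner) measurable
  have m: "(\<lambda>p. ?f (fst p) (snd p)) \<in> borel_measurable (gauss_entries \<Otimes>\<^sub>M M)"
    by measurable
  show "(\<lambda>w. cf ?N (T A c n d k w) M) \<in> borel_measurable gauss_entries"
    unfolding cf_def using m by (intro M.borel_measurable_lebesgue_integral) (simp add: split_def)
  have int: "integrable (gauss_entries \<Otimes>\<^sub>M M) (case_prod ?f)"
    using m by (intro P.integrable_const_bound[where B=1]) (auto simp: split_def)
  have inner: "(\<integral>w. ?f w X \<partial>gauss_entries) = complex_of_real (exp (- (c\<^sup>2 * herm_form (conj_transpose A) (avg_gram n X) +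
         d\<^sup>2 * herm_form (conj_transpose A) (avg_gram k X)) / 4))" for X
  proof -
    have "(\<integral>w. ?f w X \<partial>gauss_entries) = (\<integral>w. iexp (\<Sum>i<?N. two_rows (flat c n) (flat d k) w i \<bullet> (X i v* conj_transpose A)) \<partial>gauss_entries)"
      by (simp only: T_def mat_mult_right_def inner_vector_matrix_mult)
    also have "\<dots> = complex_of_real (exp (- (\<Sum>i<?N. ((flat c n i)\<^sup>2 + (flat d k i)\<^sup>2) * (norm (X i v* conj_transpose A))\<^sup>2) / 4))"
      by (rule gauss_entries_rows_char)
    also have "(\<Sum>i<?N. ((flat c n i)\<^sup>2 + (flat d k i)\<^sup>2) * (norm (X i v* conj_transpose A))\<^sup>2) =
      c\<^sup>2 * herm_form (conj_transpose A) (avg_gram n X) + d\<^sup>2 * herm_form (conj_transpose A) (avg_gram k X)"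
      by (simp add: distrib_right sum.distrib sum_flat_square herm_form_avg_gram)
    finally show ?thesis .
  qed
  have "(\<integral>w. cf ?N (T A c n d k w) M \<partial>gauss_entries) = (\<integral>X. (\<integral>w. ?f w X \<partial>gauss_entries) \<partial>M)"
    unfolding cf_def by (rule P.Fubini_integral[OF int, symmetric])
  then show "(\<integral>w. cf ?N (T A c n d k w) M \<partial>gauss_entries) =
      (\<integral>X. complex_of_real (exp (- (c\<^sup>2 * herm_form (conj_transpose A) (avg_gram n X) +
         d\<^sup>2 * herm_form (conj_transpose A) (avg_gram k X)) / 4)) \<partial>M)"
    unfolding inner .
qed

lemma sum_eq_corr: "(\<Sum>i<n. cnj (w (p i)) * w (q i)) = (\<Sum>i<n. corr (p i) (q i) w) + (\<Sum>i<n. if p i = q i then 1 else 0)"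
  by (simp add: corr_def sum_subtractf)

lemma two_rows_nth: "two_rows a b w i $ j = a i *\<^sub>R w (False, i, j) + b i *\<^sub>R w (True, i, j)"
  by (simp add: two_rows_def)

lemma matrix_mult_scaleR:
  fixes A :: "complex ^ 'n::finite ^ 'm::finite" and B :: "complex ^ 'k::finite ^ 'n"
  shows "(r *\<^sub>R A) ** B = r *\<^sub>R (A ** B)" "A ** (r *\<^sub>R B) = r *\<^sub>R (A ** B)"
  by (simp_all add: vec_eq_iff matrix_matrix_mult_def scaleR_sum_right)

lemma conj_transpose_scaleR: "conj_transpose (r *\<^sub>R A) = r *\<^sub>R conj_transpose (A :: complex ^ 'm::finite ^ 'm)"
  by (simp add: vec_eq_iff)

text \<open>The two copies contribute \<open>c^2\<close> and \<open>d^2\<close> times the identity,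
  and their mixed terms vanish whatever the relation between the two heights; equal heights are
  included.\<close>

lemma two_rows_cgram_tendsto:
  fixes A :: "complex ^ 'm::finite ^ 'm"
  assumes a: "\<And>j. j \<le> a j" and b: "\<And>j. j \<le> b j"
  defines "n \<equiv> \<lambda>j. 2 ^ a j" and "k \<equiv> \<lambda>j. 2 ^ b j"
  shows "AE w in gauss_entries. (\<lambda>j. cgram (max (n j) (k j)) (two_rows (flat c (n j)) (flat d (k j)) w) (two_rows (flat c (n j)) (flat d (k j)) w))
    \<longlonglongrightarrow> (c\<^sup>2 + d\<^sup>2) *\<^sub>R (mat 1 :: complex ^ 'm ^ 'm)"
proof -
  have pw: "1 / (2::real) ^ x \<le> (1 / 2) ^ j" if "j \<le> x" for x j
    using that by (simp add: power_divide divide_simps)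
  have n0: "real (n j) > 0" "real (k j) > 0" for j by (simp_all add: n_def k_def)
  define C where "C x y \<rho> N u v w = (\<lambda>j::nat. \<rho> j *\<^sub>R (\<Sum>i<N j. corr (x, i, u) (y, i, v) w))"
    for x y :: bool and \<rho> :: "nat \<Rightarrow> real" and N :: "nat \<Rightarrow> nat" and u v :: 'm and w
  let ?n = "\<lambda>j. 1 / real (n j)" and ?k = "\<lambda>j. 1 / real (k j)"
    and ?s = "\<lambda>j. 1 / sqrt (real (n j) * real (k j))" and ?m = "\<lambda>j. min (n j) (k j)"
  have C: "AE w in gauss_entries. C x y \<rho> N u v w \<longlonglongrightarrow> 0" if "\<And>j. (\<rho> j)\<^sup>2 * real (N j) \<le> (1 / 2) ^ j" for x y \<rho> N u v
    unfolding C_def by (rule corr_average_tendsto_0[OF _ that]) auto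
  \<comment> \<open>A mixed sum has \<open>min n k\<close> terms and scale
    \<open>1 / sqrt (n k)\<close>, so its variance is of order \<open>1 / max n k\<close>.\<close>
  have s: "(?s j)\<^sup>2 * real (?m j) \<le> (1 / 2) ^ j" for j
  proof -
    have "real (?m j) * real (max (n j) (k j)) = real (n j) * real (k j)"
      by (simp add: min_def max_def)
    then have "(?s j)\<^sup>2 * real (?m j) = 1 / real (max (n j) (k j))"
      using n0[of j] by (simp add: power_divide field_simps max_def split: if_splits)
    also have "\<dots> \<le> 1 / real (n j)" using n0[of j] by (intro divide_left_mono) auto
    also have "\<dots> \<le> (1 / 2) ^ j" using pw[OF a[of j]] by (simp add: n_def)
    finally show ?thesis .
  qed
  have n: "(?n j)\<^sup>2 * real (n j) \<le> (1 / 2) ^ j" and k: "(?k j)\<^sup>2 * real (k j) \<le> (1 / 2) ^ j" for j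
    using pw[OF a[of j]] pw[OF b[of j]] by (simp_all add: n_def k_def power2_eq_square)
  have "AE w in gauss_entries. \<forall>u\<in>UNIV. \<forall>v\<in>UNIV. C False False ?n n u v w \<longlonglongrightarrow> 0 \<and> C True True ?k k u v w \<longlonglongrightarrow> 0 \<and>
      C False True ?s ?m u v w \<longlonglongrightarrow> 0 \<and> C True False ?s ?m u v w \<longlonglongrightarrow> 0"
    by (intro AE_finite_allI AE_conjI C[OF n] C[OF k] C[OF s]) simp_all
  then show ?thesis
  proof eventually_elim
    case (elim w)
    let ?R = "\<lambda>j. two_rows (flat c (n j)) (flat d (k j)) w"
    have e: "cgram (max (n j) (k j)) (?R j) (?R j) $ u $ v =
       c\<^sup>2 *\<^sub>R (C False False ?n n u v w j + (if u = v then 1 else 0)) +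
       d\<^sup>2 *\<^sub>R (C True True ?k k u v w j + (if u = v then 1 else 0)) +
       (c * d) *\<^sub>R (C False True ?s ?m u v w j + C True False ?s ?m u v w j)" for j u v
    proof -
      let ?N = "max (n j) (k j)"
      let ?x = "flat c (n j)" and ?y = "flat d (k j)"
      have sx: "(\<Sum>i<?N. (?x i * ?x i) *\<^sub>R f i) = (c\<^sup>2 / real (n j)) *\<^sub>R (\<Sum>i<n j. f i)" for f :: "nat \<Rightarrow> complex"
        unfolding scaleR_sum_right
        by (rule sum.mono_neutral_cong_right) (auto simp: flat_def power2_eq_square)
      have sy: "(\<Sum>i<?N. (?y i * ?y i) *\<^sub>R f i) = (d\<^sup>2 / real (k j)) *\<^sub>R (\<Sum>i<k j. f i)" for f :: "nat \<Rightarrow> complex"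
        unfolding scaleR_sum_right
        by (rule sum.mono_neutral_cong_right) (auto simp: flat_def power2_eq_square)
      have sxy: "(\<Sum>i<?N. (?x i * ?y i) *\<^sub>R f i) = ((c * d) / sqrt (real (n j) * real (k j))) *\<^sub>R (\<Sum>i<min (n j) (k j). f i)" for f :: "nat \<Rightarrow> complex"
        unfolding scaleR_sum_right
        by (rule sum.mono_neutral_cong_right) (auto simp: flat_def real_sqrt_mult)
      have "cgram ?N (?R j) (?R j) $ u $ v = (\<Sum>i<?N. (?x i * ?x i) *\<^sub>R (cnj (w (False, i, u)) * w (False, i, v)) +
          (?y i * ?y i) *\<^sub>R (cnj (w (True, i, u)) * w (True, i, v)) +
          (?x i * ?y i) *\<^sub>R (cnj (w (False, i, u)) * w (True, i, v)) + (?x i * ?y i) *\<^sub>R (cnj (w (True, i, u)) * w (False, i, v)))"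
        unfolding cgram_def by (simp add: two_rows_nth scaleR_conv_of_real algebra_simps)
      also have "\<dots> = (c\<^sup>2 / real (n j)) *\<^sub>R (\<Sum>i<n j. cnj (w (False, i, u)) * w (False, i, v)) +
         (d\<^sup>2 / real (k j)) *\<^sub>R (\<Sum>i<k j. cnj (w (True, i, u)) * w (True, i, v)) +
         ((c * d) / sqrt (real (n j) * real (k j))) *\<^sub>R (\<Sum>i<min (n j) (k j). cnj (w (False, i, u)) * w (True, i, v)) +
         ((c * d) / sqrt (real (n j) * real (k j))) *\<^sub>R (\<Sum>i<min (n j) (k j). cnj (w (True, i, u)) * w (False, i, v))"
        unfolding sum.distrib sx sy sxy ..
      also have "\<dots> = c\<^sup>2 *\<^sub>R (C False False ?n n u v w j + (if u = v then 1 else 0)) +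
       d\<^sup>2 *\<^sub>R (C True True ?k k u v w j + (if u = v then 1 else 0)) +
       (c * d) *\<^sub>R (C False True ?s ?m u v w j + C True False ?s ?m u v w j)"
        unfolding C_def sum_eq_corr[where w=w and p="\<lambda>i. (False, i, u)" and q="\<lambda>i. (False, i, v)"]
          sum_eq_corr[where w=w and p="\<lambda>i. (True, i, u)" and q="\<lambda>i. (True, i, v)"]
          sum_eq_corr[where w=w and p="\<lambda>i. (True, i, u)" and q="\<lambda>i. (False, i, v)"]
          sum_eq_corr[where w=w and p="\<lambda>i. (False, i, u)" and q="\<lambda>i. (True, i, v)"] using n0[of j]
        by (cases "u = v") (simp_all add: scaleR_add_right scaleR_conv_of_real add_divide_distrib distrib_left)
      finally show ?thesis .
    qed
    show ?case
    proof (intro vec_tendstoI)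
      fix u v
      have "(\<lambda>j. cgram (max (n j) (k j)) (?R j) (?R j) $ u $ v) \<longlonglongrightarrow>
         c\<^sup>2 *\<^sub>R (0 + (if u = v then 1 else 0)) + d\<^sup>2 *\<^sub>R (0 + (if u = v then 1 else 0)) + (c * d) *\<^sub>R (0 + (0::complex))"
        unfolding e using elim by (intro tendsto_intros) auto
      then show "(\<lambda>j. cgram (max (n j) (k j)) (?R j) (?R j) $ u $ v) \<longlonglongrightarrow> ((c\<^sup>2 + d\<^sup>2) *\<^sub>R mat 1) $ u $ v"
        by (simp add: mat_def scaleR_add_left split: if_splits)
    qed
  qed
qed

text \<open>The limit depends on \<open>c\<close> and \<open>d\<close> only through
  \<open>c^2 + d^2\<close> and not on the heights. This is the source of the Cauchy property: a
  product at two heights and a square at one height have the same limiting expectation.\<close>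

proposition integral_exp_avg_gram_tendsto:
  fixes M :: "'m::{finite,linorder} inf_mat measure"
  assumes M: "prob_space M" "invariant_measure M" "sets M = sets borel"
    and a: "\<And>j. j \<le> a j" and b: "\<And>j. j \<le> b j"
  shows "(\<lambda>j. complex_of_real (\<integral>X. exp (- (c\<^sup>2 * herm_form (conj_transpose A) (avg_gram (2 ^ a j) X) +
         d\<^sup>2 * herm_form (conj_transpose A) (avg_gram (2 ^ b j) X)) / 4) \<partial>M))
       \<longlonglongrightarrow> cfm (sqrt (c\<^sup>2 + d\<^sup>2) *\<^sub>R A) M"
proof -
  interpret M: prob_space M by fact
  let ?T = "\<lambda>j w. mat_mult_right (two_rows (flat c (2 ^ a j)) (flat d (2 ^ b j)) w) A"
  let ?N = "\<lambda>j. max (2 ^ a j) (2 ^ b j) :: nat"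
  have le: "norm (cf n T M) \<le> 1" for n T
    unfolding cf_def by (rule order_trans[OF integral_norm_bound]) (simp add: M.prob_space)
  have "(\<lambda>j. \<integral>w. cf (?N j) (?T j w) M \<partial>gauss_entries) \<longlonglongrightarrow> (\<integral>w. cfm (sqrt (c\<^sup>2 + d\<^sup>2) *\<^sub>R A) M \<partial>(gauss_entries :: (bool \<times> nat \<times> 'm \<Rightarrow> complex) measure))"
  proof (rule integral_dominated_convergence[where w="\<lambda>_. 1"])
    show "AE w in gauss_entries. (\<lambda>j. cf (?N j) (?T j w) M) \<longlonglongrightarrow> cfm (sqrt (c\<^sup>2 + d\<^sup>2) *\<^sub>R A) M"
      using two_rows_cgram_tendsto[where c=c and d=d, OF a b]
    proof eventually_elim
      case (elim w)
      have "(\<lambda>j. cgram (?N j) (?T j w) (?T j w)) \<longlonglongrightarrow> conj_transpose A ** ((c\<^sup>2 + d\<^sup>2) *\<^sub>R mat 1) ** A"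
        unfolding cgram_mat_mult_right by (intro tendsto_intros elim)
      also have "conj_transpose A ** ((c\<^sup>2 + d\<^sup>2) *\<^sub>R mat 1) ** A =
        conj_transpose (sqrt (c\<^sup>2 + d\<^sup>2) *\<^sub>R A) ** (sqrt (c\<^sup>2 + d\<^sup>2) *\<^sub>R A)"
        by (simp add: matrix_mult_scaleR conj_transpose_scaleR)
      finally show ?case by (rule cf_tendsto_cfm[OF M])
    qed
  qed (use le in \<open>auto intro!: gauss_average_cf(1)[OF M(1,3)]\<close>)
  then show "(\<lambda>j. complex_of_real (\<integral>X. exp (- (c\<^sup>2 * herm_form (conj_transpose A) (avg_gram (2 ^ a j) X) +
         d\<^sup>2 * herm_form (conj_transpose A) (avg_gram (2 ^ b j) X)) / 4) \<partial>M)) \<longlonglongrightarrow> cfm (sqrt (c\<^sup>2 + d\<^sup>2) *\<^sub>R A) M"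
    unfolding gauss_average_cf(2)[OF M(1,3)] integral_complex_of_real
    by (simp add: gauss_entries.prob_space[simplified])
qed

text \<open>The conditional average over a Gaussian matrix; the 4 comes from the characteristic
  function \<open>exp (- |c|^2 / 4)\<close> of a standard complex Gaussian.\<close>

definition laplace :: "complex ^ 'm ^ 'm \<Rightarrow> complex ^ 'm ^ 'm \<Rightarrow> real" where
  "laplace C S = exp (- herm_form C (S :: complex ^ 'm::finite ^ 'm) / 4)"

lemma laplace_pos [simp]: "0 < laplace C S" by (simp add: laplace_def)

lemma laplace_le_1: "psd S \<Longrightarrow> laplace C S \<le> 1"
  by (simp add: laplace_def psd_def)

lemma laplace_measurable [measurable (raw)]:
  assumes [measurable]: "f \<in> borel_measurable M"
  shows "(\<lambda>x. laplace C (f x)) \<in> borel_measurable M"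
  unfolding laplace_def by measurable

lemma tendsto_laplace [tendsto_intros]:
  assumes "(f \<longlongrightarrow> S) F"
  shows "((\<lambda>x. laplace C (f x)) \<longlongrightarrow> laplace C S) F"
  unfolding laplace_def by (intro tendsto_intros assms) simp

lemma laplace_scaleR: "laplace (e *\<^sub>R C) S = laplace C S powr e\<^sup>2"
proof -
  have "herm_form (e *\<^sub>R C) S = e\<^sup>2 * herm_form C S"
    by (simp add: herm_form_def conj_transpose_scaleR matrix_mult_scaleR trace_def power2_eq_square
        scaleR_sum_right[symmetric])
  then show ?thesis by (simp add: laplace_def powr_def)
qed

section \<open>Almost sure convergence of averaged Gram matrices along a subsequence\<close>

lemma integral_laplace_tendsto:
  fixes M :: "'m::{finite,linorder} inf_mat measure"
  assumes M: "prob_space M" "invariant_measure M" "sets M = sets borel" and a: "\<And>j. j \<le> a j"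
  shows "(\<lambda>j. complex_of_real (\<integral>X. laplace C (avg_gram (2 ^ a j) X) \<partial>M)) \<longlonglongrightarrow> cfm (conj_transpose C) M"
  using integral_exp_avg_gram_tendsto[OF M a order_refl, of 1 "conj_transpose C" 0] by (simp add: laplace_def)

lemma integral_laplace_mult_tendsto:
  fixes M :: "'m::{finite,linorder} inf_mat measure"
  assumes M: "prob_space M" "invariant_measure M" "sets M = sets borel" and a: "\<And>j. j \<le> a j" and b: "\<And>j. j \<le> b j"
  shows "(\<lambda>j. \<integral>X. laplace C (avg_gram (2 ^ a j) X) * laplace C (avg_gram (2 ^ b j) X) \<partial>M)
    \<longlonglongrightarrow> Re (cfm (sqrt 2 *\<^sub>R conj_transpose C) M)"
  using tendsto_Re[OF integral_exp_avg_gram_tendsto[OF M a b, of 1 "conj_transpose C" 1]]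
  by (simp add: laplace_def exp_add[symmetric] add_divide_distrib diff_divide_distrib)

lemma laplace_avg_gram_integrable:
  assumes "prob_space M" "sets M = sets borel"
  shows "integrable M (\<lambda>X. laplace C (avg_gram n X))"
    "integrable M (\<lambda>X. laplace C (avg_gram n X) * laplace C (avg_gram k X))"
proof -
  interpret prob_space M by fact
  have [measurable]: "avg_gram n \<in> borel_measurable M" for n
    using assms(2) by (simp add: measurable_cong_sets[OF assms(2) refl])
  show "integrable M (\<lambda>X. laplace C (avg_gram n X))"
    by (intro integrable_const_bound[where B=1]) (auto simp: laplace_le_1 psd_avg_gram less_imp_le)
  show "integrable M (\<lambda>X. laplace C (avg_gram n X) * laplace C (avg_gram k X))"
    by (intro integrable_const_bound[where B=1])
      (auto simp: laplace_le_1 psd_avg_gram less_imp_le intro!: mult_le_one)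
qed

text \<open>Otherwise there are exponents \<open>a N, b N \<ge> N\<close> at which the
  \<open>L^1\<close> distance stays at least \<open>e\<close>. When the squared difference is
  expanded, all three expectations tend to the same value, so the \<open>L^2\<close> distance tends
  to 0.\<close>

lemma laplace_L1_Cauchy:
  fixes M :: "'m::{finite,linorder} inf_mat measure"
  assumes M: "prob_space M" "invariant_measure M" "sets M = sets borel" and e: "0 < (e :: real)"
  shows "\<exists>N. \<forall>i\<ge>N. \<forall>j\<ge>N. (\<integral>X. \<bar>laplace C (avg_gram (2 ^ i) X) - laplace C (avg_gram (2 ^ j) X)\<bar> \<partial>M) < e"
proof (rule ccontr)
  interpret prob_space M by fact
  let ?Z = "\<lambda>i X. laplace C (avg_gram (2 ^ i) X)"
  note int = laplace_avg_gram_integrable[OF M(1,3), of C]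
  assume "\<not> ?thesis"
  then have "\<forall>N. \<exists>i j. i \<ge> N \<and> j \<ge> N \<and> e \<le> (\<integral>X. \<bar>?Z i X - ?Z j X\<bar> \<partial>M)" by (auto simp: not_less) 
  from choice[OF this] obtain a where "\<forall>N. \<exists>j. a N \<ge> N \<and> j \<ge> N \<and> e \<le> (\<integral>X. \<bar>?Z (a N) X - ?Z j X\<bar> \<partial>M)" by blast
  from choice[OF this] obtain b where ab: "\<forall>N. a N \<ge> N \<and> b N \<ge> N \<and> e \<le> (\<integral>X. \<bar>?Z (a N) X - ?Z (b N) X\<bar> \<partial>M)" by blast
  then have a: "\<And>N. N \<le> a N" and b: "\<And>N. N \<le> b N"
    and ge: "\<And>N. e \<le> (\<integral>X. \<bar>?Z (a N) X - ?Z (b N) X\<bar> \<partial>M)" by blast+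
  have sq: "(?Z i X - ?Z j X)\<^sup>2 = ?Z i X * ?Z i X + ?Z j X * ?Z j X - 2 * (?Z i X * ?Z j X)" for i j X
    by (simp add: power2_eq_square algebra_simps)
  have isq: "integrable M (\<lambda>X. (?Z i X - ?Z j X)\<^sup>2)" for i j
    unfolding sq by (intro Bochner_Integration.integrable_diff Bochner_Integration.integrable_add integrable_mult_right int)
  have "(\<integral>X. (?Z i X - ?Z j X)\<^sup>2 \<partial>M) = (\<integral>X. ?Z i X * ?Z i X \<partial>M) + (\<integral>X. ?Z j X * ?Z j X \<partial>M) - 2 * (\<integral>X. ?Z i X * ?Z j X \<partial>M)" for i j
    unfolding sq using int by simp
  then have "(\<lambda>N. \<integral>X. (?Z (a N) X - ?Z (b N) X)\<^sup>2 \<partial>M) \<longlonglongrightarrow> 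
      Re (cfm (sqrt 2 *\<^sub>R conj_transpose C) M) + Re (cfm (sqrt 2 *\<^sub>R conj_transpose C) M) - 2 * Re (cfm (sqrt 2 *\<^sub>R conj_transpose C) M)"
    by (simp only:) (intro tendsto_intros integral_laplace_mult_tendsto M a b)
  then have "(\<lambda>N. \<integral>X. (?Z (a N) X - ?Z (b N) X)\<^sup>2 \<partial>M) \<longlonglongrightarrow> 0" by simp
  then have "eventually (\<lambda>N. (\<integral>X. (?Z (a N) X - ?Z (b N) X)\<^sup>2 \<partial>M) < e\<^sup>2) sequentially"
    using e by (intro order_tendstoD(2)) auto
  then obtain N where N: "(\<integral>X. (?Z (a N) X - ?Z (b N) X)\<^sup>2 \<partial>M) < e\<^sup>2"
    by (auto simp: eventually_sequentially)
  have "e \<le> (\<integral>X. \<bar>?Z (a N) X - ?Z (b N) X\<bar> \<partial>M)" by (rule ge)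
  \<comment> \<open>The inequality \<open>|x| \<le> e/2 + x^2 / (2 e)\<close> passes from
    \<open>L^2\<close> to \<open>L^1\<close>.\<close>
  also have "\<dots> \<le> (\<integral>X. e / 2 + (?Z (a N) X - ?Z (b N) X)\<^sup>2 / (2 * e) \<partial>M)"
  proof (rule integral_mono)
    fix X
    have "0 \<le> (\<bar>?Z (a N) X - ?Z (b N) X\<bar> - e)\<^sup>2" by simp
    then show "\<bar>?Z (a N) X - ?Z (b N) X\<bar> \<le> e / 2 + (?Z (a N) X - ?Z (b N) X)\<^sup>2 / (2 * e)"
      using e by (simp add: power2_diff field_simps power2_eq_square)
  qed (use isq int in auto)
  also have "\<dots> = e / 2 + (\<integral>X. (?Z (a N) X - ?Z (b N) X)\<^sup>2 \<partial>M) / (2 * e)"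
    using isq prob_space by simp
  also have "\<dots> < e / 2 + e\<^sup>2 / (2 * e)"
    using N e by (intro add_strict_left_mono divide_strict_right_mono) auto
  also have "\<dots> = e" using e by (simp add: power2_eq_square field_simps)
  finally show False by simp
qed

text \<open>The forms \<open>\<langle>x, S x\<rangle>\<close> with \<open>x = e\<^sub>j + \<theta> e\<^sub>l\<close>, \<open>\<theta> \<in> {1, \<i>}\<close>, determine a Hermitian matrix \<open>S\<close> by polarization.\<close>

definition polar :: "'m \<times> 'm \<times> bool \<Rightarrow> complex ^ 'm ^ 'm::finite" where
  "polar = (\<lambda>(j, l, b). \<chi> i k. if k = j then (if i = j then 1 else 0) + (if i = l then (if b then \<i> else 1) else 0) else 0)"

lemma herm_form_polar:
  assumes "conj_transpose S = S"
  shows "herm_form (polar (j, l, b)) S = Re (S $ j $ j) + Re (S $ l $ l) + 2 * (if b then - Im (S $ j $ l) else Re (S $ j $ l))"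
proof -
  have S: "S $ l $ j = cnj (S $ j $ l)" using assms by (metis conj_transpose_nth)
  let ?t = "if b then \<i> else 1"
  define x where "x i = (if i = j then 1 else 0) + (if i = l then ?t else 0)" for i
  have 1: "(conj_transpose (polar (j, l, b)) ** S ** polar (j, l, b)) $ k $ k =
    (if k = j then \<Sum>i\<in>UNIV. (\<Sum>h\<in>UNIV. cnj (x h) * S $ h $ i) * x i else 0)" for k
    by (simp add: polar_def matrix_matrix_mult_def x_def cong: if_cong)
  have sx: "(\<Sum>i\<in>UNIV. f i * x i) = f j + f l * ?t" "(\<Sum>i\<in>UNIV. cnj (x i) * f i) = f j + cnj ?t * f l" for f
  proof -
    have "(\<Sum>i\<in>UNIV. f i * x i) = (\<Sum>i\<in>UNIV. (if i = j then f i else 0) + (if i = l then f i * ?t else 0))"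
      by (intro sum.cong) (auto simp: x_def algebra_simps)
    then show "(\<Sum>i\<in>UNIV. f i * x i) = f j + f l * ?t" by (simp add: sum.distrib)
    have "(\<Sum>i\<in>UNIV. cnj (x i) * f i) = (\<Sum>i\<in>UNIV. (if i = j then f i else 0) + (if i = l then cnj ?t * f i else 0))"
      by (intro sum.cong) (auto simp: x_def algebra_simps)
    then show "(\<Sum>i\<in>UNIV. cnj (x i) * f i) = f j + cnj ?t * f l" by (simp add: sum.distrib)
  qed
  show ?thesis unfolding herm_form_def trace_def 1 sx
    by (simp add: S algebra_simps)
qed

lemma convergent_hermitian:
  fixes S :: "nat \<Rightarrow> complex ^ 'm::finite ^ 'm"
  assumes herm: "\<And>k. conj_transpose (S k) = S k" and conv: "\<And>p. convergent (\<lambda>k. herm_form (polar p) (S k))"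
  shows "convergent S"
proof -
  obtain L where L: "\<And>p. (\<lambda>k. herm_form (polar p) (S k)) \<longlonglongrightarrow> L p"
    using conv unfolding convergent_def by metis
  have d: "(\<lambda>k. Re (S k $ j $ j)) \<longlonglongrightarrow> L (j, j, False) / 4" for j
  proof -
    \<comment> \<open>For \<open>l = j\<close> the real test vector is \<open>2 e_j\<close>, whence
      the factor 4.\<close>
    have "(\<lambda>k. herm_form (polar (j, j, False)) (S k) / 4) \<longlonglongrightarrow> L (j, j, False) / 4" by (intro tendsto_intros L) simp
    then show ?thesis by (simp add: herm_form_polar[OF herm])
  qed
  have "\<exists>z. (\<lambda>k. S k $ j $ l) \<longlonglongrightarrow> z" for j l
  proof -
    have "(\<lambda>k. (herm_form (polar (j, l, False)) (S k) - Re (S k $ j $ j) - Re (S k $ l $ l)) / 2) \<longlonglongrightarrow>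
       (L (j, l, False) - L (j, j, False) / 4 - L (l, l, False) / 4) / 2" by (intro tendsto_intros L d) simp
    then have r: "(\<lambda>k. Re (S k $ j $ l)) \<longlonglongrightarrow> (L (j, l, False) - L (j, j, False) / 4 - L (l, l, False) / 4) / 2"
      by (simp add: herm_form_polar[OF herm])
    have "(\<lambda>k. - (herm_form (polar (j, l, True)) (S k) - Re (S k $ j $ j) - Re (S k $ l $ l)) / 2) \<longlonglongrightarrow>
       - (L (j, l, True) - L (j, j, False) / 4 - L (l, l, False) / 4) / 2" by (intro tendsto_intros L d) simp
    then have i: "(\<lambda>k. Im (S k $ j $ l)) \<longlonglongrightarrow> - (L (j, l, True) - L (j, j, False) / 4 - L (l, l, False) / 4) / 2"
      by (simp add: herm_form_polar[OF herm])
    from tendsto_Complex[OF r i] show ?thesis by auto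
  qed
  then obtain z where z: "\<And>j l. (\<lambda>k. S k $ j $ l) \<longlonglongrightarrow> z j l" by metis
  have "S \<longlonglongrightarrow> (\<chi> j l. z j l)" by (intro vec_tendstoI) (simp add: z)
  then show ?thesis by (rule convergentI)
qed

lemma cfm_0: "prob_space M \<Longrightarrow> cfm 0 M = 1"
  by (simp add: cfm_def cf_def emb_def prob_space.prob_space)

text \<open>A limit 0 would mean that the form tends to infinity. Scaling \<open>C\<close> by
  \<open>e\<close> replaces the limit \<open>\<zeta>\<close> by \<open>\<zeta> powr e^2\<close>,
  which is at most the indicator of \<open>\<zeta> > 0\<close>. Its expectation is a value of
  \<open>cfm\<close> that tends to \<open>cfm 0 M = 1\<close> as \<open>e\<close> tends to 0, so the
  event has probability 1.\<close>

lemma AE_lim_laplace_pos: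
  fixes M :: "'m::{finite,linorder} inf_mat measure"
  assumes M: "prob_space M" "invariant_measure M" "sets M = sets borel" and r: "strict_mono r"
    and conv: "AE X in M. convergent (\<lambda>k. laplace C (avg_gram (2 ^ r k) X))"
  shows "AE X in M. 0 < lim (\<lambda>k. laplace C (avg_gram (2 ^ r k) X))"
proof -
  interpret prob_space M by fact
  have [measurable]: "avg_gram n \<in> borel_measurable M" for n
    by (simp add: measurable_cong_sets[OF M(3) refl])
  define \<zeta> where "\<zeta> X = lim (\<lambda>k. laplace C (avg_gram (2 ^ r k) X))" for X
  have [measurable]: "\<zeta> \<in> borel_measurable M" unfolding \<zeta>_def by measurable
  have lim: "AE X in M. (\<lambda>k. laplace C (avg_gram (2 ^ r k) X)) \<longlonglongrightarrow> \<zeta> X"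
    using conv by eventually_elim (simp add: \<zeta>_def convergent_LIMSEQ_iff)
  have bd: "AE X in M. 0 \<le> \<zeta> X \<and> \<zeta> X \<le> 1"
    using lim
  proof eventually_elim
    case (elim X)
    have "0 \<le> \<zeta> X" by (rule LIMSEQ_le_const[OF elim]) (auto intro!: exI[of _ 0] less_imp_le)
    moreover have "\<zeta> X \<le> 1" by (rule LIMSEQ_le_const2[OF elim]) (auto intro!: exI[of _ 0] laplace_le_1 psd_avg_gram)
    ultimately show ?case ..
  qed
  have le: "Re (cfm (conj_transpose (e *\<^sub>R C)) M) \<le> prob {X \<in> space M. 0 < \<zeta> X}" if e: "0 < e" for e
  proof -
    have "(\<lambda>k. \<integral>X. laplace (e *\<^sub>R C) (avg_gram (2 ^ r k) X) \<partial>M) \<longlonglongrightarrow> (\<integral>X. \<zeta> X powr e\<^sup>2 \<partial>M)"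
    proof (rule integral_dominated_convergence[where w="\<lambda>_. 1"])
      show "AE X in M. (\<lambda>k. laplace (e *\<^sub>R C) (avg_gram (2 ^ r k) X)) \<longlonglongrightarrow> \<zeta> X powr e\<^sup>2"
        using lim
      proof eventually_elim
        case (elim X)
        then show ?case unfolding laplace_scaleR using e
          by (intro tendsto_powr') (auto simp: less_imp_le)
      qed
    qed (auto simp: laplace_le_1 psd_avg_gram less_imp_le)
    moreover have "(\<lambda>k. \<integral>X. laplace (e *\<^sub>R C) (avg_gram (2 ^ r k) X) \<partial>M) \<longlonglongrightarrow> Re (cfm (conj_transpose (e *\<^sub>R C)) M)"
      using tendsto_Re[OF integral_laplace_tendsto[OF M, of r "e *\<^sub>R C"]] r by (simp add: strict_mono_imp_increasing)
    ultimately have "Re (cfm (conj_transpose (e *\<^sub>R C)) M) = (\<integral>X. \<zeta> X powr e\<^sup>2 \<partial>M)"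
      using LIMSEQ_unique by blast
    also have "\<dots> \<le> (\<integral>X. indicator {X \<in> space M. 0 < \<zeta> X} X \<partial>M)"
    proof (rule integral_mono_AE)
      show "AE X in M. \<zeta> X powr e\<^sup>2 \<le> indicator {X \<in> space M. 0 < \<zeta> X} X"
        using bd AE_space
      proof eventually_elim
        case (elim X)
        then show ?case using e powr_mono2[of "e\<^sup>2" "\<zeta> X" 1] by (auto simp: indicator_def)
      qed
      show "integrable M (\<lambda>X. \<zeta> X powr e\<^sup>2)"
      proof (rule integrable_const_bound[where B=1])
        show "AE X in M. norm (\<zeta> X powr e\<^sup>2) \<le> 1"
          using bd by eventually_elim (use e powr_mono2[of "e\<^sup>2" _ 1] in auto)
      qed measurable
      show "integrable M (indicator {X \<in> space M. 0 < \<zeta> X} :: _ \<Rightarrow> real)"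
        by (intro integrable_const_bound[where B=1]) (auto simp: indicator_def)
    qed
    also have "\<dots> = prob {X \<in> space M. 0 < \<zeta> X}" by simp
    finally show ?thesis .
  qed
  have "(\<lambda>n. cfm (conj_transpose ((1 / real (Suc n)) *\<^sub>R C)) M) \<longlonglongrightarrow> cfm (conj_transpose (0 *\<^sub>R C)) M"
    by (intro cfm_tendsto[OF M(1,3)] tendsto_intros LIMSEQ_Suc[OF lim_1_over_n])
  moreover have "conj_transpose (0 *\<^sub>R C) = 0" by (simp add: vec_eq_iff)
  ultimately have "(\<lambda>n. Re (cfm (conj_transpose ((1 / real (Suc n)) *\<^sub>R C)) M)) \<longlonglongrightarrow> 1"
    using tendsto_Re cfm_0[OF M(1)] by fastforce
  then have "1 \<le> prob {X \<in> space M. 0 < \<zeta> X}"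
    by (rule LIMSEQ_le_const2) (auto intro!: exI[of _ 0] le)
  then have "prob {X \<in> space M. 0 < \<zeta> X} = 1" using prob_le_1 by (intro antisym) auto
  then show ?thesis unfolding \<zeta>_def[symmetric] by (subst (asm) prob_Collect_eq_1) auto
qed

text \<open>The functionals of all \<open>polar p\<close> are collected in one vector
  \<open>V\<close>, so that a single subsequence serves them all. Positivity of the limits permits
  taking logarithms, which recovers the forms and hence the matrix.\<close>

proposition AE_convergent_avg_gram:
  fixes M :: "'m::{finite,linorder} inf_mat measure"
  assumes M: "prob_space M" "invariant_measure M" "sets M = sets borel"
  obtains r :: "nat \<Rightarrow> nat" where "strict_mono r" "AE X in M. convergent (\<lambda>k. avg_gram (2 ^ r k) X)"
proof -
  interpret prob_space M by fact
  have [measurable]: "avg_gram n \<in> borel_measurable M" for n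
    by (simp add: measurable_cong_sets[OF M(3) refl])
  define V :: "nat \<Rightarrow> 'm inf_mat \<Rightarrow> real ^ ('m \<times> 'm \<times> bool)"
    where "V k X = (\<chi> p. laplace (polar p) (avg_gram (2 ^ k) X))" for k X
  have [measurable]: "V k \<in> borel_measurable M" for k unfolding V_def by measurable
  note int = laplace_avg_gram_integrable[OF M(1,3)]
  have nV: "norm (V i X - V j X) \<le> (\<Sum>p\<in>UNIV. \<bar>laplace (polar p) (avg_gram (2 ^ i) X) - laplace (polar p) (avg_gram (2 ^ j) X)\<bar>)" for i j X
    using norm_le_l1_cart[of "V i X - V j X"] by (simp add: V_def)
  have nV1: "norm (V i X) \<le> (\<Sum>p::'m \<times> 'm \<times> bool\<in>UNIV. 1)" for i X
    by (rule order_trans[OF norm_le_l1_cart]) (intro sum_mono, simp add: V_def laplace_le_1 psd_avg_gram less_imp_le)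
  have intV: "integrable M (V k)" for k
    by (rule integrable_const_bound[OF AE_I2[OF nV1]]) measurable
  obtain r where r: "strict_mono r" and C: "AE X in M. Cauchy (\<lambda>k. V (r k) X)"
  proof (rule cauchy_L1_AE_cauchy_subseq[of M V])
    show "integrable M (V k)" for k by (rule intV)
    fix e :: real assume e: "e > 0"
    define c where "c = real (CARD('m \<times> 'm \<times> bool))"
    have c: "c > 0" unfolding c_def by (simp only: of_nat_0_less_iff) (rule zero_less_card_finite)
    have "\<exists>N. \<forall>i\<ge>N. \<forall>j\<ge>N. (\<integral>X. \<bar>laplace (polar p) (avg_gram (2 ^ i) X) - laplace (polar p) (avg_gram (2 ^ j) X)\<bar> \<partial>M) < e / c" for p
      using c e by (intro laplace_L1_Cauchy[OF M]) simp
    then have "\<forall>p. \<exists>N. \<forall>i\<ge>N. \<forall>j\<ge>N. (\<integral>X. \<bar>laplace (polar p) (avg_gram (2 ^ i) X) - laplace (polar p) (avg_gram (2 ^ j) X)\<bar> \<partial>M) < e / c" by blast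
    from choice[OF this] obtain N where N: "\<forall>p. \<forall>i\<ge>N p. \<forall>j\<ge>N p.
      (\<integral>X. \<bar>laplace (polar p) (avg_gram (2 ^ i) X) - laplace (polar p) (avg_gram (2 ^ j) X)\<bar> \<partial>M) < e / c" by blast
    have "(\<integral>X. norm (V i X - V j X) \<partial>M) < e" if ij: "i \<ge> Max (range N)" "j \<ge> Max (range N)" for i j
    proof -
      have "(\<integral>X. norm (V i X - V j X) \<partial>M) \<le> (\<integral>X. (\<Sum>p\<in>UNIV. \<bar>laplace (polar p) (avg_gram (2 ^ i) X) - laplace (polar p) (avg_gram (2 ^ j) X)\<bar>) \<partial>M)"
        using intV int by (intro integral_mono nV) auto
      also have "\<dots> = (\<Sum>p\<in>UNIV. \<integral>X. \<bar>laplace (polar p) (avg_gram (2 ^ i) X) - laplace (polar p) (avg_gram (2 ^ j) X)\<bar> \<partial>M)"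
        using int by (intro Bochner_Integration.integral_sum) auto
      also have "\<dots> < (\<Sum>p::'m \<times> 'm \<times> bool\<in>UNIV. e / c)"
        using ij by (intro sum_strict_mono N[rule_format]) auto
      also have "\<dots> = e" using c by (simp add: c_def)
      finally show ?thesis .
    qed
    then show "\<exists>N. \<forall>i\<ge>N. \<forall>j\<ge>N. (\<integral>X. norm (V i X - V j X) \<partial>M) < e" by blast
  qed (rule that)
  have conv: "AE X in M. convergent (\<lambda>k. laplace (polar p) (avg_gram (2 ^ r k) X))" for p
    using C
  proof eventually_elim
    case (elim X)
    then obtain L where "(\<lambda>k. V (r k) X) \<longlonglongrightarrow> L" by (auto simp: Cauchy_convergent_iff convergent_def)
    from tendsto_vec_nth[OF this, of p] show ?case by (auto simp: V_def convergent_def)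
  qed
  have "AE X in M. \<forall>p\<in>UNIV. convergent (\<lambda>k. laplace (polar p) (avg_gram (2 ^ r k) X)) \<and>
     0 < lim (\<lambda>k. laplace (polar p :: complex ^ 'm::{finite,linorder} ^ 'm::{finite,linorder}) (avg_gram (2 ^ r k) X))"
    by (intro AE_finite_allI AE_conjI conv AE_lim_laplace_pos[OF M r]) simp
  then have "AE X in M. convergent (\<lambda>k. avg_gram (2 ^ r k) X)"
  proof eventually_elim
    case (elim X)
    show ?case
    proof (rule convergent_hermitian)
      show "conj_transpose (avg_gram (2 ^ r k) X) = avg_gram (2 ^ r k) X" for k
        using psd_avg_gram by (auto simp: psd_def)
      fix p
      have p: "convergent (\<lambda>k. laplace (polar p) (avg_gram (2 ^ r k) X))" "0 < lim (\<lambda>k. laplace (polar p) (avg_gram (2 ^ r k) X))"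
        using elim by blast+
      have "(\<lambda>k. laplace (polar p) (avg_gram (2 ^ r k) X)) \<longlonglongrightarrow> lim (\<lambda>k. laplace (polar p) (avg_gram (2 ^ r k) X))"
        using p(1) by (simp add: convergent_LIMSEQ_iff)
      then have "(\<lambda>k. - 4 * ln (laplace (polar p) (avg_gram (2 ^ r k) X))) \<longlonglongrightarrow> - 4 * ln (lim (\<lambda>k. laplace (polar p) (avg_gram (2 ^ r k) X)))"
        using p(2) by (intro tendsto_intros) auto
      then show "convergent (\<lambda>k. herm_form (polar p) (avg_gram (2 ^ r k) X))"
        by (auto simp: laplace_def convergent_def)
    qed
  qed
  with r show ?thesis by (rule that)
qed

text \<open>Dominated convergence; together with \<open>invariant_measure_eqI\<close> it shows that
  the law of the limit matrix determines \<open>M\<close>.\<close>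

lemma cfm_eq_integral_laplace:
  fixes M :: "'m::{finite,linorder} inf_mat measure"
  assumes M: "prob_space M" "invariant_measure M" "sets M = sets borel" and r: "strict_mono r"
    and conv: "AE X in M. convergent (\<lambda>k. avg_gram (2 ^ r k) X)"
  shows "cfm A M = complex_of_real (\<integral>X. laplace (conj_transpose A) (lim (\<lambda>k. avg_gram (2 ^ r k) X)) \<partial>M)"
proof -
  interpret prob_space M by fact
  have [measurable]: "avg_gram n \<in> borel_measurable M" for n
    by (simp add: measurable_cong_sets[OF M(3) refl])
  have "(\<lambda>k. \<integral>X. laplace (conj_transpose A) (avg_gram (2 ^ r k) X) \<partial>M) \<longlonglongrightarrow>
      (\<integral>X. laplace (conj_transpose A) (lim (\<lambda>k. avg_gram (2 ^ r k) X)) \<partial>M)"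
  proof (rule integral_dominated_convergence[where w="\<lambda>_. 1"])
    show "AE X in M. (\<lambda>k. laplace (conj_transpose A) (avg_gram (2 ^ r k) X)) \<longlonglongrightarrow> laplace (conj_transpose A) (lim (\<lambda>k. avg_gram (2 ^ r k) X))"
      using conv by eventually_elim (intro tendsto_intros, simp add: convergent_LIMSEQ_iff)
  qed (auto simp: laplace_le_1 psd_avg_gram less_imp_le)
  then have "(\<lambda>k. complex_of_real (\<integral>X. laplace (conj_transpose A) (avg_gram (2 ^ r k) X) \<partial>M)) \<longlonglongrightarrow>
      complex_of_real (\<integral>X. laplace (conj_transpose A) (lim (\<lambda>k. avg_gram (2 ^ r k) X)) \<partial>M)"
    by (rule tendsto_of_real)
  moreover have "(\<lambda>k. complex_of_real (\<integral>X. laplace (conj_transpose A) (avg_gram (2 ^ r k) X) \<partial>M)) \<longlonglongrightarrow> cfm A M"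
    using integral_laplace_tendsto[OF M, of r "conj_transpose A"] r by (simp add: strict_mono_imp_increasing)
  ultimately show ?thesis using LIMSEQ_unique by blast
qed

section \<open>Gaussian and Haar matrices\<close>

definition adj_inf :: "(nat \<Rightarrow> nat \<Rightarrow> complex) \<Rightarrow> nat \<Rightarrow> nat \<Rightarrow> complex" where
  "adj_inf u = (\<lambda>i j. cnj (u j i))"

lemma kron_commute: "kron i j = kron j i"
  by (simp add: kron_def)

lemma adj_inf_unitary:
  assumes "u \<in> unitary_upto n"
  shows "adj_inf u \<in> unitary_upto n"
  using assms by (auto simp: unitary_upto_def adj_inf_def mult.commute kron_commute)

lemma mat_mult_left_adj_inf:
  assumes u: "u \<in> unitary_upto n"
  shows "mat_mult_left u (mat_mult_left (adj_inf u) X) = X"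
proof
  fix i
  show "mat_mult_left u (mat_mult_left (adj_inf u) X) i = X i"
  proof (cases "i < n")
    case True
    have "mat_mult_left u (mat_mult_left (adj_inf u) X) i $ j = X i $ j" for j
    proof -
      have "mat_mult_left u (mat_mult_left (adj_inf u) X) i $ j = (\<Sum>k<n. \<Sum>l<n. u i k * (cnj (u l k) * X l $ j))"
        using True by (simp add: mat_mult_left_upto(1)[OF u] mat_mult_left_upto(1)[OF adj_inf_unitary[OF u]] sum_distrib_left) (simp add: adj_inf_def)
      also have "\<dots> = (\<Sum>l<n. \<Sum>k<n. u i k * (cnj (u l k) * X l $ j))" by (rule sum.swap)
      also have "\<dots> = (\<Sum>l<n. (\<Sum>k<n. u i k * cnj (u l k)) * X l $ j)"
        by (simp add: sum_distrib_right mult.assoc)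
      also have "\<dots> = (\<Sum>l<n. kron i l * X l $ j)"
        using u True by (simp add: unitary_upto_def)
      also have "\<dots> = X i $ j" using True by (simp add: sum_kron)
      finally show ?thesis .
    qed
    then show ?thesis by (simp add: vec_eq_iff)
  next
    case False
    then show ?thesis by (simp add: mat_mult_left_upto(2)[OF u] mat_mult_left_upto(2)[OF adj_inf_unitary[OF u]])
  qed
qed

text \<open>A converse of \<open>cf_cong_cgram\<close>: a characteristic function that sees only
  Gram matrices belongs to a left invariant measure.\<close>

lemma distr_mat_mult_left_eqI:
  fixes M :: "'m::finite inf_mat measure"
  assumes M: "prob_space M" and s: "sets M = sets borel"
    and gram: "\<And>n T T'. cgram n T T = cgram n T' T' \<Longrightarrow> cf n T M = cf n T' M"
    and u: "u \<in> unitary_inf"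
  shows "distr M borel (mat_mult_left u) = M"
proof (rule inf_mat_measure_eqI)
  have [measurable]: "mat_mult_left u \<in> borel_measurable M" by (simp add: measurable_cong_sets[OF s refl])
  show "prob_space (distr M borel (mat_mult_left u))" by (rule prob_space.prob_space_distr[OF M]) measurable
  fix n and T :: "'m inf_mat"
  obtain m where u: "u \<in> unitary_upto m" using unitary_inf_imp_upto[OF \<open>u \<in> unitary_inf\<close>] .
  define N where "N = max n m"
  \<comment> \<open>Zero rows raise the height to at least \<open>m\<close>, where \<open>u\<close>
    preserves Gram matrices; \<open>T1\<close> is the preimage of the padded matrix under
    \<open>u\<close>.\<close>
  define T0 where "T0 = (\<lambda>i. if i < n then T i else 0)"
  define T1 where "T1 = mat_mult_left (adj_inf u) T0"
  have T0: "T0 = mat_mult_left u T1" by (simp add: T1_def mat_mult_left_adj_inf[OF u])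
  have N: "m \<le> N" by (simp add: N_def)
  have pad: "(\<Sum>i<N. T0 i \<bullet> X i) = (\<Sum>i<n. T i \<bullet> X i)" for X
    by (rule sum.mono_neutral_cong_right) (auto simp: N_def T0_def)
  have "cf n T (distr M borel (mat_mult_left u)) = (\<integral>X. iexp (\<Sum>i<n. T i \<bullet> mat_mult_left u X i) \<partial>M)"
    unfolding cf_def by (subst integral_distr) auto
  also have "\<dots> = (\<integral>X. iexp (\<Sum>i<N. mat_mult_left u T1 i \<bullet> mat_mult_left u X i) \<partial>M)"
    by (simp only: pad[symmetric] T0[symmetric])
  also have "\<dots> = cf N T1 M"
    unfolding cf_def sum_inner_eq_trace_cgram cgram_mat_mult_left[OF u N] ..
  also have "\<dots> = cf N T0 M"
    unfolding T0 by (rule gram) (simp add: cgram_mat_mult_left[OF u N])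
  also have "\<dots> = cf n T M" unfolding cf_def pad ..
  finally show "cf n T (distr M borel (mat_mult_left u)) = cf n T M" .
qed (use assms in auto)

definition rows_of :: "(nat \<times> 'm \<Rightarrow> complex) \<Rightarrow> 'm::finite inf_mat" where
  "rows_of w = (\<lambda>i. \<chi> j. w (i, j))"

lemma rows_of_measurable [measurable]: "rows_of \<in> borel_measurable gauss_entries"
  unfolding rows_of_def [abs_def] by (rule measurable_coordinatewise_then_product) measurable

lemma gaussian_matrix_eq: "gaussian_matrix = distr gauss_entries borel rows_of"
  by (simp add: gaussian_matrix_def gauss_entries_def rows_of_def [abs_def])

lemma sets_gaussian_matrix [simp, measurable_cong]: "sets gaussian_matrix = sets borel"
  and space_gaussian_matrix [simp]: "space gaussian_matrix = UNIV"
  by (simp_all add: gaussian_matrix_eq)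

lemma prob_space_gaussian_matrix: "prob_space gaussian_matrix"
  unfolding gaussian_matrix_eq by (rule gauss_entries.prob_space_distr) measurable

interpretation gaussian_matrix: prob_space gaussian_matrix by (rule prob_space_gaussian_matrix)

lemma cf_gaussian_matrix: "cf n T gaussian_matrix = complex_of_real (exp (- (\<Sum>i<n. (norm (T i))\<^sup>2) / 4))"
proof -
  let ?K = "{..<n} \<times> (UNIV :: 'a set)"
  have s: "(\<Sum>p\<in>?K. f p) = (\<Sum>i<n. \<Sum>j\<in>UNIV. f (i, j))" for f :: "nat \<times> 'a \<Rightarrow> real"
    by (simp add: sum.cartesian_product split_def)
  have e: "(\<Sum>i<n. T i \<bullet> rows_of w i) = (\<Sum>p\<in>?K. w p \<bullet> (case p of (i, j) \<Rightarrow> T i $ j))" for w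
    unfolding s by (simp add: rows_of_def inner_vec_def inner_commute)
  have nrm: "(\<Sum>p\<in>?K. (norm (case p of (i, j) \<Rightarrow> T i $ j))\<^sup>2) = (\<Sum>i<n. (norm (T i))\<^sup>2)"
    unfolding s by (simp add: power2_norm_eq_inner inner_vec_def)
  have "cf n T gaussian_matrix = (\<integral>w. iexp (\<Sum>i<n. T i \<bullet> rows_of w i) \<partial>gauss_entries)"
    unfolding cf_def gaussian_matrix_eq by (subst integral_distr) auto
  also have "\<dots> = complex_of_real (exp (- (\<Sum>i<n. (norm (T i))\<^sup>2) / 4))"
    unfolding e using gauss_entries_char[of ?K "\<lambda>(i, j). T i $ j"] by (simp only: nrm) simp
  finally show ?thesis .
qed

lemma sum_norm_square_eq_trace_cgram: "(\<Sum>i<n. (norm (T i))\<^sup>2) = Re (trace (cgram n T T))"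
  by (simp add: power2_norm_eq_inner sum_inner_eq_trace_cgram)

lemma distr_gaussian_matrix_left:
  "u \<in> unitary_inf \<Longrightarrow> distr gaussian_matrix borel (mat_mult_left u) = gaussian_matrix"
  by (rule distr_mat_mult_left_eqI)
    (simp_all add: prob_space_gaussian_matrix cf_gaussian_matrix sum_norm_square_eq_trace_cgram)

section \<open>The top square block of a Gaussian matrix\<close>

definition index_row :: "'m::finite \<Rightarrow> nat" where
  "index_row = the_inv_into {..<CARD('m)} row_index"

lemma index_row: "index_row (j :: 'm::finite) < CARD('m)" "row_index (index_row j) = j"
  "i < CARD('m) \<Longrightarrow> index_row (row_index i :: 'm) = i"
proof -
  have b: "inj_on (row_index :: nat \<Rightarrow> 'm) {..<CARD('m)}" "row_index ` {..<CARD('m)} = (UNIV :: 'm set)"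
    using bij_betw_row_index by (auto simp: bij_betw_def)
  show "row_index (index_row j) = j" unfolding index_row_def by (rule f_the_inv_into_f[OF b(1)]) (simp add: b(2))
  have "index_row j \<in> {..<CARD('m)}" unfolding index_row_def by (rule the_inv_into_into[OF b(1)]) (simp_all add: b(2))
  then show "index_row j < CARD('m)" by simp
  show "i < CARD('m) \<Longrightarrow> index_row (row_index i :: 'm) = i"
    unfolding index_row_def by (rule the_inv_into_f_f[OF b(1)]) simp
qed

definition top_rows :: "'m inf_mat \<Rightarrow> complex ^ 'm ^ 'm::finite" where
  "top_rows X = (\<chi> i. X (index_row i))"

text \<open>Lets U(m) act on the first m rows as part of U(\<infinity>), so that left invariance of
  the infinite Gaussian matrix passes to its top square block.\<close>

definition extend_unitary :: "complex ^ 'm ^ 'm::finite \<Rightarrow> nat \<Rightarrow> nat \<Rightarrow> complex" where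
  "extend_unitary v = (\<lambda>i k. if i < CARD('m) \<and> k < CARD('m) then v $ row_index i $ row_index k else kron i k)"

lemma extend_unitary:
  assumes v: "v \<in> unitary_group"
  shows "extend_unitary v \<in> unitary_upto CARD('m::finite)"
    and "top_rows (mat_mult_left (extend_unitary v) X) = v ** top_rows (X :: 'm inf_mat)"
proof -
  let ?m = "CARD('m)"
  have inj: "row_index i = (row_index j :: 'm) \<longleftrightarrow> i = j" if "i < ?m" "j < ?m" for i j
    using index_row(3)[OF that(1)] index_row(3)[OF that(2)] by metis
  have vv: "(\<Sum>k\<in>UNIV. v $ a $ k * cnj (v $ b $ k)) = (if a = b then 1 else 0)"
    "(\<Sum>k\<in>UNIV. cnj (v $ k $ a) * v $ k $ b) = (if a = b then 1 else 0)" for a b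
    using unitary_groupD[OF v] by (simp_all add: vec_eq_iff matrix_matrix_mult_def mat_def)
  have "(\<Sum>k<?m. extend_unitary v i k * cnj (extend_unitary v j k)) = kron i j" if "i < ?m" "j < ?m" for i j
  proof -
    have "(\<Sum>k<?m. extend_unitary v i k * cnj (extend_unitary v j k)) =
      (\<Sum>k<?m. v $ row_index i $ row_index k * cnj (v $ row_index j $ row_index k))"
      using that by (simp add: extend_unitary_def)
    also have "\<dots> = (\<Sum>k\<in>UNIV. v $ row_index i $ k * cnj (v $ row_index j $ k))"
      by (rule sum_row_index[where f="\<lambda>k. v $ row_index i $ k * cnj (v $ row_index j $ k)"])
    finally show ?thesis by (simp add: vv inj that kron_def)
  qed
  moreover have "(\<Sum>k<?m. cnj (extend_unitary v k i) * extend_unitary v k j) = kron i j" if "i < ?m" "j < ?m" for i j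
  proof -
    have "(\<Sum>k<?m. cnj (extend_unitary v k i) * extend_unitary v k j) =
      (\<Sum>k<?m. cnj (v $ row_index k $ row_index i) * v $ row_index k $ row_index j)"
      using that by (simp add: extend_unitary_def)
    also have "\<dots> = (\<Sum>k\<in>UNIV. cnj (v $ k $ row_index i) * v $ k $ row_index j)"
      by (rule sum_row_index[where f="\<lambda>k. cnj (v $ k $ row_index i) * v $ k $ row_index j"])
    finally show ?thesis by (simp add: vv inj that kron_def)
  qed
  ultimately show u: "extend_unitary v \<in> unitary_upto ?m"
    by (auto simp: unitary_upto_def) (auto simp: extend_unitary_def)
  have "mat_mult_left (extend_unitary v) X (index_row i) $ j = (\<Sum>k\<in>UNIV. v $ i $ k * X (index_row k) $ j)" for i j
  proof -
    have "mat_mult_left (extend_unitary v) X (index_row i) $ j = (\<Sum>k<?m. v $ i $ row_index k * X (index_row (row_index k :: 'm)) $ j)"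
      by (simp add: mat_mult_left_upto(1)[OF u index_row(1)]) (simp add: extend_unitary_def index_row)
    also have "\<dots> = (\<Sum>k\<in>UNIV. v $ i $ k * X (index_row k) $ j)"
      by (rule sum_row_index[where f="\<lambda>k. v $ i $ k * X (index_row k) $ j"])
    finally show ?thesis .
  qed
  then show "top_rows (mat_mult_left (extend_unitary v) X) = v ** top_rows X"
    by (simp add: vec_eq_iff top_rows_def matrix_matrix_mult_def)
qed

lemma top_rows_measurable [measurable]: "top_rows \<in> borel_measurable borel"
  unfolding top_rows_def [abs_def]
  by (intro borel_measurable_continuous_onI continuous_intros continuous_on_product_coordinates)

definition gaussian_square :: "(complex ^ 'm ^ 'm::finite) measure" where
  "gaussian_square = distr gaussian_matrix borel top_rows"

lemma sets_gaussian_square [simp, measurable_cong]: "sets gaussian_square = sets borel"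
  and space_gaussian_square [simp]: "space gaussian_square = UNIV"
  by (simp_all add: gaussian_square_def)

lemma prob_space_gaussian_square: "prob_space gaussian_square"
  unfolding gaussian_square_def by (rule gaussian_matrix.prob_space_distr) measurable

interpretation gaussian_square: prob_space gaussian_square by (rule prob_space_gaussian_square)

lemma distr_gaussian_square_left:
  assumes v: "v \<in> unitary_group"
  shows "distr gaussian_square borel (\<lambda>g. v ** g) = gaussian_square"
proof -
  have "gaussian_square = distr (distr gaussian_matrix borel (mat_mult_left (extend_unitary v))) borel top_rows"
    unfolding gaussian_square_def using extend_unitary(1)[OF v] unitary_upto_subset
    by (subst distr_gaussian_matrix_left) auto
  also have "\<dots> = distr gaussian_matrix borel (\<lambda>X. v ** top_rows X)"
    by (subst distr_distr) (auto simp: comp_def extend_unitary(2)[OF v])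
  also have "\<dots> = distr gaussian_square borel (\<lambda>g. v ** g)"
    unfolding gaussian_square_def by (subst distr_distr) (auto simp: comp_def)
  finally show ?thesis ..
qed

text \<open>By independence the probability is bounded below by a finite product of positive ball
  probabilities.\<close>

lemma gaussian_square_open_pos:
  assumes "open A" "a \<in> A"
  shows "emeasure gaussian_square (A :: (complex ^ 'm ^ 'm::finite) set) > 0"
proof -
  obtain e where e: "e > 0" "ball a e \<subseteq> A" using assms by (auto simp: open_contains_ball)
  \<comment> \<open>The norm is at most the sum of the moduli of the m^2 entries, each of which is
    kept below \<open>d\<close>.\<close>
  define d where "d = e / (real CARD('m) * real CARD('m))"
  have m: "real CARD('m) > 0" by (simp only: of_nat_0_less_iff) (rule zero_less_card_finite)
  have d: "d > 0" using e m by (simp add: d_def)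
  let ?K = "{..<CARD('m)} \<times> (UNIV :: 'm set)"
  let ?B = "\<lambda>(i, j). ball (a $ row_index i $ j) d"
  interpret PP: product_prob_space "\<lambda>_. complex_gaussian" "UNIV :: (nat \<times> 'm) set" ..
  have "0 < (\<Prod>p\<in>?K. emeasure complex_gaussian (?B p))"
    using complex_gaussian_ball_pos[OF d] by (auto simp: prod_zero_iff zero_less_iff_neq_zero)
  also have "\<dots> = emeasure gauss_entries {w \<in> space gauss_entries. \<forall>p\<in>?K. w p \<in> ?B p}"
    unfolding gauss_entries_def by (rule PP.emeasure_PiM_Collect[symmetric]) auto
  also have "\<dots> \<le> emeasure gauss_entries {w \<in> space gauss_entries. top_rows (rows_of w) \<in> A}"
  proof (rule emeasure_mono)
    have [measurable]: "A \<in> sets borel" using assms by simp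
    have [measurable]: "(\<lambda>w. top_rows (rows_of w)) \<in> borel_measurable gauss_entries" by measurable
    show "{w \<in> space gauss_entries. top_rows (rows_of w) \<in> A} \<in> sets gauss_entries" by measurable
    show "{w \<in> space gauss_entries. \<forall>p\<in>?K. w p \<in> ?B p} \<subseteq> {w \<in> space gauss_entries. top_rows (rows_of w) \<in> A}"
    proof safe
      fix w assume w: "\<forall>p\<in>?K. w p \<in> ?B p"
      have en: "norm ((a - top_rows (rows_of w)) $ i $ j) < d" for i j
        using bspec[OF w, of "(index_row i, j)"] index_row(1,2)[of i]
        by (simp add: top_rows_def rows_of_def dist_norm)
      have "norm (a - top_rows (rows_of w)) \<le> (\<Sum>i\<in>UNIV. norm ((a - top_rows (rows_of w)) $ i))"
        by (simp only: norm_vec_def) (rule L2_set_le_sum, simp)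
      also have "\<dots> \<le> (\<Sum>i\<in>UNIV. \<Sum>j\<in>UNIV. norm ((a - top_rows (rows_of w)) $ i $ j))"
        by (intro sum_mono, simp only: norm_vec_def[of "_ $ _"]) (rule L2_set_le_sum, simp)
      also have "\<dots> < (\<Sum>i::'m\<in>UNIV. \<Sum>j::'m\<in>UNIV. d)"
        using en by (intro sum_strict_mono) auto
      also have "\<dots> = e" using m by (simp add: d_def)
      finally have "top_rows (rows_of w) \<in> ball a e" by (simp add: dist_norm)
      then show "top_rows (rows_of w) \<in> A" using e(2) by blast
    qed
  qed
  also have "\<dots> = emeasure gaussian_square A"
  proof -
    have [measurable]: "A \<in> sets borel" using assms by simp
    have [measurable]: "(\<lambda>w. top_rows (rows_of w) :: complex ^ 'm ^ 'm) \<in> borel_measurable gauss_entries" by measurable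
    have "emeasure gaussian_square A = emeasure (distr gauss_entries borel (\<lambda>w. top_rows (rows_of w))) A"
      unfolding gaussian_square_def gaussian_matrix_eq by (subst distr_distr) (auto simp: comp_def)
    also have "\<dots> = emeasure gauss_entries ((\<lambda>w. top_rows (rows_of w)) -` A \<inter> space gauss_entries)"
      by (rule emeasure_distr) measurable
    finally show ?thesis by (simp add: vimage_def)
  qed
  finally show ?thesis .
qed

section \<open>Frobenius norm, Newton iteration and polar part\<close>

lemma norm_matrix_mult:
  fixes A B :: "complex ^ 'm::finite ^ 'm"
  shows "norm (A ** B) \<le> norm A * norm B"
proof (rule power2_le_imp_le)
  have nsq: "(norm C)\<^sup>2 = (\<Sum>i\<in>UNIV. \<Sum>j\<in>UNIV. (norm (C $ i $ j))\<^sup>2)" for C :: "complex ^ 'm ^ 'm"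
    by (simp add: norm_vec_def L2_set_def sum_nonneg)
  have "(norm ((A ** B) $ i $ j))\<^sup>2 \<le> (\<Sum>k\<in>UNIV. (norm (A $ i $ k))\<^sup>2) * (\<Sum>k\<in>UNIV. (norm (B $ k $ j))\<^sup>2)" for i j
  proof -
    have "norm ((A ** B) $ i $ j) \<le> (\<Sum>k\<in>UNIV. \<bar>norm (A $ i $ k)\<bar> * \<bar>norm (B $ k $ j)\<bar>)"
      unfolding matrix_matrix_mult_def by (simp add: norm_mult[symmetric] norm_sum)
    also have "\<dots> \<le> L2_set (\<lambda>k. norm (A $ i $ k)) UNIV * L2_set (\<lambda>k. norm (B $ k $ j)) UNIV"
      by (rule L2_set_mult_ineq)
    finally have "(norm ((A ** B) $ i $ j))\<^sup>2 \<le> (L2_set (\<lambda>k. norm (A $ i $ k)) UNIV * L2_set (\<lambda>k. norm (B $ k $ j)) UNIV)\<^sup>2"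
      by (intro power_mono) auto
    then show ?thesis by (simp add: power_mult_distrib L2_set_def sum_nonneg)
  qed
  then have "(norm (A ** B))\<^sup>2 \<le> (\<Sum>i\<in>UNIV. \<Sum>j\<in>UNIV. (\<Sum>k\<in>UNIV. (norm (A $ i $ k))\<^sup>2) * (\<Sum>k\<in>UNIV. (norm (B $ k $ j))\<^sup>2))"
    unfolding nsq by (intro sum_mono)
  also have "\<dots> = (norm A)\<^sup>2 * (\<Sum>j\<in>UNIV. \<Sum>k\<in>UNIV. (norm (B $ k $ j))\<^sup>2)"
    unfolding nsq by (simp add: sum_product)
  also have "(\<Sum>j\<in>UNIV. \<Sum>k\<in>UNIV. (norm (B $ k $ j))\<^sup>2) = (norm B)\<^sup>2"
    unfolding nsq by (rule sum.swap)
  finally show "(norm (A ** B))\<^sup>2 \<le> (norm A * norm B)\<^sup>2" by (simp add: power_mult_distrib)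
qed simp

lemma bounded_bilinear_matrix_mult: "bounded_bilinear ((**) :: complex ^ 'm::finite ^ 'm \<Rightarrow> _ \<Rightarrow> complex ^ 'm ^ 'm)"
proof
  show "\<exists>K. \<forall>a b. norm ((a :: complex ^ 'm ^ 'm) ** (b :: complex ^ 'm ^ 'm)) \<le> norm a * norm b * K"
    by (intro exI[of _ 1]) (simp add: norm_matrix_mult)
qed (simp_all add: vec_eq_iff matrix_matrix_mult_def distrib_left distrib_right sum.distrib scaleR_sum_right)

text \<open>The Newton--Schulz iteration \<open>X \<mapsto> X (3 - X\<^sup>* X) / 2\<close> squares the defect \<open>1 - X\<^sup>* X\<close> up to constants, so it
  converges to a unitary matrix, the polar part of the starting point; it commutes with left multiplication
  by unitary matrices.\<close>

definition defect :: "complex ^ 'm ^ 'm \<Rightarrow> complex ^ 'm ^ 'm::finite" where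
  "defect g = mat 1 - conj_transpose g ** g"

definition newton :: "complex ^ 'm ^ 'm \<Rightarrow> complex ^ 'm ^ 'm::finite" where
  "newton g = g ** (mat 1 + (1 / 2) *\<^sub>R defect g)"

definition near_unitary :: "(complex ^ 'm ^ 'm::finite) set" where
  "near_unitary = {g. norm (defect g) < 1 / 2}"

text \<open>The default \<open>mat 1\<close> keeps all values in \<open>unitary_group\<close>, so
  that the map is measurable into the group.\<close>

definition polar_part :: "complex ^ 'm ^ 'm \<Rightarrow> complex ^ 'm ^ 'm::finite" where
  "polar_part g = (if g \<in> near_unitary then lim (\<lambda>k. (newton ^^ k) g) else mat 1)"

lemmas matrix_mult_algebra =
  bounded_bilinear.add_left[OF bounded_bilinear_matrix_mult] bounded_bilinear.add_right[OF bounded_bilinear_matrix_mult]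
  bounded_bilinear.diff_left[OF bounded_bilinear_matrix_mult] bounded_bilinear.diff_right[OF bounded_bilinear_matrix_mult]
  bounded_bilinear.scaleR_left[OF bounded_bilinear_matrix_mult] bounded_bilinear.scaleR_right[OF bounded_bilinear_matrix_mult]

lemma conj_transpose_add: "conj_transpose (A + B) = conj_transpose A + conj_transpose (B :: complex ^ 'm::finite ^ 'm)"
  and conj_transpose_diff: "conj_transpose (A - B) = conj_transpose A - conj_transpose (B :: complex ^ 'm::finite ^ 'm)"
  by (simp_all add: vec_eq_iff)

lemma conj_transpose_defect: "conj_transpose (defect g) = defect g"
  by (simp add: defect_def conj_transpose_diff conj_transpose_mult)

text \<open>With \<open>E\<close> the defect of \<open>g\<close>, the new Gram matrix is
  \<open>(1 + E/2) (1 - E) (1 + E/2)\<close>, in which the terms linear in \<open>E\<close>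
  cancel.\<close>

lemma defect_newton:
  "defect (newton g) = (3 / 4) *\<^sub>R (defect g ** defect g) + (1 / 4) *\<^sub>R (defect g ** defect g ** defect g)"
proof -
  let ?E = "defect g"
  let ?F = "mat 1 + (1 / 2) *\<^sub>R ?E"
  have F: "conj_transpose ?F = ?F"
    by (simp add: conj_transpose_add conj_transpose_scaleR conj_transpose_defect)
  have "conj_transpose (newton g) ** newton g = ?F ** (conj_transpose g ** g) ** ?F"
    unfolding newton_def conj_transpose_mult F by (simp add: matrix_mul_assoc)
  also have "conj_transpose g ** g = mat 1 - ?E" by (simp add: defect_def)
  also have "?F ** (mat 1 - ?E) ** ?F = mat 1 - (3 / 4) *\<^sub>R (?E ** ?E) - (1 / 4) *\<^sub>R (?E ** ?E ** ?E)"
    by (simp add: matrix_mult_algebra matrix_mul_assoc, simp add: vec_eq_iff, simp add: scaleR_conv_of_real field_simps)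
  finally show ?thesis by (simp add: defect_def[of "newton g"])
qed

lemma norm_defect_newton:
  assumes "norm (defect g) \<le> 1"
  shows "norm (defect (newton g)) \<le> (norm (defect g))\<^sup>2"
proof -
  let ?e = "norm (defect g)"
  have 2: "norm (defect g ** defect g) \<le> ?e * ?e" by (rule norm_matrix_mult)
  have 3: "norm (defect g ** defect g ** defect g) \<le> ?e * ?e * ?e"
    by (rule order_trans[OF norm_matrix_mult]) (intro mult_right_mono 2, simp)
  have "norm (defect (newton g)) \<le> 3 / 4 * (?e * ?e) + 1 / 4 * (?e * ?e * ?e)"
    unfolding defect_newton by (rule order_trans[OF norm_triangle_ineq]) (use 2 3 in simp)
  also have "?e * ?e * ?e \<le> ?e * ?e * 1" using assms by (intro mult_left_mono) auto
  finally show ?thesis by (simp add: power2_eq_square)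
qed

text \<open>Below 1/2, squaring gains at least a factor 1/2 per step; this geometric rate is all
  that convergence requires.\<close>

lemma newton_iterates:
  assumes "g \<in> near_unitary"
  shows "norm (defect ((newton ^^ k) g)) \<le> (1 / 2) ^ Suc k"
proof (induction k)
  case 0
  then show ?case using assms by (simp add: near_unitary_def)
next
  case (Suc k)
  let ?e = "norm (defect ((newton ^^ k) g))"
  have le: "?e \<le> 1 / 2" using Suc by (rule order_trans) (simp add: power_le_one)
  have "norm (defect ((newton ^^ Suc k) g)) \<le> ?e\<^sup>2"
    using norm_defect_newton[of "(newton ^^ k) g"] le by simp
  also have "\<dots> \<le> 1 / 2 * (1 / 2) ^ Suc k"
    unfolding power2_eq_square using le Suc by (intro mult_mono) auto
  finally show ?case by simp
qed

text \<open>The trace of \<open>g^H g\<close> is m minus the trace of the defect, whose diagonal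
  entries have modulus at most 1.\<close>

lemma norm_le_of_defect:
  fixes g :: "complex ^ 'm ^ 'm::finite"
  assumes "norm (defect g) \<le> 1"
  shows "norm g \<le> sqrt (2 * real CARD('m))"
proof (rule real_le_rsqrt)
  have "(norm g)\<^sup>2 = Re (trace (mat 1 - defect g))" by (simp add: norm_power2_eq_trace defect_def)
  also have "\<dots> = (\<Sum>i\<in>UNIV. 1 - Re (defect g $ i $ i))" by (simp add: trace_def mat_def)
  also have "\<dots> \<le> (\<Sum>i::'m\<in>UNIV. 2)"
  proof (rule sum_mono)
    fix i
    have "\<bar>Re (defect g $ i $ i)\<bar> \<le> norm (defect g $ i $ i)" by (rule abs_Re_le_cmod)
    also have "\<dots> \<le> norm (defect g $ i)" by (rule Finite_Cartesian_Product.norm_nth_le)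
    also have "\<dots> \<le> norm (defect g)" by (rule Finite_Cartesian_Product.norm_nth_le)
    finally show "1 - Re (defect g $ i $ i) \<le> 2" using assms by linarith
  qed
  finally show "(norm g)\<^sup>2 \<le> 2 * real CARD('m)" by simp
qed

lemma tendsto_defect: "f \<longlonglongrightarrow> g \<Longrightarrow> (\<lambda>k. defect (f k)) \<longlonglongrightarrow> defect g"
  unfolding defect_def by (intro tendsto_intros)

lemma newton_convergent:
  fixes g :: "complex ^ 'm ^ 'm::finite"
  assumes g: "g \<in> near_unitary"
  shows "(\<lambda>k. (newton ^^ k) g) \<longlonglongrightarrow> polar_part g" "polar_part g \<in> unitary_group"
proof -
  let ?x = "\<lambda>k. (newton ^^ k) g"
  note e = newton_iterates[OF g]
  have e1: "norm (defect (?x k)) \<le> 1" for k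
    by (rule order_trans[OF e power_le_one]) simp_all
  have e2: "norm (defect (?x k)) \<le> (1 / 2) ^ k" for k
    by (rule order_trans[OF e]) simp
  \<comment> \<open>An increment is a bounded matrix times a geometrically small defect, so the
    telescoping series converges absolutely.\<close>
  have d: "?x (Suc k) - ?x k = (1 / 2) *\<^sub>R (?x k ** defect (?x k))" for k
    by (simp add: newton_def matrix_mult_algebra)
  have "norm (?x (Suc k) - ?x k) \<le> sqrt (2 * real CARD('m)) * (1 / 2) ^ k" for k
  proof -
    have "norm (?x (Suc k) - ?x k) \<le> norm (?x k ** defect (?x k))" unfolding d by simp
    also have "\<dots> \<le> norm (?x k) * norm (defect (?x k))" by (rule norm_matrix_mult)
    also have "\<dots> \<le> sqrt (2 * real CARD('m)) * (1 / 2) ^ k"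
      by (intro mult_mono norm_le_of_defect e1 e2) auto
    finally show ?thesis .
  qed
  note bd = this
  have "summable (\<lambda>k. ?x (Suc k) - ?x k)"
  proof (rule summable_comparison_test'[where N=0])
    show "summable (\<lambda>k. sqrt (2 * real CARD('m)) * (1 / 2) ^ k)"
      by (rule summable_mult, rule summable_geometric) simp
  qed (rule bd)
  then have "(\<lambda>n. ?x 0 + (\<Sum>k<n. ?x (Suc k) - ?x k)) \<longlonglongrightarrow> ?x 0 + (\<Sum>k. ?x (Suc k) - ?x k)"
    by (rule tendsto_add[OF tendsto_const summable_LIMSEQ])
  then have "?x \<longlonglongrightarrow> ?x 0 + (\<Sum>k. ?x (Suc k) - ?x k)" 
    unfolding sum_lessThan_telescope[of "\<lambda>k. (newton ^^ k) g"] by simp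
  then have "convergent ?x" by (rule convergentI)
  then show lim: "?x \<longlonglongrightarrow> polar_part g" using g by (simp add: polar_part_def convergent_LIMSEQ_iff)
  have "(\<lambda>k. defect (?x k)) \<longlonglongrightarrow> 0"
  proof (rule Lim_null_comparison)
    show "eventually (\<lambda>k. norm (defect (?x k)) \<le> (1 / 2) ^ Suc k) sequentially" using e by simp
    show "(\<lambda>k. (1 / 2) ^ Suc k :: real) \<longlonglongrightarrow> 0" by (rule LIMSEQ_Suc[OF LIMSEQ_power_zero]) simp
  qed
  then have "defect (polar_part g) = 0" using tendsto_defect[OF lim] LIMSEQ_unique by blast
  then have "conj_transpose (polar_part g) ** polar_part g = mat 1" by (simp add: defect_def)
  then show "polar_part g \<in> unitary_group" by (simp add: unitary_group_def matrix_left_right_inverse)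
qed

lemma polar_part_unitary: "polar_part g \<in> unitary_group"
  using newton_convergent(2)[of g] by (cases "g \<in> near_unitary") (auto simp: polar_part_def)

lemma defect_unitary_mult:
  assumes "v \<in> unitary_group"
  shows "defect (v ** g) = defect g"
proof -
  have "conj_transpose (v ** g) ** (v ** g) = conj_transpose g ** (conj_transpose v ** v) ** g"
    by (simp add: conj_transpose_mult matrix_mul_assoc)
  then show ?thesis by (simp add: defect_def unitary_groupD[OF assms])
qed

lemma near_unitary_mult: "v \<in> unitary_group \<Longrightarrow> v ** g \<in> near_unitary \<longleftrightarrow> g \<in> near_unitary"
  by (simp add: near_unitary_def defect_unitary_mult)

lemma polar_part_mult:
  assumes v: "v \<in> unitary_group" and g: "g \<in> near_unitary"
  shows "polar_part (v ** g) = v ** polar_part g"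
proof -
  have it: "(newton ^^ k) (v ** g) = v ** (newton ^^ k) g" for k
    by (induction k) (simp_all add: newton_def defect_unitary_mult[OF v] matrix_mul_assoc)
  have "(\<lambda>k. v ** (newton ^^ k) g) \<longlonglongrightarrow> v ** polar_part g"
    by (intro tendsto_intros newton_convergent g)
  moreover have "(\<lambda>k. v ** (newton ^^ k) g) \<longlonglongrightarrow> polar_part (v ** g)"
    unfolding it[symmetric] by (rule newton_convergent) (simp add: near_unitary_mult v g)
  ultimately show ?thesis using LIMSEQ_unique by blast
qed

lemma open_near_unitary: "open near_unitary"
  unfolding near_unitary_def defect_def by (intro open_Collect_less continuous_intros)

lemma polar_part_measurable [measurable]: "polar_part \<in> borel_measurable borel"
proof -
  have [measurable]: "near_unitary \<in> sets borel" by (rule borel_open[OF open_near_unitary])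
  have "newton \<in> borel_measurable borel" unfolding newton_def [abs_def] defect_def by measurable
  then have [measurable]: "(newton ^^ k) \<in> borel_measurable borel" for k
    by (induction k) (auto intro: measurable_comp)
  show ?thesis unfolding polar_part_def [abs_def] by measurable
qed

section \<open>Haar measure on the unitary group\<close>

abbreviation unitary_borel :: "(complex ^ 'm::finite ^ 'm) measure" where
  "unitary_borel \<equiv> restrict_space borel unitary_group"

definition is_haar :: "(complex ^ 'm::finite ^ 'm) measure \<Rightarrow> bool" where
  "is_haar \<nu> \<longleftrightarrow> sets \<nu> = sets unitary_borel \<and> prob_space \<nu> \<and>
     (\<forall>v \<in> unitary_group. distr \<nu> \<nu> (\<lambda>w. v ** w) = \<nu>)"

lemma unitary_borel_measurable:
  assumes "f \<in> borel_measurable borel" "\<And>w. w \<in> unitary_group \<Longrightarrow> f w \<in> unitary_group"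
  shows "f \<in> unitary_borel \<rightarrow>\<^sub>M unitary_borel"
  using assms by (intro measurable_restrict_space2 measurable_restrict_space1) (auto simp: space_restrict_space)

lemma mult_unitary_measurable: "v \<in> unitary_group \<Longrightarrow> (\<lambda>w. v ** w) \<in> unitary_borel \<rightarrow>\<^sub>M unitary_borel"
  by (intro unitary_borel_measurable mult_unitary) measurable

lemma conj_transpose_unitary_measurable: "conj_transpose \<in> unitary_borel \<rightarrow>\<^sub>M unitary_borel"
  by (intro unitary_borel_measurable conj_transpose_unitary) measurable

text \<open>A Gaussian square matrix conditioned on \<open>near_unitary\<close> stays left invariant
  because that set is left invariant, and \<open>polar_part\<close> is equivariant there; so the law
  of its polar part is left invariant. The set is open and contains \<open>mat 1\<close>, hence has
  positive probability.\<close>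

lemma ex_haar: "\<exists>\<nu> :: (complex ^ 'm::finite ^ 'm) measure. is_haar \<nu>"
proof -
  let ?O = "near_unitary :: (complex ^ 'm ^ 'm) set"
  have O[measurable]: "?O \<in> sets borel" by (rule borel_open[OF open_near_unitary])
  have "mat 1 \<in> ?O" by (simp add: near_unitary_def defect_def)
  then have pos: "emeasure gaussian_square ?O > 0" by (rule gaussian_square_open_pos[OF open_near_unitary])
  define \<Gamma> where "\<Gamma> = uniform_measure gaussian_square ?O"
  have s[measurable_cong]: "sets \<Gamma> = sets borel" by (simp add: \<Gamma>_def)
  have sp: "space \<Gamma> = UNIV" by (simp add: \<Gamma>_def)
  interpret \<Gamma>: prob_space \<Gamma>
    unfolding \<Gamma>_def using pos by (intro prob_space_uniform_measure) auto
  have pm[measurable]: "polar_part \<in> \<Gamma> \<rightarrow>\<^sub>M unitary_borel"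
    using polar_part_unitary by (intro measurable_restrict_space2) auto
  define \<nu> where "\<nu> = distr \<Gamma> unitary_borel (polar_part :: complex ^ 'm ^ 'm \<Rightarrow> _)"
  have "distr \<nu> \<nu> (\<lambda>w. v ** w) = \<nu>" if v: "v \<in> unitary_group" for v
  proof -
    have inv: "distr \<Gamma> borel (\<lambda>g. v ** g) = \<Gamma>"
    proof (rule measure_eqI)
      fix B assume "B \<in> sets (distr \<Gamma> borel (\<lambda>g. v ** g))"
      then have B[measurable]: "B \<in> sets borel" by simp
      have pre: "(\<lambda>g. v ** g) -` B \<in> sets borel"
        by (rule measurable_sets_borel[OF _ B]) measurable
      have "emeasure (distr \<Gamma> borel (\<lambda>g. v ** g)) B = emeasure \<Gamma> ((\<lambda>g. v ** g) -` B)"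
        by (subst emeasure_distr) (auto simp: sp)
      also have "\<dots> = emeasure gaussian_square (?O \<inter> (\<lambda>g. v ** g) -` B) / emeasure gaussian_square ?O"
        unfolding \<Gamma>_def using pre by (intro emeasure_uniform_measure) auto
      also have "?O \<inter> (\<lambda>g. v ** g) -` B = (\<lambda>g. v ** g) -` (?O \<inter> B)"
        using near_unitary_mult[OF v] by auto
      also have "emeasure gaussian_square ((\<lambda>g. v ** g) -` (?O \<inter> B)) = emeasure (distr gaussian_square borel (\<lambda>g. v ** g)) (?O \<inter> B)"
        by (subst emeasure_distr) auto
      also have "\<dots> = emeasure gaussian_square (?O \<inter> B)" by (simp add: distr_gaussian_square_left[OF v])
      also have "emeasure gaussian_square (?O \<inter> B) / emeasure gaussian_square ?O = emeasure \<Gamma> B"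
        unfolding \<Gamma>_def by (intro emeasure_uniform_measure[symmetric]) auto
      finally show "emeasure (distr \<Gamma> borel (\<lambda>g. v ** g)) B = emeasure \<Gamma> B" .
    qed (simp add: s)
    have m: "(\<lambda>g. v ** g) \<in> \<Gamma> \<rightarrow>\<^sub>M \<Gamma>" by measurable
    have "distr \<nu> \<nu> (\<lambda>w. v ** w) = distr \<nu> unitary_borel (\<lambda>w. v ** w)"
      by (rule distr_cong) (simp_all add: \<nu>_def)
    also have "\<dots> = distr \<Gamma> unitary_borel (\<lambda>g. v ** polar_part g)"
      unfolding \<nu>_def by (subst distr_distr) (auto simp: comp_def intro!: mult_unitary_measurable v)
    \<comment> \<open>Equivariance is available only on \<open>near_unitary\<close>, which carries
      \<open>\<Gamma>\<close>.\<close>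
    also have "\<dots> = distr \<Gamma> unitary_borel (\<lambda>g. polar_part (v ** g))"
    proof (rule distr_cong_AE)
      show "AE g in \<Gamma>. v ** polar_part g = polar_part (v ** g)"
        unfolding \<Gamma>_def by (rule AE_uniform_measureI) (auto simp: polar_part_mult[OF v])
      show "(\<lambda>g. v ** polar_part g) \<in> \<Gamma> \<rightarrow>\<^sub>M unitary_borel"
        using measurable_compose[OF pm mult_unitary_measurable[OF v]] .
      show "(\<lambda>g. polar_part (v ** g)) \<in> \<Gamma> \<rightarrow>\<^sub>M unitary_borel"
        using measurable_compose[OF m pm] .
    qed auto
    also have "\<dots> = distr (distr \<Gamma> \<Gamma> (\<lambda>g. v ** g)) unitary_borel polar_part"
      by (subst distr_distr[OF pm m]) (simp add: comp_def)
    also have "distr \<Gamma> \<Gamma> (\<lambda>g. v ** g) = \<Gamma>"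
      using inv by (simp add: s cong: distr_cong)
    finally show ?thesis by (simp add: \<nu>_def)
  qed
  moreover have "prob_space \<nu>" unfolding \<nu>_def by (rule \<Gamma>.prob_space_distr) (rule pm)
  ultimately have "is_haar \<nu>" by (auto simp: is_haar_def \<nu>_def)
  then show ?thesis by blast
qed

text \<open>For independent \<open>v\<close>, \<open>w\<close> with laws \<open>\<nu>'\<close>,
  \<open>\<nu>\<close>, the law of \<open>v^H w\<close> is computed in both orders. For fixed
  \<open>v\<close> it is \<open>\<nu>\<close>; for fixed \<open>w\<close> it is the image of
  \<open>\<nu>'\<close> under the adjoint, because \<open>v^H w = (w^H v)^H\<close>. The right-hand
  side does not contain \<open>\<nu>\<close>, which gives uniqueness; equal measures give invariance
  under inversion.\<close>

lemma haar_conj_transpose: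
  fixes \<nu> \<nu>' :: "(complex ^ 'm::finite ^ 'm) measure"
  assumes "is_haar \<nu>" "is_haar \<nu>'"
  shows "\<nu> = distr \<nu>' unitary_borel conj_transpose"
proof (rule measure_eqI)
  have s: "sets \<nu> = sets unitary_borel" "sets \<nu>' = sets unitary_borel"
    and p: "prob_space \<nu>" "prob_space \<nu>'" using assms by (auto simp: is_haar_def)
  have sp: "space \<nu> = unitary_group" "space \<nu>' = unitary_group"
    using s[THEN sets_eq_imp_space_eq] by (auto simp: space_restrict_space)
  interpret \<nu>: prob_space \<nu> by fact
  interpret \<nu>': prob_space \<nu>' by fact
  interpret P: pair_prob_space \<nu>' \<nu> ..
  have inv: "emeasure \<mu> ((\<lambda>w. v ** w) -` A \<inter> unitary_group) = emeasure \<mu> A"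
    if "is_haar \<mu>" "v \<in> unitary_group" "A \<in> sets unitary_borel" for \<mu> v A
  proof -
    have s: "sets \<mu> = sets unitary_borel" and d: "distr \<mu> \<mu> (\<lambda>w. v ** w) = \<mu>"
      using that by (auto simp: is_haar_def)
    have sp: "space \<mu> = unitary_group" using sets_eq_imp_space_eq[OF s] by (simp add: space_restrict_space)
    have "emeasure (distr \<mu> \<mu> (\<lambda>w. v ** w)) A = emeasure \<mu> ((\<lambda>w. v ** w) -` A \<inter> space \<mu>)"
      using mult_unitary_measurable[OF that(2)] that(3)
      by (intro emeasure_distr) (auto simp: s measurable_cong_sets[OF s s])
    then show ?thesis by (simp add: d sp)
  qed
  show "sets \<nu> = sets (distr \<nu>' unitary_borel conj_transpose)" by (simp add: s)
  fix A assume "A \<in> sets \<nu>"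
  then have A: "A \<in> sets unitary_borel" by (simp add: s)
  let ?f = "\<lambda>(v, w). conj_transpose v ** w"
  have [measurable]: "(\<lambda>p. p) \<in> \<nu> \<rightarrow>\<^sub>M borel" "(\<lambda>p. p) \<in> \<nu>' \<rightarrow>\<^sub>M borel"
    unfolding measurable_cong_sets[OF s(1) refl] measurable_cong_sets[OF s(2) refl]
    by (intro measurable_restrict_space1; simp)+
  have [measurable]: "fst \<in> \<nu>' \<Otimes>\<^sub>M \<nu> \<rightarrow>\<^sub>M borel" "snd \<in> \<nu>' \<Otimes>\<^sub>M \<nu> \<rightarrow>\<^sub>M borel"
    using measurable_compose[OF measurable_fst, of "\<lambda>p. p" \<nu>' borel] measurable_compose[OF measurable_snd, of "\<lambda>p. p" \<nu> borel] by simp_all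
  have f: "?f \<in> \<nu>' \<Otimes>\<^sub>M \<nu> \<rightarrow>\<^sub>M unitary_borel"
    by (intro measurable_restrict_space2) (auto simp: space_pair_measure sp split_def intro!: mult_unitary conj_transpose_unitary)
  have mem: "?f -` A \<inter> space (\<nu>' \<Otimes>\<^sub>M \<nu>) \<in> sets (\<nu>' \<Otimes>\<^sub>M \<nu>)" by (rule measurable_sets[OF f A])
  have "emeasure (\<nu>' \<Otimes>\<^sub>M \<nu>) (?f -` A \<inter> space (\<nu>' \<Otimes>\<^sub>M \<nu>)) = (\<integral>\<^sup>+v. emeasure \<nu> A \<partial>\<nu>')"
    unfolding \<nu>.emeasure_pair_measure_alt[OF mem]
  proof (rule nn_integral_cong)
    fix v assume v: "v \<in> space \<nu>'"
    have "Pair v -` (?f -` A \<inter> space (\<nu>' \<Otimes>\<^sub>M \<nu>)) = (\<lambda>w. conj_transpose v ** w) -` A \<inter> unitary_group"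
      using v by (auto simp: space_pair_measure sp)
    then show "emeasure \<nu> (Pair v -` (?f -` A \<inter> space (\<nu>' \<Otimes>\<^sub>M \<nu>))) = emeasure \<nu> A"
      using inv[OF assms(1) conj_transpose_unitary A] v by (simp add: sp)
  qed
  moreover have "emeasure (\<nu>' \<Otimes>\<^sub>M \<nu>) (?f -` A \<inter> space (\<nu>' \<Otimes>\<^sub>M \<nu>)) = (\<integral>\<^sup>+w. emeasure \<nu>' (conj_transpose -` A \<inter> unitary_group) \<partial>\<nu>)"
    unfolding P.emeasure_pair_measure_alt2[OF mem]
  proof (rule nn_integral_cong)
    fix w assume w: "w \<in> space \<nu>"
    have cA: "conj_transpose -` A \<inter> unitary_group \<in> sets unitary_borel"
      using measurable_sets[OF conj_transpose_unitary_measurable A] by (simp add: space_restrict_space)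
    have "(\<lambda>v. (v, w)) -` (?f -` A \<inter> space (\<nu>' \<Otimes>\<^sub>M \<nu>)) = 
        (\<lambda>v. conj_transpose w ** v) -` (conj_transpose -` A \<inter> unitary_group) \<inter> unitary_group"
      using w by (auto simp: space_pair_measure sp conj_transpose_mult intro: mult_unitary conj_transpose_unitary)
    then show "emeasure \<nu>' ((\<lambda>v. (v, w)) -` (?f -` A \<inter> space (\<nu>' \<Otimes>\<^sub>M \<nu>))) = emeasure \<nu>' (conj_transpose -` A \<inter> unitary_group)"
      using inv[OF assms(2) conj_transpose_unitary cA] w by (simp add: sp)
  qed
  ultimately have "emeasure \<nu> A = emeasure \<nu>' (conj_transpose -` A \<inter> unitary_group)"
    using \<nu>.emeasure_space_1 \<nu>'.emeasure_space_1 by simp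
  also have "\<dots> = emeasure (distr \<nu>' unitary_borel conj_transpose) A"
    using conj_transpose_unitary_measurable A by (subst emeasure_distr) (auto simp: sp measurable_cong_sets[OF s(2) refl])
  finally show "emeasure \<nu> A = emeasure (distr \<nu>' unitary_borel conj_transpose) A" .
qed

lemma is_haar_haar_unitary: "is_haar (haar_unitary :: (complex ^ 'm::finite ^ 'm) measure)"
proof -
  have "\<exists>!\<nu> :: (complex ^ 'm ^ 'm) measure. is_haar \<nu>"
    using ex_haar haar_conj_transpose by metis
  then have "is_haar (THE \<nu> :: (complex ^ 'm ^ 'm) measure. is_haar \<nu>)" by (rule theI')
  then show ?thesis unfolding is_haar_def haar_unitary_def .
qed

lemma sets_haar_unitary: "sets haar_unitary = sets unitary_borel"
  and prob_space_haar_unitary: "prob_space haar_unitary"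
  and distr_haar_mult: "v \<in> unitary_group \<Longrightarrow> distr haar_unitary unitary_borel (\<lambda>w. v ** w) = haar_unitary"
  and distr_haar_conj_transpose: "distr haar_unitary unitary_borel conj_transpose = haar_unitary"
proof -
  show s: "sets haar_unitary = sets unitary_borel" "prob_space haar_unitary"
    using is_haar_haar_unitary by (auto simp: is_haar_def)
  show "v \<in> unitary_group \<Longrightarrow> distr haar_unitary unitary_borel (\<lambda>w. v ** w) = haar_unitary"
    using is_haar_haar_unitary s by (auto simp: is_haar_def cong: distr_cong)
  show "distr haar_unitary unitary_borel conj_transpose = haar_unitary"
    using haar_conj_transpose[OF is_haar_haar_unitary is_haar_haar_unitary] ..
qed

lemma space_haar_unitary [simp]: "space haar_unitary = unitary_group"
  using sets_eq_imp_space_eq[OF sets_haar_unitary] by (simp add: space_restrict_space)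

interpretation haar: prob_space haar_unitary by (rule prob_space_haar_unitary)

lemma haar_measurable: "f \<in> M \<rightarrow>\<^sub>M N \<Longrightarrow> sets M = sets borel \<Longrightarrow> f \<in> haar_unitary \<rightarrow>\<^sub>M N"
  unfolding measurable_cong_sets[OF sets_haar_unitary refl]
  by (intro measurable_restrict_space1) (simp cong: measurable_cong_sets)

lemma haar_measurable_id [measurable]: "(\<lambda>w. w) \<in> borel_measurable haar_unitary"
  by (rule haar_measurable[of _ borel]) auto

text \<open>Right multiplication is left multiplication conjugated with the adjoint, and the adjoint
  preserves the measure.\<close>

lemma distr_haar_mult_right:
  assumes v: "v \<in> unitary_group"
  shows "distr haar_unitary unitary_borel (\<lambda>w. w ** v) = haar_unitary"
proof -
  have c: "conj_transpose \<in> haar_unitary \<rightarrow>\<^sub>M unitary_borel" "conj_transpose \<in> unitary_borel \<rightarrow>\<^sub>M unitary_borel"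
    using conj_transpose_unitary_measurable by (simp_all add: measurable_cong_sets[OF sets_haar_unitary refl])
  have m: "(\<lambda>w. conj_transpose v ** w) \<in> unitary_borel \<rightarrow>\<^sub>M unitary_borel"
    by (rule mult_unitary_measurable[OF conj_transpose_unitary[OF v]])
  have "haar_unitary = distr (distr (distr haar_unitary unitary_borel conj_transpose) unitary_borel (\<lambda>w. conj_transpose v ** w)) unitary_borel conj_transpose"
    by (simp add: distr_haar_conj_transpose distr_haar_mult conj_transpose_unitary v)
  also have "\<dots> = distr haar_unitary unitary_borel (\<lambda>w. conj_transpose (conj_transpose v ** conj_transpose w))"
    by (simp add: distr_distr c m measurable_compose[OF c(1) m] comp_def)
  also have "\<dots> = distr haar_unitary unitary_borel (\<lambda>w. w ** v)" by (simp add: conj_transpose_mult)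
  finally show ?thesis ..
qed

lemma haar_integral_invariant:
  fixes f :: "complex ^ 'm ^ 'm \<Rightarrow> 'b::{banach, second_countable_topology}"
  assumes f: "f \<in> borel_measurable borel" and v: "v \<in> (unitary_group :: (complex ^ 'm::finite ^ 'm) set)"
  shows "(\<integral>w. f (v ** w) \<partial>haar_unitary) = (\<integral>w. f w \<partial>haar_unitary)"
    "(\<integral>w. f (w ** v) \<partial>haar_unitary) = (\<integral>w. f w \<partial>haar_unitary)"
    "(\<integral>w. f (conj_transpose w) \<partial>haar_unitary) = (\<integral>w. f w \<partial>haar_unitary)"
proof -
  have f': "f \<in> borel_measurable unitary_borel" using f by (rule measurable_restrict_space1)
  have r: "(\<lambda>w. w ** v) \<in> unitary_borel \<rightarrow>\<^sub>M unitary_borel"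
    by (intro unitary_borel_measurable mult_unitary v) measurable
  have "(\<integral>w. f (h w) \<partial>haar_unitary) = (\<integral>w. f w \<partial>haar_unitary)"
    if "distr haar_unitary unitary_borel h = haar_unitary" "h \<in> unitary_borel \<rightarrow>\<^sub>M unitary_borel" for h
  proof -
    have "h \<in> haar_unitary \<rightarrow>\<^sub>M unitary_borel" using that(2) by (simp add: measurable_cong_sets[OF sets_haar_unitary refl])
    then have "(\<integral>w. f (h w) \<partial>haar_unitary) = (\<integral>w. f w \<partial>distr haar_unitary unitary_borel h)"
      by (rule integral_distr[OF _ f', symmetric])
    then show ?thesis by (simp add: that(1))
  qed
  note this[OF distr_haar_mult[OF v] mult_unitary_measurable[OF v]] this[OF distr_haar_mult_right[OF v] r]
    this[OF distr_haar_conj_transpose conj_transpose_unitary_measurable]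
  then show "(\<integral>w. f (v ** w) \<partial>haar_unitary) = (\<integral>w. f w \<partial>haar_unitary)"
    "(\<integral>w. f (w ** v) \<partial>haar_unitary) = (\<integral>w. f w \<partial>haar_unitary)"
    "(\<integral>w. f (conj_transpose w) \<partial>haar_unitary) = (\<integral>w. f w \<partial>haar_unitary)" by auto
qed

section \<open>The measures \<open>\<mu>\<^sub>s\<close>\<close>

lemma borel_measurable_herm_form2 [measurable (raw)]:
  assumes [measurable]: "c \<in> borel_measurable M" "f \<in> borel_measurable M"
  shows "(\<lambda>x. herm_form (c x) (f x)) \<in> borel_measurable M"
  unfolding herm_form_def by measurable

lemma borel_measurable_laplace2 [measurable (raw)]:
  assumes [measurable]: "c \<in> borel_measurable M" "f \<in> borel_measurable M"
  shows "(\<lambda>x. laplace (c x) (f x)) \<in> borel_measurable M"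
  unfolding laplace_def by measurable

definition spread :: "real ^ 'm \<Rightarrow> 'm inf_mat \<times> (complex ^ 'm ^ 'm) \<Rightarrow> 'm::finite inf_mat" where
  "spread s p = mat_mult_right (fst p) (diag_mat s ** snd p)"

lemma mu_eq: "mu s = distr (gaussian_matrix \<Otimes>\<^sub>M haar_unitary) borel (spread s)"
  by (simp add: mu_def spread_def [abs_def] split_def mat_mult_right_mult)

interpretation gauss_haar: pair_prob_space gaussian_matrix haar_unitary ..

lemma fst_row_measurable [measurable]: "(\<lambda>p. fst p i) \<in> borel_measurable (gaussian_matrix \<Otimes>\<^sub>M haar_unitary)"
  by (rule measurable_compose[OF measurable_fst]) (simp add: measurable_cong_sets[OF sets_gaussian_matrix refl])

lemma spread_measurable [measurable]: "spread s \<in> borel_measurable (gaussian_matrix \<Otimes>\<^sub>M haar_unitary)"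
  unfolding spread_def [abs_def] mat_mult_right_def vector_matrix_mult_def
  by (rule measurable_coordinatewise_then_product) measurable

lemma sets_mu [simp, measurable_cong]: "sets (mu s) = sets borel"
  and space_mu [simp]: "space (mu s) = UNIV"
  by (simp_all add: mu_eq)

lemma prob_space_mu: "prob_space (mu s)"
  unfolding mu_eq by (rule gauss_haar.prob_space_distr) measurable

lemma integral_mu:
  fixes f :: "'m::finite inf_mat \<Rightarrow> 'b::{banach, second_countable_topology}"
  assumes [measurable]: "f \<in> borel_measurable borel" and b: "\<And>X. norm (f X) \<le> B"
  shows "(\<integral>X. f X \<partial>mu s) = (\<integral>w. (\<integral>G. f (mat_mult_right G (diag_mat s ** w)) \<partial>gaussian_matrix) \<partial>haar_unitary)"
proof -
  have "integrable (gaussian_matrix \<Otimes>\<^sub>M haar_unitary) (\<lambda>p. f (spread s p))"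
    using b by (intro gauss_haar.integrable_const_bound[where B=B]) auto
  then have i: "integrable (gaussian_matrix \<Otimes>\<^sub>M haar_unitary) (case_prod (\<lambda>G w. f (spread s (G, w))))"
    by (simp add: split_def)
  have "(\<integral>X. f X \<partial>mu s) = (\<integral>p. f (spread s p) \<partial>(gaussian_matrix \<Otimes>\<^sub>M haar_unitary))"
    unfolding mu_eq by (subst integral_distr) auto
  also have "\<dots> = (\<integral>w. (\<integral>G. f (spread s (G, w)) \<partial>gaussian_matrix) \<partial>haar_unitary)"
    using gauss_haar.integral_snd[OF i] by (simp add: split_def)
  finally show ?thesis by (simp add: spread_def)
qed

lemma sum_inner_mat_mult_right:
  "(\<Sum>i<n. T i \<bullet> mat_mult_right X A i) = (\<Sum>i<n. mat_mult_right T (conj_transpose A) i \<bullet> X i)"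
  by (simp add: mat_mult_right_def inner_commute[of "T _"] inner_vector_matrix_mult)

text \<open>For fixed \<open>w\<close> the matrix is a linear image of a Gaussian one, and moving
  the linear map to the side of \<open>T\<close> leaves a Gaussian characteristic function. The
  result involves \<open>T\<close> only through its Gram matrix, which yields left
  invariance.\<close>

lemma cf_mu: "cf n T (mu s) = (\<integral>w. complex_of_real (laplace (conj_transpose w ** diag_mat s) (cgram n T T)) \<partial>haar_unitary)"
proof -
  have "(\<integral>G. iexp (\<Sum>i<n. T i \<bullet> mat_mult_right G (diag_mat s ** w) i) \<partial>gaussian_matrix) =
      complex_of_real (laplace (conj_transpose w ** diag_mat s) (cgram n T T))" for w
  proof -
    have "(\<integral>G. iexp (\<Sum>i<n. T i \<bullet> mat_mult_right G (diag_mat s ** w) i) \<partial>gaussian_matrix) =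
      cf n (mat_mult_right T (conj_transpose w ** diag_mat s)) gaussian_matrix"
      by (simp only: cf_def sum_inner_mat_mult_right conj_transpose_mult conj_transpose_diag_mat)
    then show ?thesis
      by (simp add: cf_gaussian_matrix laplace_def herm_form_cgram) (simp add: mat_mult_right_def)
  qed
  then show ?thesis unfolding cf_def by (subst integral_mu[where B=1]) auto
qed

lemma laplace_conj: "laplace C (conj_transpose v ** S ** v) = laplace (v ** C) S"
  by (simp add: laplace_def herm_form_def conj_transpose_mult matrix_mul_assoc)

lemma distr_mu_right:
  assumes v: "v \<in> unitary_group"
  shows "distr (mu s) borel (\<lambda>X. mat_mult_right X v) = mu s"
proof (rule inf_mat_measure_eqI)
  fix n T
  have "cf n T (distr (mu s) borel (\<lambda>X. mat_mult_right X v)) = (\<integral>X. iexp (\<Sum>i<n. T i \<bullet> mat_mult_right X v i) \<partial>mu s)"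
    unfolding cf_def by (subst integral_distr) auto
  also have "\<dots> = cf n (mat_mult_right T (conj_transpose v)) (mu s)"
    by (simp only: cf_def sum_inner_mat_mult_right)
  \<comment> \<open>Moving \<open>v\<close> to the other side replaces \<open>w\<close> by
    \<open>w ** v\<close>, and Haar measure is right invariant.\<close>
  also have "\<dots> = (\<integral>w. complex_of_real (laplace (conj_transpose (w ** v) ** diag_mat s) (cgram n T T)) \<partial>haar_unitary)"
    by (simp add: cf_mu cgram_mat_mult_right laplace_conj[where v="conj_transpose v", simplified] conj_transpose_mult matrix_mul_assoc)
  also have "\<dots> = cf n T (mu s)"
    unfolding cf_mu by (rule haar_integral_invariant(2)[OF _ v]) measurable
  finally show "cf n T (distr (mu s) borel (\<lambda>X. mat_mult_right X v)) = cf n T (mu s)" .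
qed (auto simp: prob_space_mu intro!: prob_space.prob_space_distr[OF prob_space_mu])

lemma invariant_measure_mu: "invariant_measure (mu s)"
  unfolding invariant_measure_def
proof safe
  fix u and v :: "complex ^ 'a ^ 'a" assume u: "u \<in> unitary_inf" and v: "v \<in> unitary_group"
  have e: "unitary_act (u, v) = (\<lambda>X. mat_mult_right X (conj_transpose v)) \<circ> mat_mult_left u"
    by (auto simp: unitary_act_def matrix_inv_unitary[OF v])
  have "distr (mu s) borel (unitary_act (u, v)) = distr (distr (mu s) borel (mat_mult_left u)) borel (\<lambda>X. mat_mult_right X (conj_transpose v))"
    unfolding e by (subst distr_distr) auto
  also have "distr (mu s) borel (mat_mult_left u) = mu s"
    by (rule distr_mat_mult_left_eqI[OF prob_space_mu _ _ u]) (simp_all add: cf_mu)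
  also have "distr (mu s) borel (\<lambda>X. mat_mult_right X (conj_transpose v)) = mu s"
    by (rule distr_mu_right[OF conj_transpose_unitary[OF v]])
  finally show "distr (mu s) borel (unitary_act (u, v)) = mu s" .
qed

section \<open>Limits of averaged Gram matrices and ergodicity\<close>

definition orbit :: "real ^ 'm \<Rightarrow> (complex ^ 'm ^ 'm::finite) set" where
  "orbit s = (\<lambda>v. conj_transpose (diag_mat s ** v) ** (diag_mat s ** v)) ` unitary_group"

lemma closed_orbit: "closed (orbit s)"
  unfolding orbit_def
  by (intro compact_imp_closed compact_continuous_image compact_unitary_group continuous_intros)

text \<open>Convergence is required explicitly because \<open>lim\<close> takes an unspecified value
  on divergent sequences. The orbit consists of the Hermitian matrices with eigenvalues
  \<open>s_j^2\<close>.\<close>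

definition has_limit_in_orbit :: "(nat \<Rightarrow> nat) \<Rightarrow> real ^ 'm \<Rightarrow> 'm::finite inf_mat \<Rightarrow> bool" where
  "has_limit_in_orbit r s X \<longleftrightarrow> convergent (\<lambda>k. avg_gram (2 ^ r k) X) \<and> lim (\<lambda>k. avg_gram (2 ^ r k) X) \<in> orbit s"

lemma convergent_avg_gram_sets: "{X. convergent (\<lambda>k. avg_gram (2 ^ r k) X)} \<in> sets borel"
  unfolding Cauchy_convergent_iff[symmetric]
  using sets_Collect_Cauchy[of "\<lambda>k. avg_gram (2 ^ r k)" borel] by simp

lemma has_limit_in_orbit_sets [measurable]: "{X. has_limit_in_orbit r s X} \<in> sets borel"
proof -
  have [measurable]: "{X. convergent (\<lambda>k. avg_gram (2 ^ r k) X)} \<in> sets borel" by (rule convergent_avg_gram_sets)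
  have [measurable]: "orbit s \<in> sets borel" using closed_orbit by (rule borel_closed)
  have "{X. has_limit_in_orbit r s X} = {X. convergent (\<lambda>k. avg_gram (2 ^ r k) X)} \<inter> {X \<in> space borel. lim (\<lambda>k. avg_gram (2 ^ r k) X) \<in> orbit s}"
    by (auto simp: has_limit_in_orbit_def)
  also have "\<dots> \<in> sets borel" by measurable
  finally show ?thesis .
qed

lemma AE_avg_gram_gaussian_matrix:
  "AE G in gaussian_matrix. (\<lambda>k. avg_gram (2 ^ k) (G :: 'm::finite inf_mat)) \<longlonglongrightarrow> mat 1"
proof -
  have c: "AE w in gauss_entries. (\<lambda>k. (1 / real (2 ^ k)) *\<^sub>R (\<Sum>i<(2::nat) ^ k. corr (i, u) (i, v) w)) \<longlonglongrightarrow> 0" for u v :: 'm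
    by (rule corr_average_tendsto_0[where p="\<lambda>i. (i, u)" and q="\<lambda>i. (i, v)" and n="\<lambda>k. 2 ^ k" and \<rho>="\<lambda>k. 1 / real (2 ^ k)"])
      (auto simp: power2_eq_square power_divide)
  have "AE w in gauss_entries. \<forall>u\<in>UNIV. \<forall>v\<in>UNIV. (\<lambda>k. (1 / real (2 ^ k)) *\<^sub>R (\<Sum>i<(2::nat) ^ k. corr (i, u :: 'm) (i, v) w)) \<longlonglongrightarrow> 0"
    by (intro AE_finite_allI c) simp_all
  then have lim: "AE w in gauss_entries. (\<lambda>k. avg_gram (2 ^ k) (rows_of w :: 'm inf_mat)) \<longlonglongrightarrow> mat 1"
  proof eventually_elim
    case (elim w)
    show ?case
    proof (intro vec_tendstoI)
      fix u v
      have e: "avg_gram (2 ^ k) (rows_of w) $ u $ v = (1 / real (2 ^ k)) *\<^sub>R (\<Sum>i<(2::nat) ^ k. corr (i, u) (i, v) w) + (if u = v then 1 else 0)" for k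
        unfolding avg_gram_def cgram_def rows_of_def
        by (simp add: sum_eq_corr[where w=w and p="\<lambda>i. (i, u)" and q="\<lambda>i. (i, v)"] scaleR_add_right)
          (simp add: scaleR_conv_of_real)
      have "(\<lambda>k. avg_gram (2 ^ k) (rows_of w) $ u $ v) \<longlonglongrightarrow> 0 + (if u = v then 1 else 0)"
        unfolding e using elim by (intro tendsto_intros) auto
      then show "(\<lambda>k. avg_gram (2 ^ k) (rows_of w) $ u $ v) \<longlonglongrightarrow> mat 1 $ u $ v" by (simp add: mat_def)
    qed
  qed
  have [measurable]: "(\<lambda>G. avg_gram (2 ^ k) (G :: 'm inf_mat)) \<in> borel_measurable borel" for k by measurable
  have m: "{G \<in> space borel. (\<lambda>k. avg_gram (2 ^ k) (G :: 'm inf_mat)) \<longlonglongrightarrow> mat 1} \<in> sets borel"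
  proof -
    have "(\<lambda>k. avg_gram (2 ^ k) G) \<longlonglongrightarrow> mat 1 \<longleftrightarrow> (\<lambda>k. dist (avg_gram (2 ^ k) G) (mat 1)) \<longlonglongrightarrow> 0" for G :: "'m inf_mat"
      by (rule tendsto_dist_iff)
    then show ?thesis by (simp only:) measurable
  qed
  then show ?thesis unfolding gaussian_matrix_eq using lim by (subst AE_distr_iff) auto
qed

text \<open>With \<open>D = diag_mat s ** w\<close>, the averaged Gram matrix of \<open>G D\<close>
  is \<open>D^H S D\<close>, where \<open>S\<close> is that of \<open>G\<close> and tends to the
  identity.\<close>

lemma AE_mu_has_limit_in_orbit: "AE X in mu s. has_limit_in_orbit (\<lambda>k. k) s X"
proof -
  have "AE G in gaussian_matrix. AE w in haar_unitary. has_limit_in_orbit (\<lambda>k. k) s (spread s (G, w))"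
    using AE_avg_gram_gaussian_matrix
  proof eventually_elim
    case (elim G)
    show ?case
    proof (rule AE_I2)
      fix w :: "complex ^ 'a ^ 'a" assume "w \<in> space haar_unitary"
      then have w: "w \<in> unitary_group" by simp
      let ?D = "diag_mat s ** w"
      have e: "avg_gram n (spread s (G, w)) = conj_transpose ?D ** avg_gram n G ** ?D" for n
        by (simp add: avg_gram_def spread_def cgram_mat_mult_right matrix_mult_algebra)
      have "(\<lambda>k. avg_gram (2 ^ k) (spread s (G, w))) \<longlonglongrightarrow> conj_transpose ?D ** mat 1 ** ?D"
        unfolding e by (intro tendsto_intros elim)
      then have "(\<lambda>k. avg_gram (2 ^ k) (spread s (G, w))) \<longlonglongrightarrow> conj_transpose ?D ** ?D" by simp
      then show "has_limit_in_orbit (\<lambda>k. k) s (spread s (G, w))"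
        using w by (auto simp: has_limit_in_orbit_def limI orbit_def intro: convergentI)
    qed
  qed
  moreover have "{p \<in> space (gaussian_matrix \<Otimes>\<^sub>M haar_unitary). has_limit_in_orbit (\<lambda>k. k) s (spread s p)} \<in> sets (gaussian_matrix \<Otimes>\<^sub>M haar_unitary)"
    using measurable_sets[OF spread_measurable has_limit_in_orbit_sets[of "\<lambda>k. k" s], of s]
    by (simp add: vimage_def Int_def conj_commute)
  ultimately have "AE p in gaussian_matrix \<Otimes>\<^sub>M haar_unitary. has_limit_in_orbit (\<lambda>k. k) s (spread s p)"
    by (intro gauss_haar.AE_pair_measure) auto
  then show ?thesis unfolding mu_eq by (subst AE_distr_iff) (use has_limit_in_orbit_sets in auto)
qed

lemma norm_conj_transpose: "norm (conj_transpose A) = norm (A :: complex ^ 'm::finite ^ 'm)"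
proof -
  have "(norm (conj_transpose A))\<^sup>2 = (norm A)\<^sup>2"
    unfolding norm_power2_eq_trace by (simp add: trace_cyclic)
  then show ?thesis by simp
qed

lemma herm_form_square: "herm_form C (conj_transpose B ** B) = (norm (B ** C))\<^sup>2"
  unfolding norm_power2_eq_trace by (simp add: herm_form_def conj_transpose_mult matrix_mul_assoc)

text \<open>By right invariance \<open>A\<close> may be replaced by \<open>A ** w\<close> and
  averaged over \<open>w\<close>. On the orbit of \<open>s\<close> this Haar average is constant, so
  the limit matrix disappears from the formula and the value is the one for
  \<open>mu s\<close>.\<close>

proposition eq_mu_of_limit_in_orbit:
  fixes M :: "'m::{finite,linorder} inf_mat measure"
  assumes M: "prob_space M" "invariant_measure M" "sets M = sets borel" and r: "strict_mono r"
    and lim: "AE X in M. has_limit_in_orbit r s X"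
  shows "M = mu s"
proof (rule invariant_measure_eqI[OF M prob_space_mu invariant_measure_mu sets_mu])
  fix A
  interpret M: prob_space M by fact
  interpret P: pair_prob_space haar_unitary M ..
  define S where "S X = lim (\<lambda>k. avg_gram (2 ^ r k) X)" for X :: "'m inf_mat"
  note [measurable_cong] = M(3)
  have [measurable]: "avg_gram n \<in> borel_measurable M" for n
    by (simp add: measurable_cong_sets[OF M(3) refl])
  have [measurable]: "S \<in> borel_measurable M" unfolding S_def by measurable
  have conv: "AE X in M. convergent (\<lambda>k. avg_gram (2 ^ r k) X)"
    using lim by eventually_elim (simp add: has_limit_in_orbit_def)
  have S: "AE X in M. S X \<in> orbit s"
    using lim by eventually_elim (simp add: has_limit_in_orbit_def S_def)
  have psd: "AE X in M. psd (S X)"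
    using conv
  proof eventually_elim
    case (elim X)
    then have "(\<lambda>k. avg_gram (2 ^ r k) X) \<longlonglongrightarrow> S X" by (simp add: S_def convergent_LIMSEQ_iff)
    then show ?case by (rule psd_tendsto) (auto simp: psd_avg_gram)
  qed
  note cfm = cfm_eq_integral_laplace[OF M r conv, folded S_def]
  have rot: "cfm A M = complex_of_real (\<integral>X. laplace (conj_transpose (A ** w)) (S X) \<partial>M)" if w: "w \<in> unitary_group" for w
  proof -
    have "emb (A ** w) = mat_mult_right (emb A) w"
      by (rule ext) (simp add: emb_def mat_mult_right_def vec_eq_iff matrix_matrix_mult_def vector_matrix_mult_nth)
    then have "cfm A M = cfm (A ** w) M" unfolding cfm_def using cf_mat_mult_right[OF M(2,3) w] by metis
    then show ?thesis by (simp only: cfm)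
  qed
  define L where "L w = laplace (conj_transpose w ** diag_mat s) (conj_transpose A ** A)" for w
  have [measurable]: "L \<in> borel_measurable borel" unfolding L_def [abs_def] by measurable
  have m: "(\<lambda>p. laplace (conj_transpose (A ** fst p)) (S (snd p))) \<in> borel_measurable (haar_unitary \<Otimes>\<^sub>M M)"
  proof -
    have [measurable]: "fst \<in> borel_measurable (haar_unitary \<Otimes>\<^sub>M M)"
      using measurable_compose[OF measurable_fst haar_measurable_id] by simp
    show ?thesis by measurable
  qed
  \<comment> \<open>\<open>S X\<close> is positive semidefinite only almost surely, so the bound by
    1 holds almost surely too.\<close>
  have bound: "AE p in haar_unitary \<Otimes>\<^sub>M M. norm (laplace (conj_transpose (A ** fst p)) (S (snd p))) \<le> 1"
  proof (rule P.AE_pair_measure)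
    show "AE w in haar_unitary. AE X in M. norm (laplace (conj_transpose (A ** fst (w, X))) (S (snd (w, X)))) \<le> 1"
      by (rule AE_I2) (use psd in \<open>auto elim!: eventually_mono simp: less_imp_le laplace_le_1\<close>)
    show "{p \<in> space (haar_unitary \<Otimes>\<^sub>M M). norm (laplace (conj_transpose (A ** fst p)) (S (snd p))) \<le> 1} \<in> sets (haar_unitary \<Otimes>\<^sub>M M)"
      using m by measurable
  qed
  have int: "integrable (haar_unitary \<Otimes>\<^sub>M M) (case_prod (\<lambda>w X. laplace (conj_transpose (A ** w)) (S X)))"
    using P.integrable_const_bound[OF bound m] by (simp add: split_def)
  have orb: "(\<integral>w. laplace (conj_transpose (A ** w)) T \<partial>haar_unitary) = (\<integral>w. L w \<partial>haar_unitary)" if orb: "T \<in> orbit s" for T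
  proof -
    obtain v where v: "v \<in> unitary_group" and T: "T = conj_transpose (diag_mat s ** v) ** (diag_mat s ** v)"
      using orb by (auto simp: orbit_def)
    \<comment> \<open>The Frobenius norm is invariant under the adjoint, which exchanges the roles
      of \<open>A\<close> and \<open>diag_mat s\<close>.\<close>
    have "laplace (conj_transpose (A ** w)) T = L (v ** conj_transpose w)" for w
    proof -
      have "norm (diag_mat s ** v ** conj_transpose (A ** w)) = norm (conj_transpose (diag_mat s ** v ** conj_transpose (A ** w)))"
        by (rule norm_conj_transpose[symmetric])
      also have "\<dots> = norm (A ** (conj_transpose (v ** conj_transpose w) ** diag_mat s))"
        by (simp add: conj_transpose_mult matrix_mul_assoc)
      finally show ?thesis by (simp add: L_def T laplace_def herm_form_square)
    qed
    then have "(\<integral>w. laplace (conj_transpose (A ** w)) T \<partial>haar_unitary) = (\<integral>w. L (v ** conj_transpose w) \<partial>haar_unitary)" by simp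
    also have "\<dots> = (\<integral>w. L (v ** w) \<partial>haar_unitary)"
      by (rule haar_integral_invariant(3)[OF _ v]) measurable
    also have "\<dots> = (\<integral>w. L w \<partial>haar_unitary)"
      by (rule haar_integral_invariant(1)[OF _ v]) measurable
    finally show ?thesis .
  qed
  have "cfm A M = (\<integral>w. cfm A M \<partial>(haar_unitary :: (complex ^ 'm::{finite,linorder} ^ 'm::{finite,linorder}) measure))"
    using haar.prob_space by (simp add: haar.prob_space[simplified])
  also have "\<dots> = (\<integral>w. complex_of_real (\<integral>X. laplace (conj_transpose (A ** w)) (S X) \<partial>M) \<partial>haar_unitary)"
    by (intro Bochner_Integration.integral_cong refl rot) simp
  also have "\<dots> = complex_of_real (\<integral>w. (\<integral>X. laplace (conj_transpose (A ** w)) (S X) \<partial>M) \<partial>haar_unitary)"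
    by (rule integral_complex_of_real)
  also have "(\<integral>w. (\<integral>X. laplace (conj_transpose (A ** w)) (S X) \<partial>M) \<partial>haar_unitary) =
      (\<integral>X. (\<integral>w. laplace (conj_transpose (A ** w)) (S X) \<partial>haar_unitary) \<partial>M)"
    by (rule P.Fubini_integral[OF int, symmetric])
  also have "\<dots> = (\<integral>X. (\<integral>w. L w \<partial>haar_unitary) \<partial>M)"
  proof (rule integral_cong_AE)
    show "(\<lambda>X. \<integral>w. laplace (conj_transpose (A ** w)) (S X) \<partial>haar_unitary) \<in> borel_measurable M"
      using P.integrable_snd[OF int] by (rule borel_measurable_integrable)
    show "AE X in M. (\<integral>w. laplace (conj_transpose (A ** w)) (S X) \<partial>haar_unitary) = (\<integral>w. L w \<partial>haar_unitary)"
      using S by eventually_elim (rule orb)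
  qed simp
  also have "\<dots> = (\<integral>w. L w \<partial>haar_unitary)" using M.prob_space by simp
  also have "complex_of_real \<dots> = cfm A (mu s)"
    unfolding cfm_def cf_mu cgram_emb L_def by (rule integral_complex_of_real[symmetric])
  finally show "cfm A M = cfm A (mu s)" .
qed

lemma mat_mult_left_right: "mat_mult_left u (mat_mult_right X A) = mat_mult_right (mat_mult_left u X) A"
proof -
  have "(\<Sum>k | u i k \<noteq> 0. u i k * (\<Sum>a\<in>UNIV. X k $ a * A $ a $ j)) = (\<Sum>a\<in>UNIV. (\<Sum>k | u i k \<noteq> 0. u i k * X k $ a) * A $ a $ j)" for i j
  proof -
    have "(\<Sum>k | u i k \<noteq> 0. u i k * (\<Sum>a\<in>UNIV. X k $ a * A $ a $ j)) = (\<Sum>k | u i k \<noteq> 0. \<Sum>a\<in>UNIV. u i k * X k $ a * A $ a $ j)"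
      by (simp add: sum_distrib_left mult.assoc)
    also have "\<dots> = (\<Sum>a\<in>UNIV. \<Sum>k | u i k \<noteq> 0. u i k * X k $ a * A $ a $ j)" by (rule sum.swap)
    finally show ?thesis by (simp add: sum_distrib_right)
  qed
  then show ?thesis by (simp add: fun_eq_iff vec_eq_iff mat_mult_left_def mat_mult_right_def vector_matrix_mult_nth)
qed

lemma unitary_act_eq:
  "v \<in> unitary_group \<Longrightarrow> unitary_act (u, v) X = mat_mult_right (mat_mult_left u X) (conj_transpose v)"
  by (simp add: unitary_act_def matrix_inv_unitary)

lemma unitary_act_inverse:
  assumes u: "u \<in> unitary_inf" and v: "v \<in> unitary_group"
  shows "\<exists>u'\<in>unitary_inf. \<exists>v'\<in>unitary_group. \<forall>X. unitary_act (u', v') (unitary_act (u, v) X) = X \<and> unitary_act (u, v) (unitary_act (u', v') X) = X"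
proof -
  obtain n where n: "u \<in> unitary_upto n" using unitary_inf_imp_upto[OF u] .
  note n' = adj_inf_unitary[OF n]
  have aa: "adj_inf (adj_inf u) = u" by (simp add: adj_inf_def)
  have "adj_inf u \<in> unitary_inf" using n' unitary_upto_subset by blast
  moreover have "unitary_act (adj_inf u, conj_transpose v) (unitary_act (u, v) X) = X" for X
    using mat_mult_left_adj_inf[OF n', of X]
    by (simp add: unitary_act_eq v conj_transpose_unitary mat_mult_left_right mat_mult_right_mult unitary_groupD[OF v] aa)
  moreover have "unitary_act (u, v) (unitary_act (adj_inf u, conj_transpose v) X) = X" for X
    using mat_mult_left_adj_inf[OF n, of X]
    by (simp add: unitary_act_eq v conj_transpose_unitary mat_mult_left_right mat_mult_right_mult unitary_groupD[OF v])
  ultimately show ?thesis using conj_transpose_unitary[OF v] by blast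
qed

text \<open>Stability suffices for equality of the images because the inverse maps belong to the
  same group.\<close>

lemma invariant_setI:
  assumes "\<And>u v X. u \<in> unitary_inf \<Longrightarrow> v \<in> unitary_group \<Longrightarrow> X \<in> B \<Longrightarrow> unitary_act (u, v) X \<in> B"
  shows "invariant_set B"
  unfolding invariant_set_def
proof safe
  fix u :: "nat \<Rightarrow> nat \<Rightarrow> complex" and v :: "complex ^ 'a ^ 'a" and X assume u: "u \<in> unitary_inf" and v: "v \<in> unitary_group" and X: "X \<in> B"
  show "unitary_act (u, v) X \<in> B" by (rule assms[OF u v X])
  obtain u' v' where i: "u' \<in> unitary_inf" "v' \<in> unitary_group" "unitary_act (u, v) (unitary_act (u', v') X) = X"
    using unitary_act_inverse[OF u v] by blast
  have "unitary_act (u', v') X \<in> B" by (rule assms[OF i(1,2) X])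
  then show "X \<in> unitary_act (u, v) ` B" using i(3) by (metis image_eqI)
qed

lemma invariant_set_vimage:
  assumes "invariant_set A" and u: "u \<in> unitary_inf" and v: "v \<in> unitary_group"
  shows "unitary_act (u, v) X \<in> A \<longleftrightarrow> X \<in> A"
proof -
  obtain u' v' where i: "u' \<in> unitary_inf" "v' \<in> unitary_group" "unitary_act (u', v') (unitary_act (u, v) X) = X"
    using unitary_act_inverse[OF u v] by blast
  have "unitary_act (u, v) ` A = A" "unitary_act (u', v') ` A = A"
    using assms i by (auto simp: invariant_set_def)
  then show ?thesis using i(3) by (metis image_eqI)
qed

text \<open>The preimage of an invariant set is the set itself, so intersecting with it commutes
  with taking preimages.\<close>

lemma invariant_uniform_measure:
  fixes M :: "'m::finite inf_mat measure"
  assumes M: "sets M = sets borel" "invariant_measure M" and A: "A \<in> sets borel" "invariant_set A"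
  shows "invariant_measure (uniform_measure M A)"
  unfolding invariant_measure_def
proof safe
  fix u and v :: "complex ^ 'm ^ 'm" assume u: "u \<in> unitary_inf" and v: "v \<in> unitary_group"
  let ?g = "unitary_act (u, v)"
  have sp: "space M = UNIV" using sets_eq_imp_space_eq[OF M(1)] by simp
  have A': "A \<in> sets M" using A M by simp
  have gM: "?g \<in> M \<rightarrow>\<^sub>M borel" by (simp add: measurable_cong_sets[OF M(1) refl])
  have gU: "?g \<in> uniform_measure M A \<rightarrow>\<^sub>M borel" using gM by simp
  show "distr (uniform_measure M A) borel ?g = uniform_measure M A"
  proof (rule measure_eqI)
    fix B assume "B \<in> sets (distr (uniform_measure M A) borel ?g)"
    then have B: "B \<in> sets borel" by simp
    have pre: "?g -` B \<in> sets M" using measurable_sets[OF gM B] by (simp add: sp)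
    have "emeasure (distr (uniform_measure M A) borel ?g) B = emeasure (uniform_measure M A) (?g -` B)"
      using B gU by (subst emeasure_distr) (auto simp: sp)
    also have "\<dots> = emeasure M (A \<inter> ?g -` B) / emeasure M A"
      by (rule emeasure_uniform_measure[OF A' pre])
    also have "A \<inter> ?g -` B = ?g -` (A \<inter> B)"
      using invariant_set_vimage[OF A(2) u v] by auto
    also have "emeasure M (?g -` (A \<inter> B)) = emeasure (distr M borel ?g) (A \<inter> B)"
      using gM A B by (subst emeasure_distr) (auto simp: sp)
    also have "distr M borel ?g = M" using M(2) u v by (auto simp: invariant_measure_def)
    also have "emeasure M (A \<inter> B) / emeasure M A = emeasure (uniform_measure M A) B"
      using A' B M by (intro emeasure_uniform_measure[symmetric]) auto
    finally show "emeasure (distr (uniform_measure M A) borel ?g) B = emeasure (uniform_measure M A) B" .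
  qed (simp add: M)
qed

text \<open>If \<open>A\<close> is invariant and not null, then \<open>\<mu>\<^sub>s\<close> conditioned on \<open>A\<close> is invariant and has the same limiting
  Gram matrices, hence equals \<open>\<mu>\<^sub>s\<close>.\<close>

proposition mu_ergodic: "mu (s :: real ^ 'm::{finite,linorder}) \<in> ergodic_measures"
proof -
  interpret prob_space "mu s" by (rule prob_space_mu)
  have "emeasure (mu s) A = 0 \<or> emeasure (mu s) (UNIV - A) = 0"
    if A: "A \<in> sets borel" "invariant_set A" for A
  proof (cases "emeasure (mu s) A = 0")
    case False
    note pos = this
    have A': "A \<in> sets (mu s)" using A by simp
    define N where "N = uniform_measure (mu s) A"
    have "N = mu s"
    proof (rule eq_mu_of_limit_in_orbit[where r="\<lambda>k. k"])
      show "prob_space N" unfolding N_def using pos by (intro prob_space_uniform_measure) auto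
      show "invariant_measure N" unfolding N_def by (rule invariant_uniform_measure[OF sets_mu invariant_measure_mu A])
      show "AE X in N. has_limit_in_orbit (\<lambda>k. k) s X"
        unfolding N_def using AE_mu_has_limit_in_orbit[of s] by (intro AE_uniform_measureI A') auto
    qed (auto simp: N_def strict_mono_def)
    then have "emeasure (mu s) (UNIV - A) = emeasure N (UNIV - A)" by simp
    also have "\<dots> = emeasure (mu s) (A \<inter> (UNIV - A)) / emeasure (mu s) A"
      unfolding N_def using A by (intro emeasure_uniform_measure) auto
    also have "\<dots> = 0" by simp
    finally show ?thesis ..
  qed simp
  then show ?thesis
    by (auto simp: ergodic_measures_def borel_prob_measures_def prob_space_mu invariant_measure_mu)
qed

section \<open>Classification and homeomorphism\<close>

text \<open>The polynomial with factors \<open>1 + x s_j^2\<close> is determined by its values at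
  the naturals. At the first index \<open>j\<close> where the vectors differ, say
  \<open>s'_j < s_j\<close>, the earlier factors cancel and evaluation at \<open>- 1 / s_j^2\<close>
  gives 0 for \<open>s\<close>; for \<open>s'\<close> it is positive, as the later entries do not
  exceed \<open>s'_j\<close>.\<close>

lemma ordered_cone_eqI:
  fixes s s' :: "real ^ 'm::{finite,linorder}"
  assumes s: "s \<in> ordered_cone" and s': "s' \<in> ordered_cone"
    and eq: "\<And>n::nat. (\<Prod>j\<in>UNIV. 1 + real n * (s $ j)\<^sup>2) = (\<Prod>j\<in>UNIV. 1 + real n * (s' $ j)\<^sup>2)"
  shows "s = s'"
proof (rule ccontr)
  define P where "P s = (\<Prod>j\<in>UNIV. [:1, (s $ j)\<^sup>2:])" for s :: "real ^ 'm::{finite,linorder}"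
  have poly_P: "poly (P s) x = (\<Prod>j\<in>UNIV. 1 + x * (s $ j)\<^sup>2)" for s x
    by (simp add: P_def poly_prod)
  have P: "P s = P s'"
  proof (rule ccontr)
    assume "P s \<noteq> P s'"
    then have "finite {x. poly (P s - P s') x = 0}" by (intro poly_roots_finite) simp
    moreover have "range real \<subseteq> {x. poly (P s - P s') x = 0}" using eq by (auto simp: poly_P)
    ultimately have "finite (range real)" by (rule finite_subset[rotated])
    then show False by (simp add: finite_image_iff)
  qed
  have no: "\<not> s' $ j < s $ j"
    if s: "s \<in> ordered_cone" and s': "s' \<in> ordered_cone" and P: "P s = P s'" and before: "\<And>i. i < j \<Longrightarrow> s $ i = s' $ i"
    for s s' :: "real ^ 'm::{finite,linorder}" and j
  proof
    assume less: "s' $ j < s $ j"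
    have pos: "0 < s $ j" using less s' by (auto simp: ordered_cone_def intro: le_less_trans)
    have split: "P u = (\<Prod>i\<in>{..<j}. [:1, (u $ i)\<^sup>2:]) * (\<Prod>i\<in>{j..}. [:1, (u $ i)\<^sup>2:])" for u
    proof -
      have "(\<Prod>i\<in>{..<j} \<union> {j..}. [:1, (u $ i)\<^sup>2:]) = (\<Prod>i\<in>{..<j}. [:1, (u $ i)\<^sup>2:]) * (\<Prod>i\<in>{j..}. [:1, (u $ i)\<^sup>2:])"
        by (rule prod.union_disjoint) auto
      moreover have "{..<j} \<union> {j..} = UNIV" by auto
      ultimately show ?thesis by (simp only: P_def)
    qed
    have "(\<Prod>i\<in>{..<j}. [:1, (s $ i)\<^sup>2:]) = (\<Prod>i\<in>{..<j}. [:1, (s' $ i)\<^sup>2:])"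
      using before by (intro prod.cong) auto
    \<comment> \<open>The cancelled factor is nonzero as a polynomial but may vanish at the point of
      evaluation, when \<open>s_i = s_j\<close> for some \<open>i < j\<close>; hence cancellation
      precedes evaluation.\<close>
    moreover have "(\<Prod>i\<in>{..<j}. [:1, (s' $ i)\<^sup>2:]) \<noteq> 0" by (simp add: prod_zero_iff)
    ultimately have "(\<Prod>i\<in>{j..}. [:1, (s $ i)\<^sup>2:]) = (\<Prod>i\<in>{j..}. [:1, (s' $ i)\<^sup>2:])"
      using P unfolding split by simp
    then have "poly (\<Prod>i\<in>{j..}. [:1, (s $ i)\<^sup>2:]) (- 1 / (s $ j)\<^sup>2) = poly (\<Prod>i\<in>{j..}. [:1, (s' $ i)\<^sup>2:]) (- 1 / (s $ j)\<^sup>2)"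
      by simp
    then have "(\<Prod>i\<in>{j..}. 1 - (s $ i)\<^sup>2 / (s $ j)\<^sup>2) = (\<Prod>i\<in>{j..}. 1 - (s' $ i)\<^sup>2 / (s $ j)\<^sup>2)"
      by (simp add: poly_prod)
    moreover have "(\<Prod>i\<in>{j..}. 1 - (s $ i)\<^sup>2 / (s $ j)\<^sup>2) = 0"
      using pos by (intro prod_zero) (auto intro!: bexI[of _ j])
    moreover have "(\<Prod>i\<in>{j..}. 1 - (s' $ i)\<^sup>2 / (s $ j)\<^sup>2) > 0"
    proof (rule prod_pos)
      fix i assume "i \<in> {j..}"
      then have "s' $ i \<le> s' $ j" "0 \<le> s' $ i" using s' by (auto simp: ordered_cone_def)
      then have "(s' $ i)\<^sup>2 < (s $ j)\<^sup>2" using less by (intro power_strict_mono) auto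
      then show "0 < 1 - (s' $ i)\<^sup>2 / (s $ j)\<^sup>2" using pos by (simp add: field_simps)
    qed
    ultimately show False by linarith
  qed
  assume ne: "s \<noteq> s'"
  define J where "J = {j. s $ j \<noteq> s' $ j}"
  have "J \<noteq> {}" using ne by (auto simp: J_def vec_eq_iff)
  define j where "j = Min J"
  have "j \<in> J" unfolding j_def using \<open>J \<noteq> {}\<close> by (intro Min_in) auto
  then have j: "s $ j \<noteq> s' $ j" by (simp add: J_def)
  have before: "s $ i = s' $ i" if "i < j" for i
  proof (rule ccontr)
    assume "s $ i \<noteq> s' $ i"
    then have "i \<in> J" by (simp add: J_def)
    then have "j \<le> i" unfolding j_def by (intro Min_le) auto
    with that show False by simp
  qed
  have "\<not> s' $ j < s $ j" by (rule no[OF s s' P before])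
  moreover have "\<not> s $ j < s' $ j" by (rule no[OF s' s P[symmetric] before[symmetric]])
  ultimately show False using j by linarith
qed

text \<open>The reversed characteristic polynomial at natural arguments. On the orbit of
  \<open>s\<close> it is the product that \<open>ordered_cone_eqI\<close> compares.\<close>

definition char_det :: "nat \<Rightarrow> complex ^ 'm ^ 'm \<Rightarrow> complex" where
  "char_det t S = det (mat 1 + real t *\<^sub>R (S :: complex ^ 'm::finite ^ 'm))"

lemma char_det_conj:
  assumes v: "v \<in> unitary_group"
  shows "char_det t (conj_transpose v ** S ** v) = char_det t S"
proof -
  have "mat 1 + real t *\<^sub>R (conj_transpose v ** S ** v) = conj_transpose v ** (mat 1 + real t *\<^sub>R S) ** v"
    by (simp add: matrix_mult_algebra unitary_groupD[OF v])
  then have "char_det t (conj_transpose v ** S ** v) = det (conj_transpose v) * char_det t S * det v"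
    by (simp add: char_det_def det_mul)
  also have "\<dots> = det (conj_transpose v ** v) * char_det t S" by (simp add: det_mul)
  finally show ?thesis by (simp add: unitary_groupD[OF v])
qed

lemma char_det_orbit:
  assumes "S \<in> orbit s"
  shows "char_det t S = complex_of_real (\<Prod>j\<in>UNIV. 1 + real t * (s $ j)\<^sup>2)"
proof -
  obtain v where v: "v \<in> unitary_group" and S: "S = conj_transpose (diag_mat s ** v) ** (diag_mat s ** v)"
    using assms by (auto simp: orbit_def)
  have S': "S = conj_transpose v ** (diag_mat s ** diag_mat s) ** v"
    by (simp add: S conj_transpose_mult matrix_mul_assoc)
  have D: "(diag_mat s ** diag_mat s) $ i $ j = (if i = j then complex_of_real ((s $ i)\<^sup>2) else 0)" for i j
    by (simp add: matrix_matrix_mult_def diag_mat_def power2_eq_square if_distrib[of "\<lambda>x. x * _"] if_distrib[of "\<lambda>x. _ * x"] cong: if_cong)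
  have "char_det t S = char_det t (diag_mat s ** diag_mat s)" unfolding S' by (rule char_det_conj[OF v])
  also have "\<dots> = (\<Prod>i\<in>UNIV. (mat 1 + real t *\<^sub>R (diag_mat s ** diag_mat s)) $ i $ i)"
    unfolding char_det_def by (rule det_diagonal) (simp add: D mat_def)
  also have "\<dots> = (\<Prod>i\<in>UNIV. complex_of_real (1 + real t * (s $ i)\<^sup>2))"
    by (intro prod.cong refl) (simp add: D mat_def, simp add: scaleR_conv_of_real)
  finally show ?thesis by simp
qed

lemma avg_gram_unitary_act:
  assumes u: "u \<in> unitary_upto m" and v: "v \<in> unitary_group" and n: "m \<le> n"
  shows "avg_gram n (unitary_act (u, v) X) = v ** avg_gram n X ** conj_transpose v"
  by (simp add: avg_gram_def unitary_act_eq[OF v] cgram_mat_mult_right cgram_mat_mult_left[OF u n] matrix_mult_algebra)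

text \<open>The factor \<open>u\<close> mixes only finitely many rows, so from some height on the
  averaged Gram matrices are merely conjugated by \<open>v\<close>.\<close>

lemma avg_gram_unitary_act_tendsto:
  assumes u: "u \<in> unitary_inf" and v: "v \<in> unitary_group" and r: "strict_mono r"
    and L: "(\<lambda>k. avg_gram (2 ^ r k) X) \<longlonglongrightarrow> L"
  shows "(\<lambda>k. avg_gram (2 ^ r k) (unitary_act (u, v) X)) \<longlonglongrightarrow> v ** L ** conj_transpose v"
proof -
  obtain m where m: "u \<in> unitary_upto m" using unitary_inf_imp_upto[OF u] .
  have "m \<le> 2 ^ r k" if "m \<le> k" for k
  proof -
    have "k \<le> r k" using r by (rule strict_mono_imp_increasing)
    also have "\<dots> \<le> 2 ^ r k" by (rule less_imp_le) (rule less_exp)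
    finally show ?thesis using that by simp
  qed
  then have "eventually (\<lambda>k. v ** avg_gram (2 ^ r k) X ** conj_transpose v = avg_gram (2 ^ r k) (unitary_act (u, v) X)) sequentially"
    by (intro eventually_sequentiallyI[of m]) (simp add: avg_gram_unitary_act[OF m v])
  moreover have "(\<lambda>k. v ** avg_gram (2 ^ r k) X ** conj_transpose v) \<longlonglongrightarrow> v ** L ** conj_transpose v"
    by (intro tendsto_intros L)
  ultimately show ?thesis by (rule Lim_transform_eventually[rotated])
qed

text \<open>Each sublevel set of the real part of \<open>char_det t (S X)\<close> inside the
  convergence set is invariant, hence null or of full measure. Countably many naturals
  \<open>t\<close> and rationals \<open>q\<close> give one almost sure event on which all these
  values agree with those at a single \<open>X0\<close>, whose orbit supplies the parameter
  \<open>s\<close>.\<close>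

proposition ergodic_imp_mu:
  fixes M :: "'m::{finite,linorder} inf_mat measure"
  assumes M: "M \<in> ergodic_measures"
  obtains s where "s \<in> ordered_cone" "M = mu s"
proof -
  have p: "prob_space M" and s: "sets M = sets borel" and inv: "invariant_measure M"
    and erg: "\<And>A. A \<in> sets borel \<Longrightarrow> invariant_set A \<Longrightarrow> emeasure M A = 0 \<or> emeasure M (UNIV - A) = 0"
    using M by (auto simp: ergodic_measures_def borel_prob_measures_def)
  interpret prob_space M by fact
  have sp: "space M = UNIV" using sets_eq_imp_space_eq[OF s] by simp
  obtain r where r: "strict_mono r" and conv: "AE X in M. convergent (\<lambda>k. avg_gram (2 ^ r k) X)"
    using AE_convergent_avg_gram[OF p inv s] .
  define S where "S X = lim (\<lambda>k. avg_gram (2 ^ r k) X)" for X :: "'m inf_mat"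
  have S_lim: "(\<lambda>k. avg_gram (2 ^ r k) X) \<longlonglongrightarrow> S X" if "convergent (\<lambda>k. avg_gram (2 ^ r k) X)" for X
    using that by (simp add: S_def convergent_LIMSEQ_iff)
  have "\<exists>b. AE X in M. (Re (char_det t (S X)) \<le> q) = b" for t :: nat and q :: real
  proof -
    define A where "A = {X :: 'm inf_mat. convergent (\<lambda>k. avg_gram (2 ^ r k) X)} \<inter> {X \<in> space borel. Re (char_det t (S X)) \<le> q}"
    have [measurable]: "{X :: 'm inf_mat. convergent (\<lambda>k. avg_gram (2 ^ r k) X)} \<in> sets borel" by (rule convergent_avg_gram_sets)
    have [measurable]: "S \<in> borel_measurable borel" unfolding S_def [abs_def] by measurable
    have A: "A \<in> sets borel" unfolding A_def char_det_def by measurable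
    have "invariant_set A"
    proof (rule invariant_setI)
      fix u and v :: "complex ^ 'm::{finite,linorder} ^ 'm::{finite,linorder}" and X
      assume u: "u \<in> unitary_inf" and v: "v \<in> unitary_group" and X: "X \<in> A"
      then have l: "(\<lambda>k. avg_gram (2 ^ r k) X) \<longlonglongrightarrow> S X" by (intro S_lim) (simp add: A_def)
      note l' = avg_gram_unitary_act_tendsto[OF u v r l]
      have "S (unitary_act (u, v) X) = v ** S X ** conj_transpose v"
        unfolding S_def[of "unitary_act (u, v) X"] by (rule limI[OF l'])
      then have "char_det t (S (unitary_act (u, v) X)) = char_det t (S X)"
        using char_det_conj[OF conj_transpose_unitary[OF v]] by simp
      then show "unitary_act (u, v) X \<in> A" using X convergentI[OF l'] by (simp add: A_def)
    qed
    from erg[OF A this] show ?thesis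
    proof
      assume "emeasure M A = 0"
      then have "AE X in M. X \<notin> A" using A s by (intro AE_not_in) (auto simp: null_sets_def)
      with conv have "AE X in M. (Re (char_det t (S X)) \<le> q) = False"
        by eventually_elim (auto simp: A_def)
      then show ?thesis ..
    next
      assume "emeasure M (UNIV - A) = 0"
      then have "AE X in M. X \<notin> UNIV - A" using A s by (intro AE_not_in) (auto simp: null_sets_def)
      then have "AE X in M. (Re (char_det t (S X)) \<le> q) = True"
        by eventually_elim (auto simp: A_def)
      then show ?thesis ..
    qed
  qed
  then obtain b where "\<And>t q. AE X in M. (Re (char_det t (S X)) \<le> q) = b t q" by metis
  then have all: "AE X in M. \<forall>t::nat. \<forall>q::rat. (Re (char_det t (S X)) \<le> of_rat q) = b t (of_rat q)"
    by (intro AE_all_countable[THEN iffD2] allI)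
  have orb: "AE X in M. \<exists>s \<in> ordered_cone. S X \<in> orbit s"
    using conv
  proof eventually_elim
    case (elim X)
    have "psd (S X)" by (rule psd_tendsto[OF S_lim[OF elim]]) (auto simp: psd_avg_gram)
    then show ?case by (rule psd_diagonalization) (auto simp: orbit_def)
  qed
  \<comment> \<open>An almost sure event of a probability measure is nonempty.\<close>
  have "\<exists>X. (\<exists>s \<in> ordered_cone. S X \<in> orbit s) \<and> (\<forall>t::nat. \<forall>q::rat. (Re (char_det t (S X)) \<le> of_rat q) = b t (of_rat q))"
  proof (rule ccontr)
    assume none: "\<not> ?thesis"
    from all orb have "AE X in M. False" by eventually_elim (use none in blast)
    then show False by simp
  qed
  then obtain X0 s where s: "s \<in> ordered_cone" and X0: "S X0 \<in> orbit s"
    and b: "\<And>(t::nat) (q::rat). (Re (char_det t (S X0)) \<le> of_rat q) = b t (of_rat q)" by blast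
  have "AE X in M. has_limit_in_orbit r s X"
    using conv all orb
  proof eventually_elim
    case (elim X)
    from elim(3) obtain s' where s': "s' \<in> ordered_cone" "S X \<in> orbit s'" by blast
    have "Re (char_det t (S X)) = Re (char_det t (S X0))" for t
    proof (rule ccontr)
      assume "Re (char_det t (S X)) \<noteq> Re (char_det t (S X0))"
      then consider "Re (char_det t (S X)) < Re (char_det t (S X0))" | "Re (char_det t (S X0)) < Re (char_det t (S X))" by linarith
      then show False
      proof cases
        case 1
        then obtain q where "Re (char_det t (S X)) < of_rat q" "of_rat q < Re (char_det t (S X0))" using of_rat_dense by blast
        then show False using elim(2)[rule_format, of t q] b[of t q] by auto
      next
        case 2
        then obtain q where "Re (char_det t (S X0)) < of_rat q" "of_rat q < Re (char_det t (S X))" using of_rat_dense by blast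
        then show False using elim(2)[rule_format, of t q] b[of t q] by auto
      qed
    qed
    then have "s' = s"
      unfolding char_det_orbit[OF X0] char_det_orbit[OF s'(2)] Re_complex_of_real by (intro ordered_cone_eqI s s')
    then show ?case using elim(1) s'(2) by (simp add: has_limit_in_orbit_def S_def)
  qed
  then have "M = mu s" by (rule eq_mu_of_limit_in_orbit[OF p inv \<open>sets M = sets borel\<close> r])
  with s show ?thesis by (rule that)
qed

section \<open>Functionals of the first row and the weak topology\<close>

lemma norm_vector_matrix_unitary:
  assumes "w \<in> unitary_group"
  shows "norm (x v* w) = norm x"
proof -
  have "(x v* w) \<bullet> (x v* w) = x \<bullet> x"
    by (simp add: inner_vector_matrix_mult vector_matrix_mul_assoc unitary_groupD[OF assms])
  then show ?thesis by (simp add: norm_eq_sqrt_inner)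
qed

text \<open>The norm of a row is invariant under unitary right multiplication, so the Haar factor
  drops out; a single row already determines all \<open>s_j\<close>.\<close>

definition first_row_test :: "nat \<Rightarrow> 'm::finite inf_mat \<Rightarrow>\<^sub>C real" where
  "first_row_test t = Bcontfun (\<lambda>X. exp (- (real t * (norm (X 0))\<^sup>2)))"

lemma apply_first_row_test: "apply_bcontfun (first_row_test t) X = exp (- (real t * (norm (X 0))\<^sup>2))"
proof -
  have "(\<lambda>X :: 'a inf_mat. exp (- (real t * (norm (X 0))\<^sup>2))) \<in> bcontfun"
    unfolding bcontfun_def
    by (auto intro!: continuous_intros continuous_on_product_coordinates boundedI[of _ 1])
  then show ?thesis by (simp add: first_row_test_def Bcontfun_inverse)
qed

text \<open>Without the unitary factor the entries of the row are independent Gaussians scaled by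
  \<open>s_j\<close>, and each contributes \<open>1 / (1 + t s_j^2)\<close>.\<close>

lemma integral_first_row_test:
  fixes s :: "real ^ 'm::finite"
  shows "(\<integral>X. apply_bcontfun (first_row_test t) X \<partial>mu s) = (\<Prod>j\<in>UNIV. 1 / (1 + real t * (s $ j)\<^sup>2))"
proof -
  let ?f = "\<lambda>x :: complex ^ 'm. exp (- (real t * (norm x)\<^sup>2))"
  have [measurable]: "(\<lambda>X :: 'm inf_mat. ?f (X 0)) \<in> borel_measurable borel" by measurable
  have [measurable]: "(\<lambda>X :: 'm inf_mat. ?f (X 0 v* diag_mat s)) \<in> borel_measurable borel"
    unfolding vector_matrix_mult_def by measurable
  have "(\<integral>X. apply_bcontfun (first_row_test t) X \<partial>mu s) =
      (\<integral>w. (\<integral>G. ?f (mat_mult_right G (diag_mat s ** w) 0) \<partial>gaussian_matrix) \<partial>haar_unitary)"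
    unfolding apply_first_row_test by (rule integral_mu[where B=1]) auto
  also have "\<dots> = (\<integral>w. (\<integral>G. ?f (G 0 v* diag_mat s) \<partial>gaussian_matrix) \<partial>(haar_unitary :: (complex ^ 'm ^ 'm) measure))"
    by (intro Bochner_Integration.integral_cong refl)
      (simp add: mat_mult_right_def norm_vector_matrix_unitary flip: vector_matrix_mul_assoc)
  also have "\<dots> = (\<integral>G. ?f (G 0 v* diag_mat s) \<partial>gaussian_matrix)"
    by (simp add: haar.prob_space[simplified])
  also have "\<dots> = (\<integral>w. ?f (rows_of w 0 v* diag_mat s) \<partial>gauss_entries)"
    unfolding gaussian_matrix_eq by (subst integral_distr) auto
  also have "\<dots> = (\<integral>w. (\<Prod>p\<in>{0::nat} \<times> (UNIV :: 'm set). exp (- (real t * (s $ snd p)\<^sup>2 * (norm (w p))\<^sup>2))) \<partial>gauss_entries)"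
  proof (intro Bochner_Integration.integral_cong refl)
    fix w :: "nat \<times> 'm \<Rightarrow> complex"
    have c: "(rows_of w 0 v* diag_mat s) $ j = w (0, j) * complex_of_real (s $ j)" for j
      by (simp add: vector_matrix_mult_nth rows_of_def diag_mat_def if_distrib[of "\<lambda>x. _ * x"] cong: if_cong)
    have "(norm (rows_of w 0 v* diag_mat s))\<^sup>2 = (\<Sum>j\<in>UNIV. (norm (w (0, j)))\<^sup>2 * (s $ j)\<^sup>2)"
      by (simp add: norm_vec_def L2_set_def sum_nonneg c norm_mult power_mult_distrib)
    then have "?f (rows_of w 0 v* diag_mat s) = (\<Prod>j\<in>UNIV. exp (- (real t * (s $ j)\<^sup>2 * (norm (w (0, j)))\<^sup>2)))"
      by (simp add: exp_sum[symmetric] sum_distrib_left sum_negf mult_ac)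
    also have "\<dots> = (\<Prod>p\<in>{0} \<times> UNIV. exp (- (real t * (s $ snd p)\<^sup>2 * (norm (w p))\<^sup>2)))"
      by (rule prod.reindex_bij_witness[of _ snd "\<lambda>j. (0, j)"]) auto
    finally show "?f (rows_of w 0 v* diag_mat s) = (\<Prod>p\<in>{0} \<times> UNIV. exp (- (real t * (s $ snd p)\<^sup>2 * (norm (w p))\<^sup>2)))" .
  qed
  also have "\<dots> = (\<Prod>p\<in>{0::nat} \<times> (UNIV :: 'm set). \<integral>z. exp (- (real t * (s $ snd p)\<^sup>2 * (norm z)\<^sup>2)) \<partial>complex_gaussian)"
  proof (rule gauss_entries_integral_prod[where f="\<lambda>p z. exp (- (real t * (s $ snd p)\<^sup>2 * (norm z)\<^sup>2))"])
    show m: "(\<lambda>z::complex. exp (- (real t * (s $ snd p)\<^sup>2 * (norm z)\<^sup>2))) \<in> borel_measurable borel" for p :: "nat \<times> 'm"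
      by (intro borel_measurable_continuous_onI continuous_intros)
    show "integrable complex_gaussian (\<lambda>z. exp (- (real t * (s $ snd p)\<^sup>2 * (norm z)\<^sup>2)))" for p :: "nat \<times> 'm"
      using m[of p] by (intro complex_gaussian.integrable_const_bound[where B=1])
        (auto simp: measurable_cong_sets[OF sets_complex_gaussian refl])
  qed simp
  also have "\<dots> = (\<Prod>p\<in>{0::nat} \<times> (UNIV :: 'm set). 1 / (1 + real t * (s $ snd p)\<^sup>2))"
    by (intro prod.cong refl complex_gaussian_exp_norm_square) simp
  also have "\<dots> = (\<Prod>j\<in>UNIV. 1 / (1 + real t * (s $ j)\<^sup>2))"
    by (rule prod.reindex_bij_witness[of _ "\<lambda>j. (0, j)" snd]) auto
  finally show ?thesis .
qed

text \<open>All \<open>mu s\<close> are images of one fixed measure under maps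
  \<open>spread s\<close> that depend continuously on \<open>s\<close>, so dominated convergence
  applies.\<close>

lemma continuous_integral_mu:
  fixes f :: "'m::finite inf_mat \<Rightarrow>\<^sub>C real"
  shows "continuous_on S (\<lambda>s. \<integral>X. apply_bcontfun f X \<partial>mu s)"
proof (rule continuous_on_sequentiallyI)
  fix u :: "nat \<Rightarrow> real ^ 'm" and a assume u: "u \<longlonglongrightarrow> a"
  have cf: "continuous_on UNIV (apply_bcontfun f)" and bf: "bounded (range (apply_bcontfun f))"
    using apply_bcontfun[of f] by (auto simp: bcontfun_def)
  obtain B where B: "\<And>X. norm (apply_bcontfun f X) \<le> B" using bf by (auto simp: bounded_iff)
  have [measurable]: "apply_bcontfun f \<in> borel_measurable borel" by (rule borel_measurable_continuous_onI[OF cf])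
  have e: "(\<integral>X. apply_bcontfun f X \<partial>mu s) = (\<integral>p. apply_bcontfun f (spread s p) \<partial>(gaussian_matrix \<Otimes>\<^sub>M haar_unitary))" for s
    unfolding mu_eq by (subst integral_distr) auto
  show "(\<lambda>n. \<integral>X. apply_bcontfun f X \<partial>mu (u n)) \<longlonglongrightarrow> (\<integral>X. apply_bcontfun f X \<partial>mu a)"
    unfolding e
  proof (rule integral_dominated_convergence[where w="\<lambda>_. B"])
    show "AE p in gaussian_matrix \<Otimes>\<^sub>M haar_unitary. (\<lambda>n. apply_bcontfun f (spread (u n) p)) \<longlonglongrightarrow> apply_bcontfun f (spread a p)"
    proof (rule AE_I2)
      fix p :: "'m inf_mat \<times> (complex ^ 'm ^ 'm)"
      have d: "continuous_on UNIV (\<lambda>s :: real ^ 'm. if i = j then complex_of_real (s $ i) else 0)" for i j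
        by (cases "i = j") (auto intro!: continuous_intros)
      have "continuous_on UNIV (\<lambda>s. spread s p)"
        unfolding spread_def mat_mult_right_def vector_matrix_mult_def matrix_matrix_mult_def diag_mat_def
        by simp (intro d continuous_on_coordinatewise_then_product continuous_intros)
      then have "continuous_on UNIV (\<lambda>s. apply_bcontfun f (spread s p))"
        by (intro continuous_on_compose2[OF cf]) auto
      then show "(\<lambda>n. apply_bcontfun f (spread (u n) p)) \<longlonglongrightarrow> apply_bcontfun f (spread a p)"
        using u by (rule continuous_on_tendsto_compose) auto
    qed
  qed (use B in auto)
qed

theorem theorem1p3:
  shows "(\<forall>s \<in> ordered_cone. mu (s :: real ^ 'm::{finite,linorder}) \<in> ergodic_measures) \<and>
         homeomorphic_map
           (subtopology euclidean ordered_cone)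
           (subtopology weak_topology ergodic_measures)
           (mu :: real ^ 'm::{finite,linorder} \<Rightarrow> _)"
proof (intro conjI ballI mu_ergodic)
  let ?X = "subtopology euclidean (ordered_cone :: (real ^ 'm::{finite,linorder}) set)"
  let ?Y = "subtopology weak_topology (ergodic_measures :: 'm inf_mat measure set)"
  define I where "I \<mu> = (\<lambda>f :: 'm inf_mat \<Rightarrow>\<^sub>C real. \<integral>x. apply_bcontfun f x \<partial>\<mu>)" for \<mu>
  \<comment> \<open>Countably many weakly continuous functionals: together they separate the
    parameters, and the value at 1 controls the size of \<open>s\<close>.\<close>
  define H where "H \<mu> = (\<lambda>t. I \<mu> (first_row_test t))" for \<mu>
  have mu_prob: "mu s \<in> borel_prob_measures" for s :: "real ^ 'm::{finite,linorder}"
    using mu_ergodic[of s] by (simp add: ergodic_measures_def)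
  have weak: "weak_topology = pullback_topology borel_prob_measures I euclidean"
    by (simp add: weak_topology_def I_def [abs_def])
  have topY: "topspace ?Y = ergodic_measures"
    by (auto simp: weak topspace_pullback_topology ergodic_measures_def)
  have cont_I: "continuous_on S (\<lambda>s. I (mu s))" for S
    by (rule continuous_on_coordinatewise_then_product) (simp add: I_def continuous_integral_mu)
  have H_mu: "H (mu s) t = (\<Prod>j\<in>UNIV. 1 / (1 + real t * (s $ j)\<^sup>2))" for s t
    by (simp add: H_def I_def integral_first_row_test)
  have inj: "s = s'" if "s \<in> ordered_cone" "s' \<in> ordered_cone" "H (mu s) = H (mu s')" for s s'
  proof (rule ordered_cone_eqI[OF that(1,2)])
    fix n :: nat
    have "H (mu s) n = H (mu s') n" using that(3) by simp
    then show "(\<Prod>j\<in>UNIV. 1 + real n * (s $ j)\<^sup>2) = (\<Prod>j\<in>UNIV. 1 + real n * (s' $ j)\<^sup>2)"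
      by (simp add: H_mu prod_dividef)
  qed
  have cont_H: "continuous_on S (\<lambda>s. H (mu s))" for S
    unfolding H_def by (intro continuous_on_coordinatewise_then_product continuous_on_product_then_coordinatewise[OF cont_I])
  show "homeomorphic_map ?X ?Y mu"
  proof (rule bijective_open_imp_homeomorphic_map)
    have "continuous_map euclidean weak_topology (mu :: real ^ 'm::{finite,linorder} \<Rightarrow> _)"
      unfolding weak using cont_I[of UNIV] mu_prob by (intro continuous_map_pullback') (auto simp: comp_def)
    then show "continuous_map ?X ?Y mu"
      using mu_ergodic by (auto simp: continuous_map_in_subtopology intro: continuous_map_from_subtopology)
    show "mu ` topspace ?X = topspace ?Y"
    proof
      show "mu ` topspace ?X \<subseteq> topspace ?Y" unfolding topY using mu_ergodic by auto
      show "topspace ?Y \<subseteq> mu ` topspace ?X" unfolding topY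
      proof
        fix M assume "M \<in> (ergodic_measures :: 'm inf_mat measure set)"
        then obtain s where "s \<in> ordered_cone" "M = mu s" by (rule ergodic_imp_mu)
        then show "M \<in> mu ` topspace ?X" by simp
      qed
    qed
    show "inj_on mu (topspace ?X)" using inj by (auto intro!: inj_onI)
    show "open_map ?X ?Y mu"
      unfolding open_map_def
    proof (intro allI impI)
      fix U assume U: "openin ?X U"
      then obtain V where V: "open V" "U = V \<inter> ordered_cone" by (auto simp: openin_open)
      show "openin ?Y (mu ` U)"
      proof (subst openin_subopen, intro ballI)
        fix \<mu> assume "\<mu> \<in> mu ` U"
        then obtain s0 where s0: "s0 \<in> U" "\<mu> = mu s0" by blast
        \<comment> \<open>Any number strictly between 0 and \<open>H (mu s0) 1\<close> would do:
          \<open>c \<le> H (mu s) 1\<close> bounds \<open>s\<close>, and \<open>s0\<close> satisfies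
          it strictly.\<close>
        define c where "c = H (mu s0) 1 / 2"
        have pos: "H (mu s) 1 > 0" for s
          unfolding H_mu by (intro prod_pos) (auto intro!: divide_pos_pos add_pos_nonneg)
        have c: "0 < c" "c < H (mu s0) 1" using pos[of s0] by (auto simp: c_def)
        \<comment> \<open>The parameters outside \<open>V\<close> that the bound does not exclude.
          Their image under \<open>H\<close> is compact and by injectivity misses the value at
          \<open>s0\<close>, so its complement yields a neighbourhood.\<close>
        define K where "K = {s \<in> ordered_cone. c \<le> H (mu s) 1} - V"
        have "compact K"
        proof (rule compact_eq_bounded_closed[THEN iffD2], rule conjI)
          have "closed (ordered_cone :: (real ^ 'm::{finite,linorder}) set)"
            unfolding ordered_cone_def
            by (intro closed_Collect_conj closed_Collect_all closed_Collect_imp closed_Collect_le continuous_intros open_Collect_const)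
          moreover have "closed {s. c \<le> H (mu s) 1}"
            by (intro closed_Collect_le continuous_intros continuous_on_product_then_coordinatewise[OF cont_H])
          ultimately show "closed K" unfolding K_def using V(1)
            by (auto intro!: closed_Diff simp: Collect_conj_eq closed_Int)
          have "\<bar>s $ j\<bar> \<le> sqrt (1 / c)" if "s \<in> K" for s j
          proof -
            have "c \<le> (\<Prod>i\<in>UNIV. 1 / (1 + (s $ i)\<^sup>2))" using that by (simp add: K_def H_mu)
            \<comment> \<open>All factors are at most 1, so the product bounds each coordinate
              separately.\<close>
            also have "\<dots> = 1 / (1 + (s $ j)\<^sup>2) * (\<Prod>i\<in>UNIV - {j}. 1 / (1 + (s $ i)\<^sup>2))"
              by (rule prod.remove) auto
            also have "\<dots> \<le> 1 / (1 + (s $ j)\<^sup>2) * 1"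
              by (intro mult_left_mono prod_le_1) (auto simp: divide_le_eq_1 add_pos_nonneg)
            finally have "c * (1 + (s $ j)\<^sup>2) \<le> 1" by (simp add: field_simps add_pos_nonneg)
            then have "(s $ j)\<^sup>2 \<le> 1 / c" using c(1) by (simp add: field_simps)
            then show ?thesis using real_le_rsqrt[of "\<bar>s $ j\<bar>" "1 / c"] by simp
          qed
          then have "norm s \<le> (\<Sum>j::'m\<in>UNIV. sqrt (1 / c))" if "s \<in> K" for s
            using that by (intro order_trans[OF norm_le_l1_cart] sum_mono)
          then show "bounded K" by (auto simp: bounded_iff)
        qed
        then have cl: "closed ((\<lambda>s. H (mu s)) ` K)"
          by (intro compact_imp_closed compact_continuous_image cont_H)
        define W where "W = - ((\<lambda>s. H (mu s)) ` K) \<inter> {h. c < h 1}"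
        have W: "open W"
          unfolding W_def using cl
          by (intro open_Int open_Collect_less continuous_intros continuous_on_product_coordinates) (auto simp: open_Compl)
        \<comment> \<open>Membership in \<open>W\<close> is an open condition on integrals of
          bounded continuous functions, so \<open>Q\<close> is open in the weak topology on
          \<open>ergodic_measures\<close>.\<close>
        define Q where "Q = I -` ((\<lambda>y t. y (first_row_test t)) -` W) \<inter> borel_prob_measures \<inter> ergodic_measures"
        have "open ((\<lambda>y t. y (first_row_test t)) -` W)"
          by (rule open_vimage[OF W]) (intro continuous_on_coordinatewise_then_product continuous_on_product_coordinates)
        then have "openin weak_topology (I -` ((\<lambda>y t. y (first_row_test t)) -` W) \<inter> borel_prob_measures)"
          unfolding weak openin_pullback_topology by auto
        then have op: "openin ?Y Q" unfolding Q_def by (auto simp: openin_subtopology)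
        have mem: "mu s \<in> Q \<longleftrightarrow> H (mu s) \<in> W" for s
          using mu_prob[of s] mu_ergodic[of s] by (simp add: Q_def H_def)
        have "H (mu s0) \<in> W"
        proof -
          have "H (mu s0) \<notin> (\<lambda>s. H (mu s)) ` K"
          proof
            assume "H (mu s0) \<in> (\<lambda>s. H (mu s)) ` K"
            then obtain s where "s \<in> K" "H (mu s0) = H (mu s)" by blast
            then have "s0 = s" using s0(1) V(2) by (intro inj) (auto simp: K_def)
            then show False using \<open>s \<in> K\<close> s0(1) V(2) by (auto simp: K_def)
          qed
          then show ?thesis using c(2) by (simp add: W_def)
        qed
        moreover have "Q \<subseteq> mu ` U"
        proof
          fix M assume M: "M \<in> Q"
          then obtain s where s: "s \<in> ordered_cone" "M = mu s" unfolding Q_def using ergodic_imp_mu by blast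
          then have "H (mu s) \<in> W" using M mem by simp
          then have "c < H (mu s) 1" "s \<notin> K" by (auto simp: W_def)
          then have "s \<in> V" using s(1) by (auto simp: K_def)
          then show "M \<in> mu ` U" using s V(2) by auto
        qed
        ultimately show "\<exists>T. openin ?Y T \<and> \<mu> \<in> T \<and> T \<subseteq> mu ` U"
          using op mem[of s0] s0(2) by blast
      qed
    qed
  qed
qed

end
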